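(* Let $p$ be a prime. There is a constant $c$ (depending only on $p$) such that for all $\ell\ge 1$: if $p\ge 3$, then $$p^{\frac{2}{27}\ell^3-\frac{2}{3}\ell^2}\le f_{\mathfrak{B}_{p,2}}(p^\ell)\le p^{\frac{2}{27}\ell^3-\frac{2}{3}\ell^2+c\ell},$$ and (for every prime $p$) $$p^{\frac{2}{27}\ell^3-\frac{4}{9}\ell^2}\le f_{\mathfrak{H}_p}(p^\ell)\le p^{\frac{2}{27}\ell^3-\frac{4}{9}\ell^2+c\ell}.$$
   Context: All groups are finite. $\mathfrak{B}_{p,2}$ denotes the class of $p$-groups $G$ of class (at most) $2$ and exponent $p$, i.e. $[G,G]\le Z(G)$ and $g^p=1$ for all $g\in G$. $\mathfrak{H}_p$ denotes the class of $p$-groups of Frattini class $2$, i.e. $p$-groups whose Frattini subgroup is central and elementary abelian (equivalently $g^{p^2}=1$, $[g,h]^p=1$ and $[g,[h,k]]=1$ for all $g,h,k\in G$). $f_{\mathfrak{B}_{p,2}}(p^\ell)$ (resp. $f_{\mathfrak{H}_p}(p^\ell)$) is the number of isomorphism classes of groups of order $p^\ell$ in $\mathfrak{B}_{p,2}$ (resp. $\mathfrak{H}_p$). *)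

theory Defs
  imports Complex_Main "HOL-Algebra.Generated_Groups" "HOL-Computational_Algebra.Primes"
begin

definition p_group :: "nat \<Rightarrow> ('a, 'b) monoid_scheme \<Rightarrow> bool" where
  "p_group p G \<longleftrightarrow> group G \<and> (\<exists>k. order G = p ^ k)"

definition group_center :: "('a, 'b) monoid_scheme \<Rightarrow> 'a set" where
  "group_center G =
     {z \<in> carrier G. \<forall>g \<in> carrier G. z \<otimes>\<^bsub>G\<^esub> g = g \<otimes>\<^bsub>G\<^esub> z}"

definition maximal_subgroup :: "'a set \<Rightarrow> ('a, 'b) monoid_scheme \<Rightarrow> bool" where
  "maximal_subgroup M G \<longleftrightarrow> subgroup M G \<and> M \<noteq> carrier G \<and>
     (\<forall>H. subgroup H G \<longrightarrow> M \<subseteq> H \<longrightarrow> H = M \<or> H = carrier G)"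

text \<open>Intersecting with the carrier gives the usual convention that the Frattini subgroup is
  the whole group when there are no maximal subgroups (for a finite group: when it is trivial).\<close>

definition frattini :: "('a, 'b) monoid_scheme \<Rightarrow> 'a set" where
  "frattini G = carrier G \<inter> \<Inter> {M. maximal_subgroup M G}"

text \<open>As usual, the trivial group counts as elementary abelian.\<close>

definition elementary_abelian :: "nat \<Rightarrow> ('a, 'b) monoid_scheme \<Rightarrow> bool" where
  "elementary_abelian p G \<longleftrightarrow> comm_group G \<and> (\<forall>x \<in> carrier G. x [^]\<^bsub>G\<^esub> p = \<one>\<^bsub>G\<^esub>)"

text \<open>\<open>p\<close>-groups of class at most 2 and exponent (dividing) \<open>p\<close>.\<close>

definition class_B :: "nat \<Rightarrow> ('a, 'b) monoid_scheme \<Rightarrow> bool" where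
  "class_B p G \<longleftrightarrow> p_group p G \<and>
     derived G (carrier G) \<subseteq> group_center G \<and>
     (\<forall>g \<in> carrier G. g [^]\<^bsub>G\<^esub> p = \<one>\<^bsub>G\<^esub>)"

text \<open>\<open>p\<close>-groups of Frattini class 2.\<close>

definition class_H :: "nat \<Rightarrow> ('a, 'b) monoid_scheme \<Rightarrow> bool" where
  "class_H p G \<longleftrightarrow> p_group p G \<and>
     frattini G \<subseteq> group_center G \<and>
     elementary_abelian p (G\<lparr>carrier := frattini G\<rparr>)"

text \<open>The number of isomorphism classes of groups of order \<open>n\<close> (for \<open>n > 0\<close>) with an
  isomorphism-invariant property \<open>P\<close>. Every finite group is isomorphic to one whose elements are
  natural numbers, so it suffices to count isomorphism classes of groups on subsets of \<open>nat\<close>.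
  The set of such groups is infinite, but its quotient by isomorphism is finite, since
  every class is determined by a multiplication table on \<open>{..<n}\<close>.\<close>

definition groups_of_order :: "(nat monoid \<Rightarrow> bool) \<Rightarrow> nat \<Rightarrow> nat monoid set" where
  "groups_of_order P n = {G. group G \<and> order G = n \<and> P G}"

definition num_iso_classes :: "(nat monoid \<Rightarrow> bool) \<Rightarrow> nat \<Rightarrow> nat" where
  "num_iso_classes P n = card (groups_of_order P n //
     {(G, H). G \<in> groups_of_order P n \<and> H \<in> groups_of_order P n \<and> G \<cong> H})"

lemma equiv_iso_groups_of_order:
  "equiv (groups_of_order P n)
     {(G, H). G \<in> groups_of_order P n \<and> H \<in> groups_of_order P n \<and> G \<cong> H}"
  by (auto simp: equiv_def refl_on_def sym_def trans_def groups_of_order_def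
      intro: iso_refl group.iso_sym iso_trans)

definition f_B :: "nat \<Rightarrow> nat \<Rightarrow> nat" where
  "f_B p n = num_iso_classes (class_B p) n"

definition f_H :: "nat \<Rightarrow> nat \<Rightarrow> nat" where
  "f_H p n = num_iso_classes (class_H p) n"

end

theory Submission
  imports Defs "HOL-Algebra.Group_Action" "HOL-Algebra.Multiplicative_Group" "HOL-Number_Theory.Cong"
begin

text \<open>
  Upper bounds. A group \<open>G\<close> of order \<open>p\<^sup>l\<close> in either class has a central subgroup \<open>Z\<close> of exponent
  \<open>p\<close> with \<open>G/Z\<close> elementary abelian (the centre, respectively the Frattini subgroup). Let
  \<open>|G/Z| = p\<^sup>d\<close> and \<open>|Z| = p\<^sup>s\<close>. A framing identifies \<open>G/Z\<close> with \<open>V = GF(p)\<^sup>d\<close> and \<open>Z\<close> with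
  \<open>W = GF(p)\<^sup>s\<close>; the commutator form \<open>V \<times> V \<rightarrow> W\<close> and the \<open>p\<close>-th powers of a basis determine \<open>G\<close>.
  Counting framings, the number of groups times \<open>|GL(V)| |GL(W)|\<close> is at most the sum of the orders of
  the stabilisers of all forms. Once the images of \<open>m = 32\<close> basis vectors are prescribed, which
  costs only a factor \<open>p^O(l)\<close>, a stabiliser embeds into the set of pairs \<open>(g, h)\<close> that
  intertwine \<open>m\<close> essentially arbitrary linear maps \<open>V \<rightarrow> W\<close>. Hence everything reduces to bounding
  \<open>\<Sum>(g,h). |Hom(g, h)|^m\<close>, where \<open>Hom(g, h) = {A. A g = h A}\<close>. Let \<open>K\<close> be a largest subspace of \<open>V\<close>
  with \<open>K \<inter> g^-1 K = 0\<close>, of dimension \<open>j\<close>. A map in \<open>Hom(g, h)\<close> is determined on \<open>g K\<close> by its values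
  on \<open>K\<close>, so \<open>|Hom(g, h)| \<le> p^(s(d - j))\<close>; likewise, for a subspace \<open>K\<close> of \<open>W\<close> with
  \<open>K \<inter> h^-1 K = 0\<close>, it is determined by its values modulo \<open>K\<close>. On the other hand \<open>g\<close> is a scalar modulo \<open>K + g K\<close> by
  maximality of \<open>K\<close>, so only about \<open>p^(4jd)\<close> maps \<open>g\<close> have a given \<open>j\<close>. When \<open>d\<close> is far from
  \<open>2l/3\<close>, the number of forms alone is small enough.

  Lower bounds. Let \<open>d = \<lfloor>2l/3\<rfloor>\<close> and \<open>s = l - d\<close>. Normalise the structure constants so that a basis
  of \<open>W\<close> consists of \<open>s\<close> of the commutators (respectively \<open>p\<close>-th powers) of the generators. An
  isomorphism between two such groups that maps generators to generators modulo central elements of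
  order \<open>p\<close> forces the structure constants to agree, so each isomorphism class arises at most
  \<open>p\<close> to the power \<open>d\<^sup>2\<close> times.
\<close>

section \<open>Adjoining elements to a subgroup\<close>

text \<open>The exponent \<open>s * (d * (d - 1) div 2)\<close> of the number of forms exceeds the
  claimed bound by about \<open>d^2 + s^2\<close>, the exponent of |GL(V)| |GL(W)|. So stabilisers
  must have size \<open>p^O(l)\<close> on average; losing \<open>l^2\<close> anywhere is fatal.
  Fixing \<open>m\<close> basis vectors replaces the condition on the form, quadratic in
  \<open>g\<close>, by the conditions \<open>A g = h A\<close> on \<open>m\<close> of its rows, and
  then the sum over \<open>(g, h)\<close> factorises. Half of the \<open>m\<close> rows pay for the
  number of \<open>g\<close>, half for the number of \<open>h\<close>: with \<open>m = 2 r\<close>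
  this takes \<open>4 d <= r s\<close> and \<open>4 s <= r d\<close>. If neither of
  \<open>d\<close>, \<open>s\<close> exceeds four times the other, \<open>r = 16\<close> will do,
  whence \<open>m = 32\<close>. Outside this range the trivial count has cubic coefficient at most
  \<open>8/125 < 2/27\<close>. The lower bound has the same quadratic terms: normalising costs
  \<open>s^2\<close>, the images of generators \<open>d^2\<close>. At \<open>d = 2l/3\<close> both
  exponents become the claimed ones, with \<open>s d\<close> added for the \<open>p\<close>-th
  powers in the second class. Vector spaces over GF(p) appear as elementary abelian groups: scalars
  are natural exponents, and spans grow by adjoining one element at a time.\<close>

context group
begin

text \<open>Left multiplication by an element of \<open>H\<close> is an injective self-map of a
  finite set, hence onto; preimages of \<open>x\<close> and of \<open>\<one>\<close> yield the
  identity and the inverse.\<close>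

lemma finite_closed_subgroup:
  assumes "finite (carrier G)" "H \<subseteq> carrier G" "H \<noteq> {}"
    and closed: "\<And>x y. x \<in> H \<Longrightarrow> y \<in> H \<Longrightarrow> x \<otimes> y \<in> H"
  shows "subgroup H G"
proof (rule subgroupI[OF assms(2,3)])
  fix x assume x: "x \<in> H"
  have fin: "finite H" using assms(1,2) finite_subset by blast
  have "inj_on (\<lambda>y. x \<otimes> y) H"
    using inj_on_cmult[of x] x assms(2) by (meson inj_on_subset subsetD)
  then have surj: "(\<lambda>y. x \<otimes> y) ` H = H"
    using endo_inj_surj[OF fin] closed x by blast
  then obtain e where e: "e \<in> H" "x \<otimes> e = x" using x by (metis (no_types, lifting) imageE)
  then have "\<one> \<in> H" using x assms(2) l_cancel_one by (metis subsetD)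
  then obtain y where y: "y \<in> H" "x \<otimes> y = \<one>" using surj by (metis (no_types, lifting) imageE)
  then show "inv x \<in> H" using x assms(2) inv_equality inv_comm
    by (metis subsetD)
qed (use closed in auto)

text \<open>Bezout. With \<open>b = p\<close> this is the group version of dividing a vector by a
  nonzero scalar.\<close>

lemma pow_coprime_mem:
  assumes K: "subgroup K G" and y: "y \<in> carrier G"
    and "y [^] (a::nat) \<in> K" "y [^] (b::nat) \<in> K" "coprime a b"
  shows "y \<in> K"
proof -
  obtain u v where uv: "u * int a + v * int b = 1"
    using bezout_int[of "int a" "int b"] assms(5) by (metis coprime_iff_gcd_eq_1 coprime_int_iff)
  have "y = y [^] (u * int a + v * int b)" using y uv by (simp add: int_pow_1)
  also have "\<dots> = (y [^] int a) [^] u \<otimes> (y [^] int b) [^] v"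
    using y by (simp add: int_pow_mult int_pow_pow mult.commute)
  also have "\<dots> \<in> K"
    using assms by (simp add: int_pow_int subgroup.m_closed subgroup_int_pow_closed)
  finally show ?thesis .
qed

text \<open>Nonnegative exponents are enough in a finite group; when \<open>y\<close> normalises
  \<open>K\<close> this is the subgroup generated by both.\<close>

definition adjoin :: "'a set \<Rightarrow> 'a \<Rightarrow> 'a set" where
  "adjoin K y = {k \<otimes> y [^] (i::nat) |k i. k \<in> K}"

lemma adjoin_incl: "subgroup K G \<Longrightarrow> y \<in> carrier G \<Longrightarrow> K \<subseteq> adjoin K y"
proof
  fix k assume K: "subgroup K G" and y: "y \<in> carrier G" and k: "k \<in> K"
  have "k = k \<otimes> y [^] (0::nat)" using subgroup.mem_carrier[OF K k] by simp
  then show "k \<in> adjoin K y" unfolding adjoin_def using k by blast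
qed

lemma adjoin_self: "subgroup K G \<Longrightarrow> y \<in> carrier G \<Longrightarrow> y \<in> adjoin K y"
  unfolding adjoin_def mem_Collect_eq
  by (rule exI[of _ \<one>], rule exI[of _ 1]) (simp add: subgroup.one_closed)

lemma adjoin_subset: "subgroup K G \<Longrightarrow> y \<in> carrier G \<Longrightarrow> adjoin K y \<subseteq> carrier G"
  unfolding adjoin_def by (auto dest: subgroup.mem_carrier)

lemma adjoin_minimal:
  assumes "subgroup H G" "K \<subseteq> H" "y \<in> H"
  shows "adjoin K y \<subseteq> H"
proof -
  have "y [^] (i::nat) \<in> H" for i
    by (induction i) (use assms in \<open>auto simp: subgroup.one_closed subgroup.m_closed\<close>)
  then show ?thesis using assms unfolding adjoin_def by (auto intro: subgroup.m_closed)
qed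

lemma conj_pow_mem:
  assumes K: "subgroup K G" and y: "y \<in> carrier G"
    and norm: "\<And>k. k \<in> K \<Longrightarrow> y \<otimes> k \<otimes> inv y \<in> K" and k: "k \<in> K"
  shows "y [^] (i::nat) \<otimes> k \<otimes> inv (y [^] i) \<in> K"
proof (induction i)
  case 0 then show ?case using k K by (simp add: subgroup.mem_carrier)
next
  case (Suc i)
  have kc: "k \<in> carrier G" using k K by (simp add: subgroup.mem_carrier)
  have "y [^] Suc i \<otimes> k \<otimes> inv (y [^] Suc i) = y \<otimes> (y [^] i \<otimes> k \<otimes> inv (y [^] i)) \<otimes> inv y"
    unfolding nat_pow_Suc2[OF y] using y kc by (simp add: inv_mult_group m_assoc)
  then show ?case using norm[OF Suc] by simp
qed

lemma adjoin_subgroup: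
  assumes fin: "finite (carrier G)" and K: "subgroup K G" and y: "y \<in> carrier G"
    and norm: "\<And>k. k \<in> K \<Longrightarrow> y \<otimes> k \<otimes> inv y \<in> K"
  shows "subgroup (adjoin K y) G"
proof (rule finite_closed_subgroup[OF fin adjoin_subset[OF K y]])
  show "adjoin K y \<noteq> {}" using adjoin_self[OF K y] by blast
  fix a b assume "a \<in> adjoin K y" "b \<in> adjoin K y"
  then obtain k i k' j where ab: "k \<in> K" "a = k \<otimes> y [^] (i::nat)" "k' \<in> K" "b = k' \<otimes> y [^] (j::nat)"
    unfolding adjoin_def by blast
  have kc: "k \<in> carrier G" "k' \<in> carrier G" using ab K by (auto simp: subgroup.mem_carrier)
  have "inv (y [^] i) \<otimes> (y [^] i \<otimes> y [^] j) = y [^] j"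
    using y by (simp flip: m_assoc)
  then have "a \<otimes> b = (k \<otimes> (y [^] i \<otimes> k' \<otimes> inv (y [^] i))) \<otimes> y [^] (i + j)"
    unfolding ab nat_pow_mult[OF y, symmetric] using kc y by (simp add: m_assoc)
  then show "a \<otimes> b \<in> adjoin K y"
    unfolding adjoin_def using conj_pow_mem[OF K y norm ab(3)] ab(1) K
    by (auto intro: subgroup.m_closed)
qed

lemma adjoin_eq_image:
  assumes K: "subgroup K G" and y: "y \<in> carrier G" and yp: "y [^] (p::nat) \<in> K" and p: "p > 0"
  shows "adjoin K y = (\<lambda>(k, i). k \<otimes> y [^] i) ` (K \<times> {..<p})"
proof
  have pw: "(y [^] p) [^] (q::nat) \<in> K" for q
    by (induction q) (use yp K in \<open>auto simp: subgroup.one_closed subgroup.m_closed\<close>)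
  show "adjoin K y \<subseteq> (\<lambda>(k, i). k \<otimes> y [^] i) ` (K \<times> {..<p})"
  proof
    fix a assume "a \<in> adjoin K y"
    then obtain k i where a: "k \<in> K" "a = k \<otimes> y [^] (i::nat)" unfolding adjoin_def by blast
    have "y [^] i = (y [^] p) [^] (i div p) \<otimes> y [^] (i mod p)"
      using y by (simp add: nat_pow_pow nat_pow_mult mult.commute)
    then have "a = (k \<otimes> (y [^] p) [^] (i div p)) \<otimes> y [^] (i mod p)"
      using a K y by (simp add: m_assoc subgroup.mem_carrier)
    moreover have "k \<otimes> (y [^] p) [^] (i div p) \<in> K" using a K pw by (simp add: subgroup.m_closed)
    ultimately show "a \<in> (\<lambda>(k, i). k \<otimes> y [^] i) ` (K \<times> {..<p})" using p
      by (intro image_eqI[of _ _ "(k \<otimes> (y [^] p) [^] (i div p), i mod p)"]) auto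
  qed
qed (auto simp: adjoin_def)

lemma card_adjoin_le:
  assumes "finite (carrier G)" and K: "subgroup K G" and y: "y \<in> carrier G"
    and yp: "y [^] (p::nat) \<in> K" and p: "p > 0"
  shows "card (adjoin K y) \<le> p * card K"
proof -
  have "finite K" using assms(1) subgroup.subset[OF K] finite_subset by blast
  then have "card (adjoin K y) \<le> card (K \<times> {..<p})"
    unfolding adjoin_eq_image[OF K y yp p] by (intro card_image_le) auto
  then show ?thesis by (simp add: card_cartesian_product mult.commute)
qed

text \<open>Two exponents \<open>i < j < p\<close> representing the same element would put
  \<open>y [^] (j - i)\<close> into \<open>K\<close>; since \<open>j - i\<close> is coprime to
  \<open>p\<close> and \<open>y [^] p\<close> lies in \<open>K\<close>, so would
  \<open>y\<close>.\<close>

lemma adjoin_rep_unique: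
  assumes K: "subgroup K G" and y: "y \<in> carrier G"
    and yp: "y [^] p \<in> K" and p: "prime (p::nat)" and yK: "y \<notin> K"
    and "k \<in> K" "i < p" "k' \<in> K" "j < p" "k \<otimes> y [^] i = k' \<otimes> y [^] j"
  shows "k = k' \<and> i = j"
proof -
  have key: "i = j" if le: "i \<le> j" and ij: "j < p" and k: "k \<in> K" "k' \<in> K"
    and eq: "k \<otimes> y [^] i = k' \<otimes> y [^] j" for i j k k'
  proof (rule ccontr)
    assume ne: "i \<noteq> j"
    have kc: "k \<in> carrier G" "k' \<in> carrier G" using k K by (auto simp: subgroup.mem_carrier)
    have "k \<otimes> y [^] i = k' \<otimes> y [^] (j - i) \<otimes> y [^] i"
      using eq le y kc by (simp add: m_assoc nat_pow_mult)
    then have "k = k' \<otimes> y [^] (j - i)" using y kc by simp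
    then have "y [^] (j - i) = inv k' \<otimes> k" using y kc by (simp add: inv_solve_left)
    then have "y [^] (j - i) \<in> K" using k K by (simp add: subgroup.m_closed subgroup.m_inv_closed)
    moreover have "coprime (j - i) p"
    proof -
      have "\<not> p dvd (j - i)" using ne le ij by (meson dvd_imp_le diff_is_0_eq le_antisym
            less_imp_diff_less not_less zero_less_iff_neq_zero)
      then show ?thesis using p by (metis coprime_commute prime_imp_coprime)
    qed
    ultimately show False using pow_coprime_mem[OF K y _ yp] yK by blast
  qed
  have "i = j" using key[of i j k k'] key[of j i k' k] assms by (metis nat_le_linear)
  then show ?thesis using assms by (simp add: subgroup.mem_carrier)
qed

lemma card_adjoin:
  assumes "finite (carrier G)" and K: "subgroup K G" and y: "y \<in> carrier G"
    and yp: "y [^] p \<in> K" and p: "prime (p::nat)" and yK: "y \<notin> K"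
  shows "card (adjoin K y) = p * card K"
proof -
  have "inj_on (\<lambda>(k, i). k \<otimes> y [^] i) (K \<times> {..<p})"
    by (rule inj_onI) (use adjoin_rep_unique[OF K y yp p yK] in auto)
  then have "card (adjoin K y) = card (K \<times> {..<p})"
    unfolding adjoin_eq_image[OF K y yp prime_gt_0_nat[OF p]] by (rule card_image)
  then show ?thesis by (simp add: card_cartesian_product mult.commute)
qed

end

section \<open>Maximal subgroups of finite p-groups\<close>

context group
begin

text \<open>
  \<open>M\<close> acts on its right cosets. Their number is divisible by \<open>p\<close> and \<open>M\<close> itself is a fixed point, so
  there is another fixed coset, and it lies in the normaliser of \<open>M\<close>.
\<close>

lemma p_group_normalizer_grows:
  assumes p: "prime (p::nat)" and ord: "order G = p ^ k"
    and M: "subgroup M G" and ne: "M \<noteq> carrier G"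
  shows "\<exists>x\<in>carrier G - M. \<forall>m\<in>M. x \<otimes> m \<otimes> inv x \<in> M"
proof -
  let ?E = "rcosets M"
  let ?GM = "G\<lparr>carrier := M\<rparr>"
  \<comment> \<open>Translation by the inverse makes this right multiplication a
    homomorphism.\<close>
  define \<phi> where "\<phi> = (\<lambda>m. \<lambda>C\<in>?E. C #> inv m)"
  have fin: "finite (carrier G)" using ord p order_gt_0_iff_finite by (simp add: prime_gt_0_nat)
  have mc: "m \<in> carrier G" if "m \<in> M" for m using that M by (simp add: subgroup.mem_carrier)
  have Msub: "M \<subseteq> carrier G" using mc by blast
  have E_sub: "C \<subseteq> carrier G" if "C \<in> ?E" for C using subgroup.rcosets_carrier[OF M is_group that] .
  have act_closed: "C #> inv m \<in> ?E" if C: "C \<in> ?E" and m: "m \<in> M" for C m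
  proof -
    obtain x where "x \<in> carrier G" "C = M #> x" using C by (auto simp: RCOSETS_def)
    then show ?thesis using m mc Msub by (simp add: coset_mult_assoc rcosetsI)
  qed
  have act_mult: "C #> inv (m \<otimes> n) = (C #> inv n) #> inv m" if "C \<in> ?E" "m \<in> M" "n \<in> M" for C m n
    using that mc E_sub[OF that(1)] by (simp add: inv_mult_group coset_mult_assoc)
  have bij: "\<phi> m \<in> Bij ?E" if m: "m \<in> M" for m
  proof -
    have im: "inv m \<in> M" using m M by (simp add: subgroup.m_inv_closed)
    have "bij_betw (\<phi> m) ?E ?E"
    proof (rule bij_betw_byWitness[where f'="\<phi> (inv m)"])
      show "\<forall>a\<in>?E. \<phi> (inv m) (\<phi> m a) = a"
        using m mc E_sub act_closed im by (auto simp: \<phi>_def coset_mult_assoc)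
      show "\<forall>a\<in>?E. \<phi> m (\<phi> (inv m) a) = a"
        using m mc E_sub act_closed[OF _ im] by (auto simp: \<phi>_def coset_mult_assoc)
    qed (use m im act_closed in \<open>auto simp: \<phi>_def\<close>)
    then show ?thesis by (simp add: Bij_def \<phi>_def)
  qed
  have "group_hom ?GM (BijGroup ?E) \<phi>"
  proof (rule group_hom.intro)
    show "group ?GM" by (rule subgroup_imp_group[OF M])
    show "group (BijGroup ?E)" by (rule group_BijGroup)
    show "group_hom_axioms ?GM (BijGroup ?E) \<phi>"
    proof (unfold group_hom_axioms_def, rule homI)
      fix m assume "m \<in> carrier ?GM" then show "\<phi> m \<in> carrier (BijGroup ?E)"
        using bij by (simp add: BijGroup_def)
    next
      fix m n assume "m \<in> carrier ?GM" "n \<in> carrier ?GM"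
      then have mn: "m \<in> M" "n \<in> M" by auto
      show "\<phi> (m \<otimes>\<^bsub>?GM\<^esub> n) = \<phi> m \<otimes>\<^bsub>BijGroup ?E\<^esub> \<phi> n"
        using bij[OF mn(1)] bij[OF mn(2)] act_mult act_closed mn
        by (auto simp: BijGroup_def \<phi>_def compose_def intro!: restrict_ext)
    qed
  qed
  then interpret act: group_action ?GM ?E \<phi> by (rule group_action.intro)
  have finE: "finite ?E" using fin rcosets_part_G[OF M] by (metis finite_UnionD)
  obtain a where a: "card M = p ^ a"
    using lagrange[OF M] ord p by (metis divides_primepow_nat dvd_triv_right)
  have cardE: "card ?E * card M = p ^ k" using lagrange[OF M] ord by simp
  have "card M \<noteq> p ^ k" using ne ord card_subset_eq[OF fin Msub] unfolding order_def by auto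
  then have E1: "card ?E \<noteq> 1" using cardE by auto
  obtain e where e: "card ?E = p ^ e" using cardE p by (metis divides_primepow_nat dvd_triv_left)
  have pE: "p dvd card ?E" using E1 e by (metis dvd_power gr0I power_0)
  let ?orbs = "orbits ?GM ?E \<phi>"
  have part: "partition ?E ?orbs" by (rule act.orbit_partition)
  have finorbs: "finite ?orbs" using finE unfolding orbits_def by simp
  have ME: "M \<in> ?E" using M by (simp add: subgroup.subgroup_in_rcosets)
  have orbM: "orbit ?GM \<phi> M = {M}"
  proof -
    have "\<phi> m M = M" if "m \<in> M" for m
      using that ME M by (simp add: \<phi>_def coset_join2 subgroup.m_inv_closed mc)
    moreover have "\<one> \<in> M" using M by (simp add: subgroup.one_closed)
    ultimately show ?thesis unfolding orbit_def by auto
  qed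
  then have Morb: "{M} \<in> ?orbs" unfolding orbits_def using ME by blast
  have sumE: "card ?E = (\<Sum>ob\<in>?orbs. card ob)"
    using disjoint_sum[OF finorbs finE part, of "\<lambda>_. 1::nat"] by simp
  have "\<exists>ob\<in>?orbs - {{M}}. \<not> p dvd card ob"
  proof (rule ccontr)
    assume "\<not> ?thesis"
    then have "p dvd (\<Sum>ob\<in>?orbs - {{M}}. card ob)" by (intro dvd_sum) auto
    moreover have "(\<Sum>ob\<in>?orbs. card ob) = 1 + (\<Sum>ob\<in>?orbs - {{M}}. card ob)"
      using sum.remove[OF finorbs Morb, of card] by simp
    ultimately have "p dvd 1" using pE sumE by (metis dvd_add_left_iff)
    then show False using p by auto
  qed
  then obtain C where C: "C \<in> ?E" "orbit ?GM \<phi> C \<noteq> {M}" "\<not> p dvd card (orbit ?GM \<phi> C)"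
    unfolding orbits_def by blast
  have "card (orbit ?GM \<phi> C) * card (stabilizer ?GM \<phi> C) = p ^ a"
    using act.orbit_stabilizer_theorem[OF C(1)] a unfolding order_def by simp
  \<comment> \<open>The size of the orbit divides the order of the \<open>p\<close>-group
    \<open>M\<close>; being prime to \<open>p\<close>, it is 1.\<close>
  then have "card (orbit ?GM \<phi> C) = 1" using C(3) p
    by (metis divides_primepow_nat dvd_triv_left dvd_power gr0I power_0)
  moreover have "C \<in> orbit ?GM \<phi> C" by (rule act.orbit_refl[OF C(1)])
  ultimately have orbC: "orbit ?GM \<phi> C = {C}" by (metis card_1_singletonE singletonD)
  obtain x where x: "x \<in> carrier G" "C = M #> x" using C(1) by (auto simp: RCOSETS_def)
  have "x \<notin> M" using x C(2) orbC coset_join2[OF x(1) M] by auto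
  moreover have "x \<otimes> m \<otimes> inv x \<in> M" if m: "m \<in> M" for m
  proof -
    have im: "inv m \<in> M" using m M by (simp add: subgroup.m_inv_closed)
    have "\<phi> (inv m) C = C" using orbC im unfolding orbit_def by auto
    then have "M #> (x \<otimes> m) = M #> x"
      using C(1) x m mc Msub by (simp add: \<phi>_def coset_mult_assoc)
    then have "x \<otimes> m \<in> M #> x" using rcos_self[OF _ M] x m mc by (metis m_closed)
    then obtain n where n: "n \<in> M" "x \<otimes> m = n \<otimes> x" unfolding r_coset_def by blast
    then have "x \<otimes> m \<otimes> inv x = n" using x m mc by (simp add: m_assoc)
    then show ?thesis using n by simp
  qed
  ultimately show ?thesis using x by blast
qed

text \<open>The normaliser is larger than \<open>M\<close>, so by maximality adjoining one
  normalising element outside \<open>M\<close> gives the whole group.\<close>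

lemma maximal_subgroup_normal:
  assumes p: "prime (p::nat)" and ord: "order G = p ^ k"
    and max: "maximal_subgroup M G"
  obtains x where "x \<in> carrier G" "x \<notin> M" "\<And>m. m \<in> M \<Longrightarrow> x \<otimes> m \<otimes> inv x \<in> M" "adjoin M x = carrier G"
proof -
  have fin: "finite (carrier G)" using ord p order_gt_0_iff_finite by (simp add: prime_gt_0_nat)
  have M: "subgroup M G" "M \<noteq> carrier G" using max by (auto simp: maximal_subgroup_def)
  obtain x where x: "x \<in> carrier G" "x \<notin> M" "\<And>m. m \<in> M \<Longrightarrow> x \<otimes> m \<otimes> inv x \<in> M"
    using p_group_normalizer_grows[OF p ord M] by blast
  have "subgroup (adjoin M x) G" using adjoin_subgroup[OF fin M(1) x(1) x(3)] by blast
  then have "adjoin M x = carrier G"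
    using max adjoin_incl[OF M(1) x(1)] adjoin_self[OF M(1) x(1)] x(2) unfolding maximal_subgroup_def by blast
  then show ?thesis using x that by blast
qed

definition comm :: "'a \<Rightarrow> 'a \<Rightarrow> 'a" where
  "comm x y = x \<otimes> y \<otimes> inv x \<otimes> inv y"

lemma comm_closed [simp]: "x \<in> carrier G \<Longrightarrow> y \<in> carrier G \<Longrightarrow> comm x y \<in> carrier G"
  by (simp add: comm_def)

lemma comm_eq: "x \<in> carrier G \<Longrightarrow> y \<in> carrier G \<Longrightarrow> x \<otimes> y = comm x y \<otimes> (y \<otimes> x)"
proof -
  assume xy: "x \<in> carrier G" "y \<in> carrier G"
  have "inv y \<otimes> (y \<otimes> x) = x" using xy by (simp flip: m_assoc)
  then show ?thesis using xy by (simp add: comm_def m_assoc)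
qed

lemma comm_unique:
  "x \<in> carrier G \<Longrightarrow> y \<in> carrier G \<Longrightarrow> c \<in> carrier G \<Longrightarrow> x \<otimes> y = c \<otimes> (y \<otimes> x) \<Longrightarrow> comm x y = c"
  using comm_eq[of x y] by (metis comm_closed m_closed right_cancel)

lemma maximal_subgroup_imp_normal:
  assumes p: "prime (p::nat)" and ord: "order G = p ^ k"
    and max: "maximal_subgroup M G"
  shows "M \<lhd> G"
proof -
  have fin: "finite (carrier G)" using ord p order_gt_0_iff_finite by (simp add: prime_gt_0_nat)
  have M: "subgroup M G" "M \<noteq> carrier G" using max by (auto simp: maximal_subgroup_def)
  obtain x where x: "x \<in> carrier G" "x \<notin> M" "\<And>m. m \<in> M \<Longrightarrow> x \<otimes> m \<otimes> inv x \<in> M" "adjoin M x = carrier G"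
    using maximal_subgroup_normal[OF p ord max] by blast
  have mc: "m \<in> carrier G" if "m \<in> M" for m using that M by (simp add: subgroup.mem_carrier)
  have xpow: "x [^] i \<otimes> m \<otimes> inv (x [^] i) \<in> M" if "m \<in> M" for i :: nat and m
    using conj_pow_mem[OF M(1) x(1) x(3) that] by blast
  have normM: "g \<otimes> m \<otimes> inv g \<in> M" if g: "g \<in> carrier G" and m: "m \<in> M" for g m
  proof -
    obtain n i where gi: "n \<in> M" "g = n \<otimes> x [^] (i::nat)" using g x(4) unfolding adjoin_def by blast
    have "g \<otimes> m \<otimes> inv g = n \<otimes> (x [^] i \<otimes> m \<otimes> inv (x [^] i)) \<otimes> inv n"
      using gi m mc x(1) by (simp add: m_assoc inv_mult_group)
    then show ?thesis using xpow[OF m, of i] gi M by (simp add: subgroup.m_closed subgroup.m_inv_closed)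
  qed
  show ?thesis using M(1) normM by (simp add: normal_inv_iff)
qed

text \<open>\<open>G\<close> consists of \<open>M\<close> and powers of a single \<open>x\<close>,
  so the quotient by the normal subgroup \<open>M\<close> is cyclic, hence commutative.\<close>

lemma maximal_subgroup_comm:
  assumes p: "prime (p::nat)" and ord: "order G = p ^ k"
    and max: "maximal_subgroup M G"
    and gh: "g \<in> carrier G" "h \<in> carrier G"
  shows "comm g h \<in> M"
proof -
  have fin: "finite (carrier G)" using ord p order_gt_0_iff_finite by (simp add: prime_gt_0_nat)
  have M: "subgroup M G" "M \<noteq> carrier G" using max by (auto simp: maximal_subgroup_def)
  obtain x where x: "x \<in> carrier G" "x \<notin> M" "\<And>m. m \<in> M \<Longrightarrow> x \<otimes> m \<otimes> inv x \<in> M" "adjoin M x = carrier G"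
    using maximal_subgroup_normal[OF p ord max] by blast
  have mc: "m \<in> carrier G" if "m \<in> M" for m using that M by (simp add: subgroup.mem_carrier)
  have nM: "M \<lhd> G" by (rule maximal_subgroup_imp_normal[OF p ord max])
  obtain m i n j where e: "m \<in> M" "g = m \<otimes> x [^] (i::nat)" "n \<in> M" "h = n \<otimes> x [^] (j::nat)"
    using gh x(4) unfolding adjoin_def by blast
  have Ms: "M \<subseteq> carrier G" by (rule subgroup.subset[OF M(1)])
  have "M #> g = (M #> m) #> x [^] i" "M #> h = (M #> n) #> x [^] j"
    unfolding e using Ms mc[OF e(1)] mc[OF e(3)] x(1) by (metis coset_mult_assoc nat_pow_closed)+
  then have gM: "M #> g = M #> x [^] i" "M #> h = M #> x [^] j"
    using coset_join2[OF mc M(1)] e(1,3) by auto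
  interpret normal M G by (rule nM)
  have "M #> (g \<otimes> h) = (M #> g) <#> (M #> h)" by (rule rcos_sum[OF gh, symmetric])
  also have "\<dots> = M #> (x [^] i \<otimes> x [^] j)" unfolding gM by (rule rcos_sum) (use x in auto)
  also have "x [^] i \<otimes> x [^] j = x [^] j \<otimes> x [^] i" using x(1) by (simp add: nat_pow_mult add.commute)
  also have "M #> (x [^] j \<otimes> x [^] i) = (M #> h) <#> (M #> g)"
    unfolding gM by (rule rcos_sum[symmetric]) (use x in auto)
  also have "\<dots> = M #> (h \<otimes> g)" by (rule rcos_sum[OF gh(2,1)])
  finally have "M #> (g \<otimes> h) = M #> (h \<otimes> g)" .
  then have "g \<otimes> h \<in> M #> (h \<otimes> g)" using rcos_self[OF _ M(1), of "g \<otimes> h"] gh by simp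
  then obtain m where m: "m \<in> M" "g \<otimes> h = m \<otimes> (h \<otimes> g)" unfolding r_coset_def by blast
  then have "comm g h = m" using comm_unique gh mc by blast
  then show ?thesis using m by simp
qed

lemma maximal_subgroup_pow:
  assumes p: "prime (p::nat)" and ord: "order G = p ^ k"
    and max: "maximal_subgroup M G"
    and g: "g \<in> carrier G"
  shows "g [^] p \<in> M"
proof -
  have fin: "finite (carrier G)" using ord p order_gt_0_iff_finite by (simp add: prime_gt_0_nat)
  have M: "subgroup M G" "M \<noteq> carrier G" using max by (auto simp: maximal_subgroup_def)
  have mc: "m \<in> carrier G" if "m \<in> M" for m using that M by (simp add: subgroup.mem_carrier)
  have normM: "g \<otimes> m \<otimes> inv g \<in> M" if "g \<in> carrier G" "m \<in> M" for g m
    using maximal_subgroup_imp_normal[OF p ord max] that by (simp add: normal_inv_iff)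
  show ?thesis
  proof (cases "g \<in> M")
    case True
    then have "g [^] i \<in> M" for i :: nat
      by (induction i) (use M in \<open>auto simp: subgroup.one_closed subgroup.m_closed\<close>)
    then show ?thesis by blast
  next
    case gM: False
    show ?thesis
    proof (rule ccontr)
      assume gp: "g [^] p \<notin> M"
      have gpc: "g [^] p \<in> carrier G" using g by simp
      have "subgroup (adjoin M (g [^] p)) G"
        using adjoin_subgroup[OF fin M(1) gpc] normM[OF gpc] by blast
      then have "adjoin M (g [^] p) = carrier G"
        using max adjoin_incl[OF M(1) gpc] adjoin_self[OF M(1) gpc] gp unfolding maximal_subgroup_def by blast
      \<comment> \<open>Now \<open>g\<close> to the power \<open>1 - p i\<close> lies in
        \<open>M\<close>. As \<open>1 - p i\<close> is coprime to \<open>p\<close> and the order of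
        \<open>g\<close> is a power of \<open>p\<close>, this puts \<open>g\<close> itself into
        \<open>M\<close>.\<close>
      then obtain m i where m: "m \<in> M" "g = m \<otimes> (g [^] p) [^] (i::nat)" using g unfolding adjoin_def by blast
      define q where "q = int p * int i"
      have e1: "g [^] (1 - q) = m"
      proof -
        have "g [^] (1::int) = m \<otimes> g [^] q" using m(2) g
          by (metis int_pow_1 int_pow_int nat_pow_pow of_nat_mult q_def)
        then have "m = g [^] (1::int) \<otimes> inv (g [^] q)"
          by (subst inv_solve_right) (use g mc[OF m(1)] in auto)
        then show ?thesis using g by (simp add: int_pow_diff)
      qed
      have e2: "g [^] (int p ^ k) = \<one>"
        using pow_order_eq_1[OF g] ord by (metis int_pow_int of_nat_power)
      have cop: "coprime (1 - q) (int p)"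
      proof (rule coprimeI)
        fix d assume "d dvd 1 - q" "d dvd int p"
        then have "d dvd (1 - q) + q" unfolding q_def by (intro dvd_add dvd_mult2)
        then show "is_unit d" by simp
      qed
      obtain u v where "u * (1 - q) + v * int p ^ k = gcd (1 - q) (int p ^ k)"
        using bezout_int by blast
      then have uv: "(1 - q) * u + int p ^ k * v = 1" using cop by (simp add: mult.commute)
      have "g = g [^] ((1 - q) * u + int p ^ k * v)" unfolding uv using g by (simp add: int_pow_1)
      also have "\<dots> = g [^] ((1 - q) * u) \<otimes> g [^] (int p ^ k * v)" by (rule int_pow_mult[OF g])
      also have "g [^] ((1 - q) * u) = m [^] u" using int_pow_pow[OF g, of "1 - q" u] e1 by simp
      also have "g [^] (int p ^ k * v) = \<one>" using int_pow_pow[OF g, of "int p ^ k" v] e2 by simp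
      finally have "g = m [^] u \<otimes> \<one>" .
      then have "g = m [^] u" using mc[OF m(1)] by (metis int_pow_closed r_one)
      then show False using gM subgroup_int_pow_closed[OF M(1) m(1), of u] by simp
    qed
  qed
qed

end

section \<open>Elementary abelian groups\<close>

text \<open>Extensionality makes maps that agree on the carrier equal, so that sets of homomorphisms
  are finite and can be counted.\<close>

definition ehom :: "('a, 'c) monoid_scheme \<Rightarrow> ('b, 'd) monoid_scheme \<Rightarrow> ('a \<Rightarrow> 'b) set" where
  "ehom A B = hom A B \<inter> extensional (carrier A)"

lemma ehom_eqI:
  "f \<in> ehom A B \<Longrightarrow> g \<in> ehom A B \<Longrightarrow> (\<And>x. x \<in> carrier A \<Longrightarrow> f x = g x) \<Longrightarrow> f = g"
  unfolding ehom_def by (blast intro: extensionalityI)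

lemma equalizer_subgroup:
  assumes "group A" "group B" "f \<in> hom A B" "g \<in> hom A B"
  shows "subgroup {x \<in> carrier A. f x = g x} A"
proof -
  interpret A: group A by fact
  interpret f: group_hom A B f using assms by (simp add: group_hom_def group_hom_axioms_def)
  interpret g: group_hom A B g using assms by (simp add: group_hom_def group_hom_axioms_def)
  show ?thesis by (rule A.subgroupI) (auto intro: exI[of _ "\<one>\<^bsub>A\<^esub>"])
qed

context group
begin

fun adjoins :: "'a set \<Rightarrow> 'a list \<Rightarrow> 'a set" where
  "adjoins K [] = K"
| "adjoins K (x # xs) = adjoin (adjoins K xs) x"

end

text \<open>A finite vector space over GF(p) in multiplicative notation: exponents modulo
  \<open>p\<close> are the scalars, subgroups are the subspaces.\<close>

locale elab = comm_group G for G (structure) +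
  fixes p :: nat
  assumes prime_p: "prime p"
    and fin: "finite (carrier G)"
    and pow_p: "x \<in> carrier G \<Longrightarrow> x [^] p = \<one>"
begin

lemma p_gt_1: "p > 1" using prime_gt_1_nat[OF prime_p] .

lemma adjoin_sub: "subgroup K G \<Longrightarrow> y \<in> carrier G \<Longrightarrow> subgroup (adjoin K y) G"
proof -
  assume K: "subgroup K G" and y: "y \<in> carrier G"
  have "y \<otimes> k \<otimes> inv y = k" if "k \<in> K" for k
  proof -
    have kc: "k \<in> carrier G" using that K by (simp add: subgroup.mem_carrier)
    have "y \<otimes> k \<otimes> inv y = k \<otimes> (y \<otimes> inv y)" using kc y m_comm[OF y kc] by (simp add: m_assoc)
    then show ?thesis using kc y by simp
  qed
  then show ?thesis using adjoin_subgroup[OF fin K y] by simp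
qed

lemma pow_p_mem: "subgroup K G \<Longrightarrow> y \<in> carrier G \<Longrightarrow> y [^] p \<in> K"
  by (simp add: pow_p subgroup.one_closed)

lemma adjoin_card: "subgroup K G \<Longrightarrow> y \<in> carrier G \<Longrightarrow> y \<notin> K \<Longrightarrow> card (adjoin K y) = p * card K"
  by (rule card_adjoin[OF fin _ _ pow_p_mem prime_p])

lemma adjoins_sub: "subgroup K G \<Longrightarrow> set xs \<subseteq> carrier G \<Longrightarrow> subgroup (adjoins K xs) G"
  by (induction xs) (auto intro: adjoin_sub)

lemma adjoins_minimal:
  assumes "subgroup H G" "K \<subseteq> H" "set xs \<subseteq> H"
  shows "adjoins K xs \<subseteq> H"
  using assms(3)
proof (induction xs)
  case (Cons x xs)
  then show ?case using adjoin_minimal[OF assms(1), of "adjoins K xs" x] by simp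
qed (use assms in simp)

text \<open>Completion of a basis: each element chosen outside the current span multiplies its size
  by \<open>p\<close>, so the length of the list is the codimension of \<open>K\<close> in
  \<open>H\<close>.\<close>

lemma adjoins_list:
  assumes "subgroup K G" "subgroup H G" "K \<subseteq> H"
  shows "\<exists>xs. set xs \<subseteq> H \<and> adjoins K xs = H \<and> card H = p ^ length xs * card K"
  using assms
proof (induction "card H - card K" arbitrary: K rule: less_induct)
  case less
  have finH: "finite H" using fin less(3) subgroup.subset finite_subset by blast
  show ?case
  proof (cases "K = H")
    case True then show ?thesis by (intro exI[of _ "[]"]) simp
  next
    case False
    then obtain x where x: "x \<in> H" "x \<notin> K" using less(4) by blast
    have xc: "x \<in> carrier G" using x(1) less(3) by (simp add: subgroup.mem_carrier)
    have sub: "subgroup (adjoin K x) G" by (rule adjoin_sub[OF less(2) xc])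
    have le: "adjoin K x \<subseteq> H" by (rule adjoin_minimal[OF less(3,4) x(1)])
    have c: "card (adjoin K x) = p * card K" by (rule adjoin_card[OF less(2) xc x(2)])
    have "card K > 0" using less(2) finH less(4)
      by (metis card_gt_0_iff finite_subset subgroup_nonempty)
    then have lt: "card K < card (adjoin K x)" using c p_gt_1 by simp
    have "card (adjoin K x) \<le> card H" using card_mono[OF finH le] .
    then obtain xs where xs: "set xs \<subseteq> H" "adjoins (adjoin K x) xs = H" "card H = p ^ length xs * card (adjoin K x)"
      using less(1)[OF _ sub less(3) le] lt by (meson diff_less_mono2 less_le_trans)
    have app: "adjoins K (ys @ [x]) = adjoins (adjoin K x) ys" for ys by (induction ys) auto
    show ?thesis using xs x(1) c by (intro exI[of _ "xs @ [x]"]) (auto simp: app)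
  qed
qed

lemma gens:
  assumes "subgroup H G"
  shows "\<exists>xs. set xs \<subseteq> H \<and> adjoins {\<one>} xs = H \<and> card H = p ^ length xs"
  using adjoins_list[OF triv_subgroup assms] subgroup.one_closed[OF assms] by auto

lemma proper_factor_card:
  assumes "subgroup K G" "subgroup H G" "K \<subseteq> H" "card H = p ^ n" "card K = p ^ j"
  shows "\<exists>xs. set xs \<subseteq> H \<and> adjoins K xs = H \<and> length xs = n - j \<and> j \<le> n"
proof -
  obtain xs where xs: "set xs \<subseteq> H" "adjoins K xs = H" "card H = p ^ length xs * card K"
    using adjoins_list[OF assms(1-3)] by blast
  then have "p ^ n = p ^ (length xs + j)" using assms by (simp add: power_add)
  then have "n = length xs + j" using p_gt_1 by (metis power_inject_exp)
  then show ?thesis using xs by auto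
qed

lemma FactGroup_elab:
  assumes "subgroup K G"
  shows "elab (G Mod K) p"
proof -
  interpret K: normal K G using assms by (simp add: normal_iff_subgroup)
  interpret Q: comm_group "G Mod K" using abelian_FactGroup[OF assms] .
  show ?thesis
  proof (unfold_locales)
    show "prime p" by (rule prime_p)
    show "finite (carrier (G Mod K))" using fin by (simp add: carrier_FactGroup)
    fix x assume "x \<in> carrier (G Mod K)"
    then obtain y where "y \<in> carrier G" "x = K #> y" by (auto simp: carrier_FactGroup)
    then show "x [^]\<^bsub>G Mod K\<^esub> p = \<one>\<^bsub>G Mod K\<^esub>"
      by (simp add: K.FactGroup_pow pow_p assms subgroup.subset)
  qed
qed

text \<open>Coordinates with respect to independent \<open>a\<close> and \<open>b\<close> are
  unique. The shape is the one obtained by comparing the eigenvalues of two vectors with that of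
  their sum.\<close>

lemma pair_independent:
  assumes ab: "a \<in> carrier G" "b \<in> carrier G" "a \<noteq> \<one>" "b \<notin> adjoin {\<one>} a"
    and "i < p" "k < p" "m < p" and eq: "a [^] i \<otimes> b [^] k = a [^] m \<otimes> b [^] (m::nat)"
  shows "i = k"
proof -
  have T: "subgroup {\<one>} G" by (rule triv_subgroup)
  have A: "subgroup (adjoin {\<one>} a) G" by (rule adjoin_sub[OF T ab(1)])
  have "a [^] i \<in> adjoin {\<one>} a" for i :: nat unfolding adjoin_def using ab by force
  then have *: "a [^] i = a [^] m \<and> k = m"
    using adjoin_rep_unique[OF A ab(2) pow_p_mem[OF A ab(2)] prime_p ab(4)] assms by blast
  moreover have "i = m"
    using adjoin_rep_unique[OF T ab(1) pow_p_mem[OF T ab(1)] prime_p, of \<one> i \<one> m] * assms by auto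
  ultimately show ?thesis by simp
qed

end

text \<open>The classical fact that a linear map for which every vector is an eigenvector is a
  scalar, relative to a surjection \<open>g\<close>. The size condition on \<open>Q\<close> says
  that its dimension is at least two.\<close>

lemma scalar_hom:
  assumes V: "group V" and Q: "elab Q p" and f: "f \<in> hom V Q" and g: "g \<in> hom V Q"
    and loc: "\<And>v. v \<in> carrier V \<Longrightarrow> g v \<noteq> \<one>\<^bsub>Q\<^esub> \<Longrightarrow> \<exists>i<p. f v = g v [^]\<^bsub>Q\<^esub> i"
    and big: "g ` carrier V = carrier Q" "order Q > p"
  shows "\<exists>i<p. \<forall>v\<in>carrier V. f v = g v [^]\<^bsub>Q\<^esub> (i::nat)"
proof -
  interpret V: group V by fact
  interpret Q: elab Q p by fact
  interpret f: group_hom V Q f using f by unfold_locales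
  interpret g: group_hom V Q g using g by unfold_locales
  have T: "subgroup {\<one>\<^bsub>Q\<^esub>} Q" by (rule Q.triv_subgroup)
  have "\<exists>a\<in>carrier Q. a \<noteq> \<one>\<^bsub>Q\<^esub>"
  proof (rule ccontr)
    assume "\<not> ?thesis"
    then have "carrier Q \<subseteq> {\<one>\<^bsub>Q\<^esub>}" by blast
    then have "card (carrier Q) \<le> 1" using card_mono[of "{\<one>\<^bsub>Q\<^esub>}" "carrier Q"] by simp
    then show False using big(2) Q.p_gt_1 unfolding order_def by simp
  qed
  then obtain v0 where v0: "v0 \<in> carrier V" "g v0 \<noteq> \<one>\<^bsub>Q\<^esub>" using big(1) by (metis imageE)
  define A where "A = Q.adjoin {\<one>\<^bsub>Q\<^esub>} (g v0)"
  have A: "subgroup A Q" unfolding A_def by (rule Q.adjoin_sub[OF T]) (use v0 in simp)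
  have "card A = p" using Q.adjoin_card[OF T, of "g v0"] v0 unfolding A_def by simp
  then have "A \<noteq> carrier Q" using big(2) unfolding order_def by auto
  then obtain b where "b \<in> carrier Q" "b \<notin> A" using subgroup.subset[OF A] by blast
  then obtain w where w: "w \<in> carrier V" "g w \<notin> A" using big(1) by (metis imageE)
  obtain i0 where i0: "i0 < p" "f v0 = g v0 [^]\<^bsub>Q\<^esub> i0" using loc v0 by blast
  have out: "f u = g u [^]\<^bsub>Q\<^esub> i0" if u: "u \<in> carrier V" "g u \<notin> A" for u
  proof -
    have "g u \<noteq> \<one>\<^bsub>Q\<^esub>" using u(2) A subgroup.one_closed by metis
    then obtain k where k: "k < p" "f u = g u [^]\<^bsub>Q\<^esub> k" using loc u(1) by blast
    have "g (v0 \<otimes>\<^bsub>V\<^esub> u) \<noteq> \<one>\<^bsub>Q\<^esub>"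
    proof
      assume "g (v0 \<otimes>\<^bsub>V\<^esub> u) = \<one>\<^bsub>Q\<^esub>"
      then have "g u = inv\<^bsub>Q\<^esub> (g v0)" using u v0 Q.inv_equality[of "g u" "g v0"] Q.m_comm by simp
      moreover have "g v0 \<in> A" unfolding A_def by (rule Q.adjoin_self[OF T]) (use v0 in simp)
      ultimately show False using u(2) subgroup.m_inv_closed[OF A] by metis
    qed
    then obtain m where m: "m < p" "f (v0 \<otimes>\<^bsub>V\<^esub> u) = g (v0 \<otimes>\<^bsub>V\<^esub> u) [^]\<^bsub>Q\<^esub> m"
      using loc[of "v0 \<otimes>\<^bsub>V\<^esub> u"] u v0 by auto
    then have "g v0 [^]\<^bsub>Q\<^esub> i0 \<otimes>\<^bsub>Q\<^esub> g u [^]\<^bsub>Q\<^esub> k = g v0 [^]\<^bsub>Q\<^esub> m \<otimes>\<^bsub>Q\<^esub> g u [^]\<^bsub>Q\<^esub> m"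
      using i0 k u v0 by (simp add: Q.nat_pow_distrib)
    then have "i0 = k" using Q.pair_independent[of "g v0" "g u" i0 k m] i0 k m u v0 unfolding A_def by simp
    then show ?thesis using k by simp
  qed
  have "f u = g u [^]\<^bsub>Q\<^esub> i0" if u: "u \<in> carrier V" for u
  \<comment> \<open>The first case includes the kernel of \<open>g\<close>, about which
    \<open>loc\<close> says nothing. Multiplying \<open>u\<close> by \<open>w\<close> leads out of
    \<open>A\<close>, where the scalar is known to be \<open>i0\<close>.\<close>
  proof (cases "g u \<in> A")
    case True
    have "g (u \<otimes>\<^bsub>V\<^esub> w) \<notin> A"
    proof
      assume "g (u \<otimes>\<^bsub>V\<^esub> w) \<in> A"
      then have "inv\<^bsub>Q\<^esub> (g u) \<otimes>\<^bsub>Q\<^esub> (g u \<otimes>\<^bsub>Q\<^esub> g w) \<in> A"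
        using u w True A by (simp add: subgroup.m_closed subgroup.m_inv_closed)
      then show False using u w by (simp flip: Q.m_assoc)
    qed
    then have "f (u \<otimes>\<^bsub>V\<^esub> w) = g (u \<otimes>\<^bsub>V\<^esub> w) [^]\<^bsub>Q\<^esub> i0" using out u w by simp
    then have "f u \<otimes>\<^bsub>Q\<^esub> f w = g u [^]\<^bsub>Q\<^esub> i0 \<otimes>\<^bsub>Q\<^esub> f w"
      using out[OF w] u w by (simp add: Q.nat_pow_distrib)
    then show ?thesis using u w by simp
  next
    case False then show ?thesis using out u by blast
  qed
  then show ?thesis using i0 by blast
qed

section \<open>Intertwining homomorphisms\<close>

definition intertwiners where
  "intertwiners V W g h = {A \<in> ehom V W. \<forall>v\<in>carrier V. A (g v) = h (A v)}"

definition shifted :: "('a, 'b) monoid_scheme \<Rightarrow> ('a \<Rightarrow> 'a) \<Rightarrow> 'a set \<Rightarrow> bool" where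
  "shifted V g K \<longleftrightarrow> subgroup K V \<and> (\<forall>k\<in>K. g k \<in> K \<longrightarrow> k = \<one>\<^bsub>V\<^esub>)"

text \<open>A measure of the distance of \<open>g\<close> from the scalars: for an endomorphism of
  an elementary abelian group it is 0 exactly when every cyclic subgroup is mapped into
  itself.\<close>

definition shift_rank :: "nat \<Rightarrow> ('a, 'b) monoid_scheme \<Rightarrow> ('a \<Rightarrow> 'a) \<Rightarrow> nat" where
  "shift_rank p V g = Max {j. \<exists>K. shifted V g K \<and> card K = p ^ j}"

lemma card_le_lists:
  assumes "finite W" "\<And>a. a \<in> S \<Longrightarrow> set (F a) \<subseteq> W \<and> length (F a) = n" "inj_on F S"
  shows "finite S \<and> card S \<le> card W ^ n"
proof -
  have sub: "F ` S \<subseteq> {xs. set xs \<subseteq> W \<and> length xs = n}" using assms(2) by blast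
  have "finite (F ` S)" using finite_subset[OF sub finite_lists_length_eq[OF assms(1)]] .
  moreover have "card (F ` S) \<le> card W ^ n"
    using card_mono[OF finite_lists_length_eq[OF assms(1)] sub] by (simp add: card_lists_length_eq[OF assms(1)])
  ultimately show ?thesis using assms(3) by (simp add: card_image finite_image_iff)
qed

context elab
begin

lemma ehom_determined:
  assumes W: "group W" and xs: "set xs \<subseteq> carrier G" "adjoins {\<one>} xs = carrier G"
    and f: "f \<in> ehom G W" and g: "g \<in> ehom G W" and eq: "\<And>x. x \<in> set xs \<Longrightarrow> f x = g x"
  shows "f = g"
proof (rule ehom_eqI[OF f g])
  have fg: "f \<in> hom G W" "g \<in> hom G W" using f g by (auto simp: ehom_def)
  have S: "subgroup {x \<in> carrier G. f x = g x} G"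
    by (rule equalizer_subgroup[OF is_group W fg])
  have "adjoins {\<one>} xs \<subseteq> {x \<in> carrier G. f x = g x}"
    by (rule adjoins_minimal[OF S]) (use xs eq subgroup.one_closed[OF S] in auto)
  then show "x \<in> carrier G \<Longrightarrow> f x = g x" for x using xs(2) by blast
qed

lemma card_ehom:
  assumes W: "group W" "finite (carrier W)" and n: "order G = p ^ n"
  shows "finite (ehom G W) \<and> card (ehom G W) \<le> card (carrier W) ^ n"
proof -
  obtain xs where xs: "set xs \<subseteq> carrier G" "adjoins {\<one>} xs = carrier G" "card (carrier G) = p ^ length xs"
    using gens[OF subgroup_self] by blast
  have len: "length xs = n" using xs(3) n p_gt_1 unfolding order_def by simp
  show ?thesis
  proof (rule card_le_lists[OF W(2), where F = "\<lambda>f. map f xs"])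
    show "set (map a xs) \<subseteq> carrier W \<and> length (map a xs) = n" if "a \<in> ehom G W" for a
      using that xs(1) len by (auto simp: ehom_def hom_def)
    show "inj_on (\<lambda>f. map f xs) (ehom G W)"
      by (rule inj_onI, rule ehom_determined[OF W(1) xs(1,2)]) auto
  qed
qed

lemma shifted_sum:
  assumes g: "g \<in> hom G G" and K: "shifted G g K"
  shows "subgroup (K <#> g ` K) G" "card (K <#> g ` K) = card K * card K"
    "K \<subseteq> K <#> g ` K" "g ` K \<subseteq> K <#> g ` K"
proof -
  interpret g: group_hom G G g using g by unfold_locales
  have sK: "subgroup K G" and K1: "\<And>k. k \<in> K \<Longrightarrow> g k \<in> K \<Longrightarrow> k = \<one>" using K by (auto simp: shifted_def)
  have kc: "k \<in> carrier G" if "k \<in> K" for k using that sK by (simp add: subgroup.mem_carrier)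
  have sgK: "subgroup (g ` K) G" using g.subgroup_img_is_subgroup[OF sK] .
  show "subgroup (K <#> g ` K) G" by (rule mult_subgroups[OF sK sgK])
  have eq: "K <#> g ` K = (\<lambda>(k, l). k \<otimes> g l) ` (K \<times> K)" unfolding set_mult_def by auto
  have "inj_on (\<lambda>(k, l). k \<otimes> g l) (K \<times> K)"
  proof (rule inj_onI, clarsimp)
    fix a b c d assume h: "a \<in> K" "b \<in> K" "c \<in> K" "d \<in> K" "a \<otimes> g b = c \<otimes> g d"
    have c: "a \<in> carrier G" "b \<in> carrier G" "c \<in> carrier G" "d \<in> carrier G" using h kc by auto
    have "g b = inv a \<otimes> (c \<otimes> g d)" using h(5) c by (simp add: inv_solve_left)
    then have "g b \<otimes> inv (g d) = inv a \<otimes> c" using c by (simp add: m_assoc)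
    then have "g (b \<otimes> inv d) = inv a \<otimes> c" using c by simp
    moreover have "inv a \<otimes> c \<in> K" "b \<otimes> inv d \<in> K"
      using h sK by (auto simp: subgroup.m_closed subgroup.m_inv_closed)
    ultimately have "b \<otimes> inv d = \<one>" using K1 by metis
    then have "b = d" using c by (metis inv_closed inv_equality inv_inv)
    then show "a = c \<and> b = d" using h c by simp
  qed
  then show "card (K <#> g ` K) = card K * card K" unfolding eq by (simp add: card_image card_cartesian_product)
  have 1: "\<one> \<in> K" using sK by (simp add: subgroup.one_closed)
  show "K \<subseteq> K <#> g ` K"
  proof
    fix k assume "k \<in> K"
    then show "k \<in> K <#> g ` K" unfolding eq using 1 kc by (intro image_eqI[of _ _ "(k, \<one>)"]) auto
  qed
  show "g ` K \<subseteq> K <#> g ` K"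
  proof
    fix x assume "x \<in> g ` K"
    then obtain k where "k \<in> K" "x = g k" by blast
    then show "x \<in> K <#> g ` K" unfolding eq using 1 kc by (intro image_eqI[of _ _ "(\<one>, k)"]) auto
  qed
qed

lemma shift_rank_props:
  assumes n: "order G = p ^ n"
  shows "\<exists>K. shifted G g K \<and> card K = p ^ shift_rank p G g"
    and "shifted G g K \<Longrightarrow> card K = p ^ j \<Longrightarrow> j \<le> shift_rank p G g"
proof -
  let ?S = "{j. \<exists>K. shifted G g K \<and> card K = p ^ j}"
  have "j \<le> n" if h: "shifted G g K" "card K = p ^ j" for j K
  proof -
    have "card K \<le> card (carrier G)"
      using h fin by (intro card_mono) (auto simp: shifted_def dest: subgroup.subset)
    then show ?thesis using h n p_gt_1 unfolding order_def by simp
  qed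
  then have fS: "finite ?S" by (intro finite_subset[of ?S "{..n}"]) auto
  have "shifted G g {\<one>} \<and> card {\<one>} = p ^ 0" using triv_subgroup by (simp add: shifted_def)
  then have "0 \<in> ?S" by blast
  then have "?S \<noteq> {}" by blast
  then have "Max ?S \<in> ?S" by (rule Max_in[OF fS])
  then show "\<exists>K. shifted G g K \<and> card K = p ^ shift_rank p G g" unfolding shift_rank_def by blast
  show "shifted G g K \<Longrightarrow> card K = p ^ j \<Longrightarrow> j \<le> shift_rank p G g"
    unfolding shift_rank_def using fS by (intro Max_ge) auto
qed

lemma shift_rank_le:
  assumes n: "order G = p ^ n" and g: "g \<in> hom G G"
  shows "2 * shift_rank p G g \<le> n"
proof -
  obtain K where K: "shifted G g K" "card K = p ^ shift_rank p G g" using shift_rank_props(1)[OF n] by blast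
  have "card (K <#> g ` K) \<le> card (carrier G)"
    by (intro card_mono fin subgroup.subset shifted_sum(1)[OF g K(1)])
  then have "p ^ (2 * shift_rank p G g) \<le> p ^ n"
    using n shifted_sum(2)[OF g K(1)] K(2) unfolding order_def by (simp add: mult_2 power_add)
  then show ?thesis using p_gt_1 by simp
qed

end

text \<open>The values recorded are those on a basis \<open>xs\<close> of \<open>K\<close> and on
  \<open>d - 2 * j\<close> elements \<open>ys\<close> completing \<open>K + g K\<close> to
  \<open>V\<close>, altogether \<open>d - j\<close> elements of \<open>W\<close>.\<close>

lemma card_intertwiners_source:
  assumes V: "elab V p" and W: "elab W p" and d: "order V = p ^ d" and s: "order W = p ^ s"
    and g: "g \<in> hom V V"
  shows "finite (intertwiners V W g h)"
    "card (intertwiners V W g h) \<le> p ^ (s * (d - shift_rank p V g))"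
proof -
  interpret V: elab V p by fact
  interpret W: elab W p by fact
  define j where "j = shift_rank p V g"
  obtain K where K: "shifted V g K" "card K = p ^ j" using V.shift_rank_props(1)[OF d] unfolding j_def by blast
  have sK: "subgroup K V" using K by (simp add: shifted_def)
  let ?D = "K <#>\<^bsub>V\<^esub> g ` K"
  note D = V.shifted_sum[OF g K(1)]
  obtain xs where xs: "set xs \<subseteq> K" "V.adjoins {\<one>\<^bsub>V\<^esub>} xs = K" "card K = p ^ length xs" using V.gens[OF sK] by blast
  have lx: "length xs = j" using xs(3) K(2) V.p_gt_1 by simp
  have "card ?D = p ^ (2 * j)" using D(2) K(2) by (simp add: mult_2 power_add)
  then obtain ys where ys: "set ys \<subseteq> carrier V" "V.adjoins ?D ys = carrier V" "length ys = d - 2 * j" "2 * j \<le> d"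
    using V.proper_factor_card[OF D(1) V.subgroup_self subgroup.subset[OF D(1)]] d unfolding order_def by blast
  have len: "length (xs @ ys) = d - j" using lx ys by simp
  have "finite (intertwiners V W g h) \<and> card (intertwiners V W g h) \<le> card (carrier W) ^ (d - j)"
  proof (rule card_le_lists[OF W.fin, where F = "\<lambda>f. map f (xs @ ys)"])
    show "set (map a (xs @ ys)) \<subseteq> carrier W \<and> length (map a (xs @ ys)) = d - j"
      if "a \<in> intertwiners V W g h" for a
      using that xs(1) ys(1) len subgroup.subset[OF sK] unfolding length_map
      by (auto simp: intertwiners_def ehom_def hom_def)
    show "inj_on (\<lambda>f. map f (xs @ ys)) (intertwiners V W g h)"
    proof (rule inj_onI)
      fix A B assume A: "A \<in> intertwiners V W g h" and B: "B \<in> intertwiners V W g h"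
        and "map A (xs @ ys) = map B (xs @ ys)"
      then have eq: "\<And>x. x \<in> set xs \<Longrightarrow> A x = B x" "\<And>x. x \<in> set ys \<Longrightarrow> A x = B x" by auto
      let ?S = "{x \<in> carrier V. A x = B x}"
      have AB: "A \<in> ehom V W" "B \<in> ehom V W" using A B by (auto simp: intertwiners_def)
      have S: "subgroup ?S V"
        using AB by (intro equalizer_subgroup) (auto simp: ehom_def)
      have KS: "K \<subseteq> ?S" unfolding xs(2)[symmetric]
        by (rule V.adjoins_minimal[OF S])
          (use xs(1) eq(1) subgroup.subset[OF sK] subgroup.one_closed[OF S] in auto)
      have gKS: "g ` K \<subseteq> ?S"
      proof
        fix x assume "x \<in> g ` K"
        then obtain k where k: "k \<in> K" "x = g k" by blast
        then have "k \<in> carrier V" "A k = B k" using KS by auto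
        moreover have "g k \<in> carrier V" using g calculation(1) by (auto simp: hom_def)
        ultimately show "x \<in> ?S" using A B k by (auto simp: intertwiners_def)
      qed
      have "?D \<subseteq> ?S"
      proof
        fix x assume "x \<in> ?D"
        then obtain k l where "k \<in> K" "l \<in> g ` K" "x = k \<otimes>\<^bsub>V\<^esub> l" unfolding set_mult_def by blast
        then show "x \<in> ?S" using subgroup.m_closed[OF S] KS gKS by blast
      qed
      then have "V.adjoins ?D ys \<subseteq> ?S"
        by (intro V.adjoins_minimal[OF S]) (use ys(1) eq(2) in auto)
      then have "carrier V \<subseteq> ?S" unfolding ys(2) .
      then show "A = B" by (intro ehom_eqI[OF AB]) auto
    qed
  qed
  then show "finite (intertwiners V W g h)" "card (intertwiners V W g h) \<le> p ^ (s * (d - shift_rank p V g))"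
    using s unfolding order_def j_def by (auto simp: power_mult)
qed

text \<open>If \<open>A\<close> and \<open>B\<close> agree modulo \<open>K\<close>, then
  \<open>h\<close> sends the difference of \<open>A v\<close> and \<open>B v\<close>, an element of
  \<open>K\<close>, to that of \<open>A (g v)\<close> and \<open>B (g v)\<close>, again in
  \<open>K\<close>; as \<open>K\<close> is shifted, the difference is trivial. So \<open>d\<close>
  values in \<open>W Mod K\<close> suffice.\<close>

lemma card_intertwiners_target:
  assumes V: "elab V p" and W: "elab W p" and d: "order V = p ^ d" and s: "order W = p ^ s"
    and g: "g \<in> hom V V" and h: "h \<in> hom W W"
  shows "card (intertwiners V W g h) \<le> p ^ (d * (s - shift_rank p W h))"
proof -
  interpret V: elab V p by fact
  interpret W: elab W p by fact
  interpret h: group_hom W W h using h by unfold_locales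
  define j where "j = shift_rank p W h"
  obtain K where K: "shifted W h K" "card K = p ^ j" using W.shift_rank_props(1)[OF s] unfolding j_def by blast
  have sK: "subgroup K W" using K by (simp add: shifted_def)
  obtain xs where xs: "set xs \<subseteq> carrier V" "V.adjoins {\<one>\<^bsub>V\<^esub>} xs = carrier V" "card (carrier V) = p ^ length xs"
    using V.gens[OF V.subgroup_self] by blast
  have lx: "length xs = d" using xs(3) d V.p_gt_1 unfolding order_def by simp
  interpret Q: elab "W Mod K" p by (rule W.FactGroup_elab[OF sK])
  interpret K: normal K W using sK by (simp add: W.normal_iff_subgroup)
  have j_le: "j \<le> s" using W.proper_factor_card[OF sK W.subgroup_self subgroup.subset[OF sK]] s K(2)
    unfolding order_def by blast
  have "card (rcosets\<^bsub>W\<^esub> K) * p ^ j = p ^ (s - j) * p ^ j"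
    using W.lagrange[OF sK] s K(2) j_le by (simp flip: power_add)
  then have cQ: "card (carrier (W Mod K)) = p ^ (s - j)"
    using W.p_gt_1 by (simp add: FactGroup_def)
  let ?\<pi> = "\<lambda>w. K #>\<^bsub>W\<^esub> w"
  have pi: "?\<pi> \<in> hom W (W Mod K)" by (rule K.r_coset_hom_Mod)
  have "finite (intertwiners V W g h) \<and> card (intertwiners V W g h) \<le> card (carrier (W Mod K)) ^ d"
  proof (rule card_le_lists[OF Q.fin, where F = "\<lambda>f. map (\<lambda>x. ?\<pi> (f x)) xs"])
    show "set (map (\<lambda>x. ?\<pi> (a x)) xs) \<subseteq> carrier (W Mod K) \<and> length (map (\<lambda>x. ?\<pi> (a x)) xs) = d"
      if "a \<in> intertwiners V W g h" for a
      using that xs(1) lx by (auto simp: intertwiners_def ehom_def hom_def carrier_FactGroup)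
    show "inj_on (\<lambda>f. map (\<lambda>x. ?\<pi> (f x)) xs) (intertwiners V W g h)"
    proof (rule inj_onI)
      fix A B assume A: "A \<in> intertwiners V W g h" and B: "B \<in> intertwiners V W g h"
        and "map (\<lambda>x. ?\<pi> (A x)) xs = map (\<lambda>x. ?\<pi> (B x)) xs"
      then have eq: "\<And>x. x \<in> set xs \<Longrightarrow> ?\<pi> (A x) = ?\<pi> (B x)" by auto
      have AB: "A \<in> ehom V W" "B \<in> ehom V W" using A B by (auto simp: intertwiners_def)
      then have ABh: "A \<in> hom V W" "B \<in> hom V W" by (auto simp: ehom_def)
      interpret A: group_hom V W A using ABh by unfold_locales
      interpret B: group_hom V W B using ABh by unfold_locales
      let ?S = "{x \<in> carrier V. ?\<pi> (A x) = ?\<pi> (B x)}"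
      have S: "subgroup ?S V"
        using equalizer_subgroup[OF V.is_group Q.is_group, of "?\<pi> \<circ> A" "?\<pi> \<circ> B"] hom_compose[OF ABh(1) pi] hom_compose[OF ABh(2) pi]
        by (simp add: comp_def)
      have "V.adjoins {\<one>\<^bsub>V\<^esub>} xs \<subseteq> ?S"
        by (rule V.adjoins_minimal[OF S]) (use xs eq subgroup.one_closed[OF S] in auto)
      then have "carrier V \<subseteq> ?S" unfolding xs(2) .
      then have all: "A v \<otimes>\<^bsub>W\<^esub> inv\<^bsub>W\<^esub> B v \<in> K" if "v \<in> carrier V" for v
      proof -
        have "?\<pi> (A v) = ?\<pi> (B v)" using that \<open>carrier V \<subseteq> ?S\<close> by blast
        then have "A v \<in> ?\<pi> (B v)" using W.rcos_self[OF _ sK, of "A v"] that by simp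
        then show ?thesis using K.rcos_module_imp[OF W.is_group] that by simp
      qed
      show "A = B"
      proof (rule ehom_eqI[OF AB])
        fix v assume v: "v \<in> carrier V"
        have gv: "g v \<in> carrier V" using g v by (auto simp: hom_def)
        have "h (A v \<otimes>\<^bsub>W\<^esub> inv\<^bsub>W\<^esub> B v) = A (g v) \<otimes>\<^bsub>W\<^esub> inv\<^bsub>W\<^esub> B (g v)"
          using v A B by (simp add: intertwiners_def)
        then have "h (A v \<otimes>\<^bsub>W\<^esub> inv\<^bsub>W\<^esub> B v) \<in> K" using all[OF gv] by simp
        then have "A v \<otimes>\<^bsub>W\<^esub> inv\<^bsub>W\<^esub> B v = \<one>\<^bsub>W\<^esub>"
          using all[OF v] K(1) unfolding shifted_def by blast
        then show "A v = B v" using W.inv_equality[of "A v" "inv\<^bsub>W\<^esub> B v"] v by simp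
      qed
    qed
  qed
  then show ?thesis using cQ unfolding j_def by (simp add: mult.commute flip: power_mult)
qed

section \<open>Endomorphisms that are scalar modulo a small subgroup\<close>

context elab
begin

lemma pow_mod_p: "x \<in> carrier G \<Longrightarrow> x [^] (a::nat) = x [^] (a mod p)"
proof -
  assume x: "x \<in> carrier G"
  have "x [^] a = x [^] (p * (a div p) + a mod p)" by simp
  also have "\<dots> = x [^] (p * (a div p)) \<otimes> x [^] (a mod p)" by (rule nat_pow_mult[OF x, symmetric])
  also have "x [^] (p * (a div p)) = \<one>" using nat_pow_pow[OF x, of p "a div p"] pow_p[OF x] by simp
  finally show ?thesis using x by simp
qed

lemma pow_eq_one_imp:
  assumes x: "x \<in> carrier G" "x \<noteq> \<one>" and a: "x [^] (a::nat) = \<one>"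
  shows "p dvd a"
proof (rule ccontr)
  assume "\<not> p dvd a"
  then have "coprime a p" using prime_p by (metis coprime_commute prime_imp_coprime)
  then have "x \<in> {\<one>}" using pow_coprime_mem[OF triv_subgroup x(1), of a p] a pow_p[OF x(1)] by simp
  then show False using x by simp
qed

lemma pow_dvd_one: "x \<in> carrier G \<Longrightarrow> p dvd a \<Longrightarrow> x [^] (a::nat) = \<one>"
  using pow_mod_p[of x a] by simp

text \<open>
  For \<open>v \<notin> D\<close> the subgroup generated by \<open>K\<close> and \<open>v\<close> is larger than \<open>K\<close>, hence not shifted, and this
  forces \<open>g v\<close> to be a power of \<open>v\<close> modulo \<open>D\<close>.
\<close>

lemma scalar_mod_shift:
  assumes n: "order G = p ^ n" and g: "g \<in> hom G G"
    and K: "shifted G g K" "card K = p ^ shift_rank p G g" and big: "2 * shift_rank p G g + 2 \<le> n"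
  defines "D \<equiv> K <#> g ` K"
  shows "\<exists>i<p. \<forall>v\<in>carrier G. g v \<otimes> inv (v [^] (i::nat)) \<in> D"
proof -
  define j where "j = shift_rank p G g"
  interpret g: group_hom G G g using g by unfold_locales
  have sK: "subgroup K G" and K1: "\<And>k. k \<in> K \<Longrightarrow> g k \<in> K \<Longrightarrow> k = \<one>" using K by (auto simp: shifted_def)
  note D = shifted_sum[OF g K(1), folded D_def]
  interpret D: normal D G using D(1) by (simp add: normal_iff_subgroup)
  interpret Q: elab "G Mod D" p by (rule FactGroup_elab[OF D(1)])
  let ?\<pi> = "\<lambda>w. D #> w"
  have pi: "?\<pi> \<in> hom G (G Mod D)" by (rule D.r_coset_hom_Mod)
  interpret pi: group_hom G "G Mod D" ?\<pi> using pi by unfold_locales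
  have psi: "(\<lambda>v. ?\<pi> (g v)) \<in> hom G (G Mod D)" by (rule homI) (simp_all del: mult_FactGroup)
  interpret psi: group_hom G "G Mod D" "\<lambda>v. ?\<pi> (g v)" using psi by unfold_locales
  have one: "?\<pi> v = D \<longleftrightarrow> v \<in> D" if "v \<in> carrier G" for v
    using coset_join1[OF _ that D(1)] coset_join2[OF that D(1)] D.subset by blast
  have cD: "card D = p ^ (2 * j)" using D(2) K(2) unfolding j_def by (simp add: mult_2 power_add)
  have "card (rcosets D) * p ^ (2 * j) = p ^ (n - 2 * j) * p ^ (2 * j)"
    using lagrange[OF D(1)] n cD big by (simp add: j_def flip: power_add)
  then have oQ: "order (G Mod D) = p ^ (n - 2 * j)" using p_gt_1 by (simp add: FactGroup_def order_def)
  \<comment> \<open>The assumption \<open>big\<close> gives the quotient the dimension at least two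
    that \<open>scalar_hom\<close> demands.\<close>
  have "p ^ 1 < p ^ (n - 2 * j)" using p_gt_1 big unfolding j_def by (intro power_strict_increasing) auto
  then have oQ1: "order (G Mod D) > p" using oQ by simp
  have "\<exists>i<p. ?\<pi> (g v) = ?\<pi> v [^]\<^bsub>G Mod D\<^esub> i" if v: "v \<in> carrier G" "?\<pi> v \<noteq> \<one>\<^bsub>G Mod D\<^esub>" for v
  proof -
    have vD: "v \<notin> D" using v one by simp
    then have vK: "v \<notin> K" using D(3) by blast
    have "card (adjoin K v) = p ^ (j + 1)" using adjoin_card[OF sK v(1) vK] K(2) unfolding j_def by simp
    then have "\<not> shifted G g (adjoin K v)" using shift_rank_props(2)[OF n] unfolding j_def by fastforce
    then obtain x where x: "x \<in> adjoin K v" "g x \<in> adjoin K v" "x \<noteq> \<one>"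
      using adjoin_sub[OF sK v(1)] unfolding shifted_def by blast
    obtain k a where ka: "k \<in> K" "x = k \<otimes> v [^] (a::nat)" using x(1) unfolding adjoin_def by blast
    obtain k' b where kb: "k' \<in> K" "g x = k' \<otimes> v [^] (b::nat)" using x(2) unfolding adjoin_def by blast
    have kc: "k \<in> carrier G" "k' \<in> carrier G" using ka kb sK by (auto simp: subgroup.mem_carrier)
    have "?\<pi> (g k) = \<one>\<^bsub>G Mod D\<^esub>" using ka(1) D(4) one[of "g k"] kc by auto
    then have e1: "?\<pi> (g x) = ?\<pi> (g v) [^]\<^bsub>G Mod D\<^esub> a"
      unfolding ka using kc v by (simp add: psi.hom_nat_pow del: one_FactGroup mult_FactGroup)
    have "?\<pi> k' = \<one>\<^bsub>G Mod D\<^esub>" using kb(1) D(3) one[of k'] kc by auto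
    then have e2: "?\<pi> (g x) = ?\<pi> v [^]\<^bsub>G Mod D\<^esub> b"
      unfolding kb using kc v by (simp add: pi.hom_nat_pow del: one_FactGroup mult_FactGroup)
    \<comment> \<open>Otherwise \<open>x\<close> would lie in \<open>K\<close>; comparing both
      expressions for \<open>g x\<close> modulo \<open>D\<close> would make \<open>b\<close>
      divisible by \<open>p\<close> as well and put \<open>g x\<close> into \<open>K\<close>,
      against \<open>K\<close> being shifted.\<close>
    have "\<not> p dvd a"
    proof
      assume "p dvd a"
      then have xk: "x = k" using ka kc v pow_dvd_one by simp
      have "?\<pi> v [^]\<^bsub>G Mod D\<^esub> b = \<one>\<^bsub>G Mod D\<^esub>"
        using e1 e2 Q.pow_dvd_one[OF psi.hom_closed[OF v(1)] \<open>p dvd a\<close>] by simp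
      then have "p dvd b" using Q.pow_eq_one_imp[of "?\<pi> v" b] v by (simp del: one_FactGroup)
      then have "g k \<in> K" using kb xk kc v pow_dvd_one by simp
      then show False using K1[OF ka(1)] x(3) xk by simp
    qed
    then have "coprime a p" using prime_p by (metis coprime_commute prime_imp_coprime)
    \<comment> \<open>In additive notation modulo \<open>D\<close> the relation is
      \<open>a (g v) = b v\<close>; with \<open>c\<close> the inverse of \<open>a\<close> modulo
      \<open>p\<close>, the eigenvalue is \<open>b * c\<close>.\<close>
    then obtain c where c: "[a * c = Suc 0] (mod p)" using cong_solve_coprime_nat[of a p] by blast
    have ac: "(a * c) mod p = 1" using c p_gt_1 by (simp add: cong_def)
    have "?\<pi> (g v) [^]\<^bsub>G Mod D\<^esub> (a * c) = ?\<pi> (g v) [^]\<^bsub>G Mod D\<^esub> (1::nat)"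
      using Q.pow_mod_p[OF psi.hom_closed[OF v(1)], of "a * c"] unfolding ac .
    then have "?\<pi> (g v) = ?\<pi> (g v) [^]\<^bsub>G Mod D\<^esub> (a * c)"
      using Q.nat_pow_eone[OF psi.hom_closed[OF v(1)]] by metis
    also have "\<dots> = (?\<pi> v [^]\<^bsub>G Mod D\<^esub> b) [^]\<^bsub>G Mod D\<^esub> c"
      unfolding e2[symmetric] e1 by (rule Q.nat_pow_pow[OF psi.hom_closed[OF v(1)], symmetric])
    also have "\<dots> = ?\<pi> v [^]\<^bsub>G Mod D\<^esub> ((b * c) mod p)"
      unfolding Q.nat_pow_pow[OF pi.hom_closed[OF v(1)]] by (rule Q.pow_mod_p[OF pi.hom_closed[OF v(1)]])
    finally show ?thesis using p_gt_1 by (intro exI[of _ "(b * c) mod p"]) auto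
  qed
  then obtain i where i: "i < p" "\<forall>v\<in>carrier G. ?\<pi> (g v) = ?\<pi> v [^]\<^bsub>G Mod D\<^esub> i"
    using scalar_hom[OF is_group Q.elab_axioms psi pi _ _ oQ1] by (auto simp: carrier_FactGroup)
  have "g v \<otimes> inv (v [^] i) \<in> D" if v: "v \<in> carrier G" for v
  proof -
    have "?\<pi> (g v) = ?\<pi> (v [^] i)" using i(2) v by (simp add: pi.hom_nat_pow)
    then have "g v \<in> ?\<pi> (v [^] i)" using rcos_self[OF _ D(1), of "g v"] v by simp
    then show ?thesis using D.rcos_module_imp[OF is_group] v by simp
  qed
  then show ?thesis using i(1) by blast
qed

lemma adjoins_card_le:
  assumes "subgroup K G" "set xs \<subseteq> carrier G"
  shows "card (adjoins K xs) \<le> p ^ length xs * card K"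
  using assms(2)
proof (induction xs)
  case (Cons x xs)
  then have "subgroup (adjoins K xs) G" "x \<in> carrier G" using adjoins_sub[OF assms(1)] by auto
  then have "card (adjoin (adjoins K xs) x) \<le> p * card (adjoins K xs)"
    using card_adjoin_le[OF fin _ _ pow_p_mem] p_gt_1 by simp
  then show ?case using Cons by (simp add: mult.assoc) (meson le_trans mult_le_mono2)
qed simp

text \<open>For \<open>2 * j + 2 > n\<close> the number of all endomorphisms is small enough.
  Otherwise \<open>g\<close> is recorded by \<open>2 * j\<close> generators of
  \<open>D = K + g K\<close>, by the scalar, and by the deviations of the \<open>n\<close> basis
  images from the scalar, which lie in \<open>D\<close>: \<open>p^(2jn)\<close>, \<open>p\<close>
  and \<open>p^(2jn)\<close> possibilities.\<close>

lemma card_shift_rank: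
  assumes n: "order G = p ^ n"
  shows "card {g \<in> ehom G G. shift_rank p G g = j} \<le> p ^ (4 * j * n + n + 1)"
proof (cases "2 * j + 2 \<le> n")
  case False
  have "card {g \<in> ehom G G. shift_rank p G g = j} \<le> card (ehom G G)"
    using card_ehom[OF is_group fin n] by (intro card_mono) auto
  also have "\<dots> \<le> (p ^ n) ^ n" using card_ehom[OF is_group fin n] n unfolding order_def by simp
  also have "\<dots> = p ^ (n * n)" by (simp add: power_mult)
  also have "\<dots> \<le> p ^ (4 * j * n + n + 1)"
  proof (rule power_increasing)
    have "n * n \<le> (2 * j + 1) * n" using False by (intro mult_le_mono1) simp
    then show "n * n \<le> 4 * j * n + n + 1" by (simp add: algebra_simps)
  qed (use p_gt_1 in simp)
  finally show ?thesis .
next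
  case True
  obtain es where es: "set es \<subseteq> carrier G" "adjoins {\<one>} es = carrier G" "card (carrier G) = p ^ length es"
    using gens[OF subgroup_self] by blast
  have le: "length es = n" using es(3) n p_gt_1 unfolding order_def by simp
  define L where "L = {xs. set xs \<subseteq> carrier G \<and> length xs = 2 * j}"
  define T where "T = (\<lambda>(xs, i). {g \<in> ehom G G. \<forall>e\<in>set es. g e \<otimes> inv (e [^] (i::nat)) \<in> adjoins {\<one>} xs})"
  have finL: "finite L" and cL: "card L = p ^ (n * (2 * j))"
    unfolding L_def using finite_lists_length_eq[OF fin] card_lists_length_eq[OF fin] n
    by (auto simp: order_def power_mult)
  have sub: "{g \<in> ehom G G. shift_rank p G g = j} \<subseteq> (\<Union>q\<in>L \<times> {..<p}. T q)"
  proof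
    fix g assume "g \<in> {g \<in> ehom G G. shift_rank p G g = j}"
    then have g: "g \<in> ehom G G" "shift_rank p G g = j" by auto
    then have gh: "g \<in> hom G G" by (simp add: ehom_def)
    obtain K where K: "shifted G g K" "card K = p ^ shift_rank p G g" using shift_rank_props(1)[OF n] by blast
    obtain i where i: "i < p" "\<forall>v\<in>carrier G. g v \<otimes> inv (v [^] (i::nat)) \<in> K <#> g ` K"
      using scalar_mod_shift[OF n gh K] True g(2) by auto
    obtain xs where xs: "set xs \<subseteq> K <#> g ` K" "adjoins {\<one>} xs = K <#> g ` K" "card (K <#> g ` K) = p ^ length xs"
      using gens[OF shifted_sum(1)[OF gh K(1)]] by blast
    have "p ^ length xs = p ^ (2 * j)" using xs(3) shifted_sum(2)[OF gh K(1)] K(2) g(2)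
      by (simp add: mult_2 power_add)
    then have "length xs = 2 * j" using p_gt_1 by simp
    then have "xs \<in> L" unfolding L_def using xs(1) subgroup.subset[OF shifted_sum(1)[OF gh K(1)]] by auto
    moreover have "g \<in> T (xs, i)" unfolding T_def using g(1) i(2) xs(2) es(1) by auto
    ultimately show "g \<in> (\<Union>q\<in>L \<times> {..<p}. T q)" using i(1) by blast
  qed
  have cT: "finite (T q) \<and> card (T q) \<le> p ^ (2 * j * n)" if q: "q \<in> L \<times> {..<p}" for q
  proof -
    obtain xs i where qi: "q = (xs, i)" "xs \<in> L" using q by blast
    have xsc: "set xs \<subseteq> carrier G" "length xs = 2 * j" using qi(2) by (auto simp: L_def)
    let ?D = "adjoins {\<one>} xs"
    have sD: "subgroup ?D G" by (rule adjoins_sub[OF triv_subgroup xsc(1)])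
    have fD: "finite ?D" using fin subgroup.subset[OF sD] finite_subset by blast
    have "finite (T q) \<and> card (T q) \<le> card ?D ^ n"
    proof (rule card_le_lists[OF fD, where F = "\<lambda>g. map (\<lambda>e. g e \<otimes> inv (e [^] i)) es"])
      show "set (map (\<lambda>e. g e \<otimes> inv (e [^] i)) es) \<subseteq> ?D \<and> length (map (\<lambda>e. g e \<otimes> inv (e [^] i)) es) = n"
        if "g \<in> T q" for g using that le unfolding T_def qi by auto
      show "inj_on (\<lambda>g. map (\<lambda>e. g e \<otimes> inv (e [^] i)) es) (T q)"
      proof (rule inj_onI)
        fix f g assume f: "f \<in> T q" and g: "g \<in> T q"
          and eq: "map (\<lambda>e. f e \<otimes> inv (e [^] i)) es = map (\<lambda>e. g e \<otimes> inv (e [^] i)) es"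
        have fg: "f \<in> ehom G G" "g \<in> ehom G G" using f g unfolding T_def qi by auto
        show "f = g"
        proof (rule ehom_determined[OF is_group es(1,2) fg])
          fix e assume e: "e \<in> set es"
          then have "f e \<otimes> inv (e [^] i) = g e \<otimes> inv (e [^] i)" using eq by simp
          moreover have "f e \<in> carrier G" "g e \<in> carrier G" "e \<in> carrier G"
            using fg e es(1) by (auto simp: ehom_def hom_def)
          ultimately show "f e = g e" by simp
        qed
      qed
    qed
    moreover have "card ?D \<le> p ^ (2 * j)" using adjoins_card_le[OF triv_subgroup xsc(1)] xsc(2) by simp
    then have "card ?D ^ n \<le> p ^ (2 * j * n)" by (simp add: power_mono power_mult)
    ultimately show ?thesis by linarith
  qed
  have fU: "finite (\<Union>q\<in>L \<times> {..<p}. T q)" using finL cT by blast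
  have "card {g \<in> ehom G G. shift_rank p G g = j} \<le> card (\<Union>q\<in>L \<times> {..<p}. T q)"
    by (rule card_mono[OF fU sub])
  also have "\<dots> \<le> (\<Sum>q\<in>L \<times> {..<p}. card (T q))" using finL by (intro card_UN_le) auto
  also have "\<dots> \<le> (\<Sum>q\<in>L \<times> {..<p}. p ^ (2 * j * n))" using cT by (intro sum_mono) blast
  also have "\<dots> = p ^ (n * (2 * j)) * p * p ^ (2 * j * n)" using cL by (simp add: card_cartesian_product)
  also have "\<dots> = p ^ (4 * j * n + 1)" by (simp add: algebra_simps flip: power_add power_Suc)
  also have "\<dots> \<le> p ^ (4 * j * n + n + 1)" using p_gt_1 by (intro power_increasing) auto
  finally show ?thesis .
qed

text \<open>Against rank 0 the summand at rank \<open>j\<close> is smaller by \<open>p^(rj)\<close>,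
  which pays for the factor \<open>p^(4jn)\<close> in the number of such endomorphisms once
  \<open>r >= 4 n\<close>. There remain \<open>p^(n+1)\<close> for each of \<open>n + 1\<close>
  ranks.\<close>

lemma sum_shift_rank:
  assumes n: "order G = p ^ n" and r: "4 * n \<le> r"
  shows "(\<Sum>g\<in>ehom G G. p ^ (r * (n - shift_rank p G g))) \<le> p ^ (r * n + 2 * n + 1)"
proof -
  have finE: "finite (ehom G G)" using card_ehom[OF is_group fin n] by blast
  have le: "shift_rank p G g \<le> n" if "g \<in> ehom G G" for g
    using shift_rank_le[OF n, of g] that by (auto simp: ehom_def)
  have "(\<Sum>g\<in>ehom G G. p ^ (r * (n - shift_rank p G g)))
    = (\<Sum>j\<le>n. \<Sum>g\<in>{g \<in> ehom G G. shift_rank p G g = j}. p ^ (r * (n - shift_rank p G g)))"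
    by (rule sum.group[symmetric]) (use finE le in auto)
  also have "\<dots> = (\<Sum>j\<le>n. card {g \<in> ehom G G. shift_rank p G g = j} * p ^ (r * (n - j)))"
    by (intro sum.cong refl) simp
  also have "\<dots> \<le> (\<Sum>j\<le>n. p ^ (r * n + n + 1))"
  proof (rule sum_mono)
    fix j assume j: "j \<in> {..n}"
    have "card {g \<in> ehom G G. shift_rank p G g = j} * p ^ (r * (n - j))
      \<le> p ^ (4 * j * n + n + 1) * p ^ (r * (n - j))"
      using card_shift_rank[OF n] by (rule mult_le_mono1)
    also have "\<dots> = p ^ (4 * j * n + n + 1 + r * (n - j))" by (simp add: power_add)
    also have "\<dots> \<le> p ^ (r * n + n + 1)"
    proof (rule power_increasing)
      have "(4 * n) * j \<le> r * j" using r by (rule mult_le_mono1)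
      moreover have "r * (n - j) + r * j = r * n" using j by (simp flip: add_mult_distrib2)
      ultimately show "4 * j * n + n + 1 + r * (n - j) \<le> r * n + n + 1"
        using mult.assoc[of 4 j n] mult.assoc[of 4 n j] mult.commute[of j n] by linarith
    qed (use p_gt_1 in simp)
    finally show "card {g \<in> ehom G G. shift_rank p G g = j} * p ^ (r * (n - j)) \<le> p ^ (r * n + n + 1)" .
  qed
  also have "\<dots> = (n + 1) * p ^ (r * n + n + 1)" by simp
  also have "\<dots> \<le> p ^ n * p ^ (r * n + n + 1)"
  proof (rule mult_le_mono1)
    have "n + 1 \<le> 2 ^ n" by (simp add: Suc_leI)
    also have "(2::nat) ^ n \<le> p ^ n" using p_gt_1 by (intro power_mono) auto
    finally show "n + 1 \<le> p ^ n" .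
  qed
  also have "\<dots> = p ^ (r * n + 2 * n + 1)" unfolding power_add[symmetric]
    by (rule arg_cong[of _ _ "\<lambda>x. p ^ x"]) simp
  finally show ?thesis .
qed

end

text \<open>Half of the power is estimated by the source bound and half by the target bound; the
  summand becomes a function of \<open>g\<close> times a function of \<open>h\<close>. Up to a
  linear exponent only \<open>p^(2rds)\<close>, the size of the term at a pair of identities,
  survives.\<close>

lemma sum_card_intertwiners:
  assumes V: "elab V p" and W: "elab W p" and d: "order V = p ^ d" and s: "order W = p ^ s"
    and r: "4 * d \<le> r * s" "4 * s \<le> r * d"
  shows "(\<Sum>g\<in>ehom V V. \<Sum>h\<in>ehom W W. card (intertwiners V W g h) ^ (2 * r))
    \<le> p ^ (2 * r * d * s + 2 * d + 2 * s + 2)"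
proof -
  interpret V: elab V p by fact
  interpret W: elab W p by fact
  have "(\<Sum>g\<in>ehom V V. \<Sum>h\<in>ehom W W. card (intertwiners V W g h) ^ (2 * r))
    \<le> (\<Sum>g\<in>ehom V V. \<Sum>h\<in>ehom W W. p ^ ((r * s) * (d - shift_rank p V g)) * p ^ ((r * d) * (s - shift_rank p W h)))"
  proof (intro sum_mono)
    fix g h assume "g \<in> ehom V V" "h \<in> ehom W W"
    then have gh: "g \<in> hom V V" "h \<in> hom W W" by (auto simp: ehom_def)
    let ?c = "card (intertwiners V W g h)"
    have "?c ^ r \<le> (p ^ (s * (d - shift_rank p V g))) ^ r"
      by (intro power_mono card_intertwiners_source(2)[OF V W d s gh(1)]) simp
    moreover have "?c ^ r \<le> (p ^ (d * (s - shift_rank p W h))) ^ r"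
      by (intro power_mono card_intertwiners_target[OF V W d s gh]) simp
    ultimately have "?c ^ r * ?c ^ r \<le> (p ^ (s * (d - shift_rank p V g))) ^ r * (p ^ (d * (s - shift_rank p W h))) ^ r"
      by (rule mult_le_mono)
    moreover have "?c ^ (2 * r) = ?c ^ r * ?c ^ r" by (simp add: mult_2 power_add)
    ultimately show "?c ^ (2 * r) \<le> p ^ ((r * s) * (d - shift_rank p V g)) * p ^ ((r * d) * (s - shift_rank p W h))"
      by (simp add: ac_simps flip: power_mult)
  qed
  also have "\<dots> = (\<Sum>g\<in>ehom V V. p ^ ((r * s) * (d - shift_rank p V g))) * (\<Sum>h\<in>ehom W W. p ^ ((r * d) * (s - shift_rank p W h)))"
    by (simp add: sum_product)
  also have "\<dots> \<le> p ^ ((r * s) * d + 2 * d + 1) * p ^ ((r * d) * s + 2 * s + 1)"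
    by (intro mult_le_mono V.sum_shift_rank[OF d r(1)] W.sum_shift_rank[OF s r(2)])
  also have "\<dots> = p ^ (2 * r * d * s + 2 * d + 2 * s + 2)" unfolding power_add[symmetric]
    by (rule arg_cong[of _ _ "\<lambda>x. p ^ x"]) (simp add: algebra_simps)
  finally show ?thesis .
qed

section \<open>A standard elementary abelian group\<close>

definition vg :: "nat \<Rightarrow> nat \<Rightarrow> (nat \<Rightarrow> nat) monoid" where
  "vg p n = \<lparr>carrier = {..<n} \<rightarrow>\<^sub>E {..<p},
     monoid.mult = (\<lambda>a b. \<lambda>i\<in>{..<n}. (a i + b i) mod p), one = (\<lambda>i\<in>{..<n}. 0)\<rparr>"

definition unitv :: "nat \<Rightarrow> nat \<Rightarrow> nat \<Rightarrow> nat" where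
  "unitv n i = (\<lambda>j\<in>{..<n}. if j = i then 1 else 0)"

lemma carrier_vg: "carrier (vg p n) = {..<n} \<rightarrow>\<^sub>E {..<p}"
  by (simp add: vg_def)

lemma mult_vg: "a \<otimes>\<^bsub>vg p n\<^esub> b = (\<lambda>i\<in>{..<n}. (a i + b i) mod p)"
  by (simp add: vg_def)

lemma one_vg: "\<one>\<^bsub>vg p n\<^esub> = (\<lambda>i\<in>{..<n}. 0)"
  by (simp add: vg_def)

lemma order_vg: "order (vg p n) = p ^ n"
  by (simp add: order_def carrier_vg card_funcsetE)

lemma vg_eqI: "a \<in> carrier (vg p n) \<Longrightarrow> b \<in> carrier (vg p n) \<Longrightarrow> (\<And>i. i < n \<Longrightarrow> a i = b i) \<Longrightarrow> a = b"
  unfolding carrier_vg by (rule PiE_ext) auto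

lemma unitv_closed: "p > 1 \<Longrightarrow> unitv n i \<in> carrier (vg p n)"
  by (auto simp: unitv_def carrier_vg)

lemma comm_group_vg:
  assumes p: "p > 0"
  shows "comm_group (vg p n)"
proof (rule comm_groupI)
  show "x \<otimes>\<^bsub>vg p n\<^esub> y \<in> carrier (vg p n)" for x y using p by (auto simp: mult_vg carrier_vg)
  show "\<one>\<^bsub>vg p n\<^esub> \<in> carrier (vg p n)" using p by (auto simp: one_vg carrier_vg)
  show "x \<otimes>\<^bsub>vg p n\<^esub> y \<otimes>\<^bsub>vg p n\<^esub> z = x \<otimes>\<^bsub>vg p n\<^esub> (y \<otimes>\<^bsub>vg p n\<^esub> z)" for x y z
    by (auto simp: mult_vg mod_simps ac_simps intro!: restrict_ext)
  show "x \<otimes>\<^bsub>vg p n\<^esub> y = y \<otimes>\<^bsub>vg p n\<^esub> x" for x y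
    by (auto simp: mult_vg ac_simps intro!: restrict_ext)
  show "\<one>\<^bsub>vg p n\<^esub> \<otimes>\<^bsub>vg p n\<^esub> x = x" if "x \<in> carrier (vg p n)" for x
    using that by (auto simp: mult_vg one_vg carrier_vg PiE_iff extensional_def)
  show "\<exists>y\<in>carrier (vg p n). y \<otimes>\<^bsub>vg p n\<^esub> x = \<one>\<^bsub>vg p n\<^esub>" if x: "x \<in> carrier (vg p n)" for x
  proof
    show "(\<lambda>i\<in>{..<n}. (p - x i) mod p) \<in> carrier (vg p n)" using p by (auto simp: carrier_vg)
    have "((p - x i) mod p + x i) mod p = 0" if "i < n" for i
    proof -
      have "x i < p" using x that by (auto simp: carrier_vg PiE_iff)
      then show ?thesis by (simp add: mod_simps)
    qed
    then show "(\<lambda>i\<in>{..<n}. (p - x i) mod p) \<otimes>\<^bsub>vg p n\<^esub> x = \<one>\<^bsub>vg p n\<^esub>"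
      by (auto simp: mult_vg one_vg intro!: restrict_ext)
  qed
qed

lemma pow_vg:
  assumes p: "p > 0" and a: "a \<in> carrier (vg p n)"
  shows "a [^]\<^bsub>vg p n\<^esub> (k::nat) = (\<lambda>i\<in>{..<n}. (k * a i) mod p)"
proof (induction k)
  case 0 then show ?case by (simp add: one_vg)
next
  case (Suc k)
  then show ?case by (auto simp: mult_vg mod_simps add.commute intro!: restrict_ext)
qed

lemma elab_vg:
  assumes "prime p"
  shows "elab (vg p n) p"
proof -
  have p: "p > 0" using assms by (rule prime_gt_0_nat)
  interpret comm_group "vg p n" by (rule comm_group_vg[OF p])
  show ?thesis
    by unfold_locales (use assms p in \<open>auto simp: pow_vg one_vg carrier_vg finite_PiE\<close>)
qed

lemma vg_generated:
  assumes p: "prime p" and H: "subgroup H (vg p n)"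
    and e: "\<And>i. i < n \<Longrightarrow> unitv n i \<in> H"
  shows "H = carrier (vg p n)"
proof
  interpret elab "vg p n" p by (rule elab_vg[OF p])
  show "H \<subseteq> carrier (vg p n)" by (rule subgroup.subset[OF H])
  show "carrier (vg p n) \<subseteq> H"
  proof
    fix a assume a: "a \<in> carrier (vg p n)"
    \<comment> \<open>The vector \<open>a\<close> is built up coordinate by coordinate from
      multiples of unit vectors.\<close>
    have "(\<lambda>i\<in>{..<n}. if i < k then a i else 0) \<in> H" if "k \<le> n" for k
      using that
    proof (induction k)
      case 0
      have "(\<lambda>i\<in>{..<n}. if i < 0 then a i else 0) = \<one>\<^bsub>vg p n\<^esub>" by (auto simp: one_vg)
      then show ?case using subgroup.one_closed[OF H] by simp
    next
      case (Suc k)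
      have pw: "unitv n k [^]\<^bsub>vg p n\<^esub> i \<in> H" for i :: nat
        by (induction i) (use e Suc.prems subgroup.one_closed[OF H] subgroup.m_closed[OF H] in auto)
      have ak: "a k < p" using a Suc.prems by (auto simp: carrier_vg PiE_iff)
      have lt: "a i < p" if "i < n" for i using a that by (auto simp: carrier_vg PiE_iff)
      have pk: "unitv n k [^]\<^bsub>vg p n\<^esub> a k = (\<lambda>i\<in>{..<n}. (a k * unitv n k i) mod p)"
        by (rule pow_vg[OF _ unitv_closed]) (use p_gt_1 in auto)
      have "(\<lambda>i\<in>{..<n}. if i < Suc k then a i else 0)
        = (\<lambda>i\<in>{..<n}. if i < k then a i else 0) \<otimes>\<^bsub>vg p n\<^esub> (unitv n k [^]\<^bsub>vg p n\<^esub> a k)"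
        unfolding pk using ak lt by (auto simp: mult_vg unitv_def less_Suc_eq intro!: restrict_ext)
      moreover have "(\<lambda>i\<in>{..<n}. if i < k then a i else 0) \<otimes>\<^bsub>vg p n\<^esub> (unitv n k [^]\<^bsub>vg p n\<^esub> a k) \<in> H"
        by (rule subgroup.m_closed[OF H Suc.IH[OF Suc_leD[OF Suc.prems]] pw])
      ultimately show ?case by simp
    qed
    from this[of n] have "(\<lambda>i\<in>{..<n}. if i < n then a i else 0) \<in> H" by simp
    also have "(\<lambda>i\<in>{..<n}. if i < n then a i else 0) = a"
      using a by (auto simp: carrier_vg PiE_iff extensional_def)
    finally show "a \<in> H" .
  qed
qed

lemma vg_hom_eq:
  assumes p: "prime p" and "group W" "f \<in> hom (vg p n) W" "g \<in> hom (vg p n) W"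
    and "\<And>i. i < n \<Longrightarrow> f (unitv n i) = g (unitv n i)" and "x \<in> carrier (vg p n)"
  shows "f x = g x"
proof -
  interpret elab "vg p n" p by (rule elab_vg[OF p])
  have "subgroup {x \<in> carrier (vg p n). f x = g x} (vg p n)"
    by (rule equalizer_subgroup[OF is_group assms(2-4)])
  then have "{x \<in> carrier (vg p n). f x = g x} = carrier (vg p n)"
    by (rule vg_generated[OF p]) (use assms(5) unitv_closed p_gt_1 in auto)
  then show ?thesis using assms(6) by blast
qed

section \<open>Coordinates and the number of bases\<close>

context elab
begin

definition lincomb :: "'a list \<Rightarrow> (nat \<Rightarrow> nat) \<Rightarrow> 'a" where
  "lincomb xs = (\<lambda>a\<in>carrier (vg p (length xs)). \<Otimes>i\<in>{..<length xs}. (xs ! i) [^] a i)"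

lemma lincomb_unitv:
  assumes "set xs \<subseteq> carrier G" "i < length xs"
  shows "lincomb xs (unitv (length xs) i) = xs ! i"
proof -
  have xc: "xs ! j \<in> carrier G" if "j < length xs" for j using assms(1) that by auto
  have "(\<Otimes>j\<in>{..<length xs}. (xs ! j) [^] unitv (length xs) i j)
    = (\<Otimes>j\<in>{..<length xs}. if i = j then xs ! j else \<one>)"
    by (rule finprod_cong') (use xc in \<open>auto simp: unitv_def\<close>)
  also have "\<dots> = xs ! i"
    using finprod_singleton[of i "{..<length xs}" "\<lambda>j. xs ! j"] assms xc by auto
  finally show ?thesis using unitv_closed[OF p_gt_1] by (simp add: lincomb_def)
qed

lemma lincomb_hom:
  assumes "set xs \<subseteq> carrier G"
  shows "lincomb xs \<in> ehom (vg p (length xs)) G"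
proof -
  let ?n = "length xs"
  have xc: "xs ! j \<in> carrier G" if "j < ?n" for j using assms that by auto
  interpret vg: elab "vg p ?n" p by (rule elab_vg[OF prime_p])
  have "lincomb xs (a \<otimes>\<^bsub>vg p ?n\<^esub> b) = lincomb xs a \<otimes> lincomb xs b"
    if ab: "a \<in> carrier (vg p ?n)" "b \<in> carrier (vg p ?n)" for a b
  proof -
    have "(\<Otimes>i\<in>{..<?n}. (xs ! i) [^] (a \<otimes>\<^bsub>vg p ?n\<^esub> b) i)
      = (\<Otimes>i\<in>{..<?n}. (xs ! i) [^] a i \<otimes> (xs ! i) [^] b i)"
    proof (rule finprod_cong')
      fix i assume "i \<in> {..<?n}"
      then show "xs ! i [^] (a \<otimes>\<^bsub>vg p ?n\<^esub> b) i = xs ! i [^] a i \<otimes> xs ! i [^] b i"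
        using pow_mod_p[of "xs ! i" "a i + b i"] xc by (simp add: mult_vg nat_pow_mult)
    qed (use xc in auto)
    also have "\<dots> = (\<Otimes>i\<in>{..<?n}. (xs ! i) [^] a i) \<otimes> (\<Otimes>i\<in>{..<?n}. (xs ! i) [^] b i)"
      by (rule finprod_multf) (use xc in auto)
    finally show ?thesis using ab by (simp add: lincomb_def)
  qed
  moreover have "lincomb xs a \<in> carrier G" if "a \<in> carrier (vg p ?n)" for a
    using that xc by (auto simp: lincomb_def intro!: finprod_closed)
  ultimately show ?thesis by (simp add: ehom_def hom_def Pi_def) (simp add: lincomb_def)
qed

lemma lincomb_bij:
  assumes "set xs \<subseteq> carrier G" "adjoins {\<one>} xs = carrier G" "order G = p ^ length xs"
  shows "bij_betw (lincomb xs) (carrier (vg p (length xs))) (carrier G)"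
proof -
  let ?V = "vg p (length xs)"
  interpret V: elab ?V p by (rule elab_vg[OF prime_p])
  interpret L: group_hom ?V G "lincomb xs"
    using lincomb_hom[OF assms(1)] by unfold_locales (auto simp: ehom_def)
  have img: "subgroup (lincomb xs ` carrier ?V) G" by (rule L.img_is_subgroup)
  have "set xs \<subseteq> lincomb xs ` carrier ?V"
  proof
    fix x assume "x \<in> set xs"
    then obtain i where "i < length xs" "x = xs ! i" by (auto simp: in_set_conv_nth)
    then have "x = lincomb xs (unitv (length xs) i)" using lincomb_unitv[OF assms(1)] by simp
    then show "x \<in> lincomb xs ` carrier ?V" using unitv_closed[OF p_gt_1] by blast
  qed
  then have "adjoins {\<one>} xs \<subseteq> lincomb xs ` carrier ?V"
    by (intro adjoins_minimal[OF img]) (use subgroup.one_closed[OF img] in auto)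
  then have surj: "lincomb xs ` carrier ?V = carrier G" using assms(2) subgroup.subset[OF img] by simp
  moreover have "card (carrier ?V) = card (carrier G)" using assms(3) order_vg[of p "length xs"] by (simp add: order_def)
  ultimately have "inj_on (lincomb xs) (carrier ?V)" by (intro eq_card_imp_inj_on V.fin) simp
  then show ?thesis using surj by (simp add: bij_betw_def)
qed

lemma iso_vg:
  assumes "order G = p ^ n"
  shows "\<exists>f. f \<in> iso G (vg p n)"
proof -
  obtain xs where xs: "set xs \<subseteq> carrier G" "adjoins {\<one>} xs = carrier G" "card (carrier G) = p ^ length xs"
    using gens[OF subgroup_self] by blast
  have n: "length xs = n" using xs(3) assms p_gt_1 by (simp add: order_def)
  interpret V: elab "vg p n" p by (rule elab_vg[OF prime_p])
  have "lincomb xs \<in> iso (vg p n) G"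
    using lincomb_hom[OF xs(1)] lincomb_bij[OF xs(1,2)] assms n by (auto simp: iso_def ehom_def)
  then show ?thesis using V.iso_set_sym by blast
qed

text \<open>Each new vector avoids a proper subspace, which leaves at least
  \<open>p^n - p^(n-1) >= p^(n-1)\<close> choices. Against \<open>p^(n*n)\<close> this loses only a
  factor \<open>p^n\<close>, harmless within \<open>p^O(l)\<close>.\<close>

lemma card_independent_lists:
  assumes n: "order G = p ^ n" and "k \<le> n"
  shows "(p ^ (n - 1)) ^ k \<le> card {xs. set xs \<subseteq> carrier G \<and> length xs = k \<and> card (adjoins {\<one>} xs) = p ^ k}"
  using assms(2)
proof (induction k)
  case 0
  have "{xs. set xs \<subseteq> carrier G \<and> length xs = 0 \<and> card (adjoins {\<one>} xs) = p ^ 0} = {[]}" by auto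
  then show ?case by simp
next
  case (Suc k)
  let ?I = "\<lambda>k. {xs. set xs \<subseteq> carrier G \<and> length xs = k \<and> card (adjoins {\<one>} xs) = p ^ k}"
  have finI: "finite (?I k)" for k by (rule finite_subset[OF _ finite_lists_length_eq[OF fin, of k]]) auto
  let ?S = "SIGMA xs:?I k. carrier G - adjoins {\<one>} xs"
  have sub: "subgroup (adjoins {\<one>} xs) G" if "set xs \<subseteq> carrier G" for xs
    by (rule adjoins_sub[OF triv_subgroup that])
  have "(\<lambda>(xs, x). x # xs) ` ?S \<subseteq> ?I (Suc k)"
    using adjoin_card[OF sub] by auto
  then have "card ((\<lambda>(xs, x). x # xs) ` ?S) \<le> card (?I (Suc k))" by (rule card_mono[OF finI])
  moreover have "inj_on (\<lambda>(xs, x). x # xs) ?S" by (auto simp: inj_on_def)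
  ultimately have le: "card ?S \<le> card (?I (Suc k))" by (simp add: card_image)
  have "card (?I k) * p ^ (n - 1) = (\<Sum>xs\<in>?I k. p ^ (n - 1))" by simp
  also have "\<dots> \<le> (\<Sum>xs\<in>?I k. card (carrier G - adjoins {\<one>} xs))"
  proof (rule sum_mono)
    fix xs assume xs: "xs \<in> ?I k"
    have s: "adjoins {\<one>} xs \<subseteq> carrier G" using sub[of xs] xs subgroup.subset by blast
    have "card (carrier G - adjoins {\<one>} xs) = p ^ n - p ^ k"
      using card_Diff_subset[OF _ s] finite_subset[OF s fin] xs n by (simp add: order_def)
    moreover have "p ^ k \<le> p ^ (n - 1)" using Suc.prems p_gt_1 by (intro power_increasing) auto
    moreover have "2 * p ^ (n - 1) \<le> p ^ n"
      using Suc.prems p_gt_1 by (cases n) auto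
    ultimately show "p ^ (n - 1) \<le> card (carrier G - adjoins {\<one>} xs)" by linarith
  qed
  also have "\<dots> = card ?S" using finI fin by (simp add: card_SigmaI)
  finally have "card (?I k) * p ^ (n - 1) \<le> card (?I (Suc k))" using le by linarith
  moreover have "(p ^ (n - 1)) ^ k * p ^ (n - 1) \<le> card (?I k) * p ^ (n - 1)"
    using Suc.IH Suc.prems by (intro mult_le_mono1) linarith
  moreover have "(p ^ (n - 1)) ^ Suc k = (p ^ (n - 1)) ^ k * p ^ (n - 1)" by simp
  ultimately show ?case by linarith
qed

end

definition autos :: "nat \<Rightarrow> nat \<Rightarrow> ((nat \<Rightarrow> nat) \<Rightarrow> (nat \<Rightarrow> nat)) set" where
  "autos p n = {g \<in> ehom (vg p n) (vg p n). bij_betw g (carrier (vg p n)) (carrier (vg p n))}"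

lemma card_autos:
  assumes p: "prime p"
  shows "finite (autos p n)" "p ^ ((n - 1) * n) \<le> card (autos p n)"
proof -
  interpret V: elab "vg p n" p by (rule elab_vg[OF p])
  have "finite (ehom (vg p n) (vg p n))" using V.card_ehom[OF V.is_group V.fin order_vg] by blast
  then show fA: "finite (autos p n)" by (simp add: autos_def)
  let ?I = "{xs. set xs \<subseteq> carrier (vg p n) \<and> length xs = n \<and> card (V.adjoins {\<one>\<^bsub>vg p n\<^esub>} xs) = p ^ n}"
  have "inj_on V.lincomb ?I"
  proof (rule inj_onI)
    fix xs ys assume h: "xs \<in> ?I" "ys \<in> ?I" "V.lincomb xs = V.lincomb ys"
    show "xs = ys"
    proof (rule nth_equalityI)
      fix i assume "i < length xs"
      then show "xs ! i = ys ! i"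
        using V.lincomb_unitv[of xs i] V.lincomb_unitv[of ys i] h by simp
    qed (use h in simp)
  qed
  moreover have "V.lincomb ` ?I \<subseteq> autos p n"
  proof
    fix g assume "g \<in> V.lincomb ` ?I"
    then obtain xs where xs: "xs \<in> ?I" "g = V.lincomb xs" by blast
    have "V.adjoins {\<one>\<^bsub>vg p n\<^esub>} xs \<subseteq> carrier (vg p n)"
      using V.adjoins_sub[OF V.triv_subgroup] xs(1) subgroup.subset by blast
    then have "V.adjoins {\<one>\<^bsub>vg p n\<^esub>} xs = carrier (vg p n)"
      using xs(1) order_vg[of p n] by (intro card_subset_eq[OF V.fin]) (auto simp: order_def)
    then show "g \<in> autos p n"
      using V.lincomb_hom[of xs] V.lincomb_bij[of xs] xs order_vg[of p n] by (simp add: autos_def)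
  qed
  ultimately have "card ?I \<le> card (autos p n)" by (meson card_inj_on_le fA)
  then show "p ^ ((n - 1) * n) \<le> card (autos p n)"
    using V.card_independent_lists[OF order_vg order_refl] by (simp add: power_mult)
qed

section \<open>Framed central extensions\<close>

text \<open>\<open>Z\<close> stands for the centre in one class and for the Frattini subgroup in the
  other, so that both are counted by the same argument.\<close>

locale central_ext = group G for G (structure) +
  fixes p d s :: nat and Z
  assumes prime_p: "prime p"
    and subZ: "subgroup Z G"
    and central: "z \<in> Z \<Longrightarrow> x \<in> carrier G \<Longrightarrow> z \<otimes> x = x \<otimes> z"
    and powZ: "z \<in> Z \<Longrightarrow> z [^] p = \<one>"
    and pow_mem: "x \<in> carrier G \<Longrightarrow> x [^] p \<in> Z"
    and comm_mem: "x \<in> carrier G \<Longrightarrow> y \<in> carrier G \<Longrightarrow> comm x y \<in> Z"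
    and cardZ: "card Z = p ^ s"
    and ordG: "order G = p ^ (d + s)"
begin

lemma p_gt_1: "p > 1" using prime_gt_1_nat[OF prime_p] .

lemma finG: "finite (carrier G)"
  using ordG p_gt_1 order_gt_0_iff_finite by simp

lemma Zc: "z \<in> Z \<Longrightarrow> z \<in> carrier G"
  using subZ by (simp add: subgroup.mem_carrier)

lemma normalZ: "Z \<lhd> G"
proof -
  have "x \<otimes> z \<otimes> inv x = z" if "x \<in> carrier G" "z \<in> Z" for x z
  proof -
    have "x \<otimes> z \<otimes> inv x = z \<otimes> x \<otimes> inv x" using central[OF that(2,1)] by simp
    then show ?thesis using that Zc by (simp add: m_assoc)
  qed
  then show ?thesis using subZ by (simp add: normal_inv_iff)
qed

lemma elab_Z: "elab (G\<lparr>carrier := Z\<rparr>) p"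
proof -
  interpret ZG: group "G\<lparr>carrier := Z\<rparr>" by (rule subgroup_imp_group[OF subZ])
  have "comm_group (G\<lparr>carrier := Z\<rparr>)" by (rule ZG.group_comm_groupI) (use central Zc in auto)
  then interpret ZG: comm_group "G\<lparr>carrier := Z\<rparr>" .
  show ?thesis
  proof unfold_locales
    show "finite (carrier (G\<lparr>carrier := Z\<rparr>))" using finG subgroup.subset[OF subZ] finite_subset by auto
    show "x [^]\<^bsub>G\<lparr>carrier := Z\<rparr>\<^esub> p = \<one>\<^bsub>G\<lparr>carrier := Z\<rparr>\<^esub>" if "x \<in> carrier (G\<lparr>carrier := Z\<rparr>)" for x
      using that powZ nat_pow_consistent[of x p Z] by simp
  qed (rule prime_p)
qed

lemma elab_quotient: "elab (G Mod Z) p"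
proof -
  interpret Z: normal Z G by (rule normalZ)
  interpret Q: group "G Mod Z" by (rule Z.factorgroup_is_group)
  have comm: "a \<otimes>\<^bsub>G Mod Z\<^esub> b = b \<otimes>\<^bsub>G Mod Z\<^esub> a" if ab: "a \<in> carrier (G Mod Z)" "b \<in> carrier (G Mod Z)" for a b
  proof -
    obtain x y where xy: "x \<in> carrier G" "a = Z #> x" "y \<in> carrier G" "b = Z #> y"
      using ab by (auto simp: carrier_FactGroup)
    have "Z #> (x \<otimes> y) = Z #> (comm x y \<otimes> (y \<otimes> x))" using comm_eq[of x y] xy by simp
    also have "\<dots> = (Z #> comm x y) #> (y \<otimes> x)" using xy Z.subset by (simp add: coset_mult_assoc)
    also have "Z #> comm x y = Z" using coset_join2[OF _ subZ comm_mem] xy by simp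
    finally show ?thesis using xy by (simp add: Z.rcos_sum)
  qed
  then interpret Q: comm_group "G Mod Z" by (rule Q.group_comm_groupI)
  show ?thesis
  proof unfold_locales
    show "finite (carrier (G Mod Z))" using finG by (simp add: carrier_FactGroup)
    fix a assume "a \<in> carrier (G Mod Z)"
    then obtain x where x: "x \<in> carrier G" "a = Z #> x" by (auto simp: carrier_FactGroup)
    then have "a [^]\<^bsub>G Mod Z\<^esub> p = Z #> x [^] p" by (simp add: Z.FactGroup_pow)
    also have "\<dots> = Z" using coset_join2[OF _ subZ pow_mem] x by simp
    finally show "a [^]\<^bsub>G Mod Z\<^esub> p = \<one>\<^bsub>G Mod Z\<^esub>" by simp
  qed (rule prime_p)
qed

lemma order_quotient: "order (G Mod Z) = p ^ d"
proof -
  have "card (rcosets Z) * p ^ s = p ^ d * p ^ s" using lagrange[OF subZ] cardZ ordG by (simp add: power_add)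
  then show ?thesis using p_gt_1 by (simp add: FactGroup_def order_def)
qed

text \<open>Central factors cancel from a commutator. Hence it depends only on cosets of
  \<open>Z\<close>, and the commutator form on the quotient is well defined.\<close>

lemma comm_shift:
  assumes "x \<in> carrier G" "y \<in> carrier G" "z \<in> Z" "z' \<in> Z"
  shows "comm (z \<otimes> x) (z' \<otimes> y) = comm x y"
proof (rule comm_unique)
  have c: "z \<in> carrier G" "z' \<in> carrier G" using assms Zc by auto
  have "(z \<otimes> x) \<otimes> (z' \<otimes> y) = z \<otimes> (x \<otimes> z') \<otimes> y" using assms c by (simp add: m_assoc)
  also have "\<dots> = (z \<otimes> z') \<otimes> (x \<otimes> y)" using assms c by (simp add: m_assoc central[OF assms(4,1), symmetric])
  also have "\<dots> = (z \<otimes> z') \<otimes> (comm x y \<otimes> (y \<otimes> x))" using comm_eq[OF assms(1,2)] by simp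
  also have "\<dots> = ((z \<otimes> z') \<otimes> comm x y) \<otimes> (y \<otimes> x)" using assms c by (simp add: m_assoc)
  also have "(z \<otimes> z') \<otimes> comm x y = comm x y \<otimes> (z \<otimes> z')"
    by (rule central) (use assms subgroup.m_closed[OF subZ] in auto)
  also have "\<dots> \<otimes> (y \<otimes> x) = comm x y \<otimes> ((z \<otimes> z') \<otimes> (y \<otimes> x))" using assms c by (simp add: m_assoc)
  also have "(z \<otimes> z') \<otimes> (y \<otimes> x) = (z' \<otimes> z) \<otimes> (y \<otimes> x)" using central[OF assms(3) c(2)] by simp
  also have "\<dots> = z' \<otimes> (z \<otimes> y) \<otimes> x" using assms c by (simp add: m_assoc)
  also have "\<dots> = (z' \<otimes> y) \<otimes> (z \<otimes> x)" using assms c central[OF assms(3,2)] by (simp add: m_assoc)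
  finally show "z \<otimes> x \<otimes> (z' \<otimes> y) = comm x y \<otimes> (z' \<otimes> y \<otimes> (z \<otimes> x))" .
qed (use assms Zc in auto)

lemma comm_mult_right:
  assumes "x \<in> carrier G" "y \<in> carrier G" "y' \<in> carrier G"
  shows "comm x (y \<otimes> y') = comm x y \<otimes> comm x y'"
proof (rule comm_unique)
  have "x \<otimes> (y \<otimes> y') = comm x y \<otimes> (y \<otimes> (x \<otimes> y'))"
    using comm_eq[OF assms(1,2)] assms by (simp flip: m_assoc)
  also have "\<dots> = comm x y \<otimes> (y \<otimes> (comm x y' \<otimes> (y' \<otimes> x)))" using comm_eq[OF assms(1,3)] by simp
  also have "y \<otimes> (comm x y' \<otimes> (y' \<otimes> x)) = comm x y' \<otimes> (y \<otimes> (y' \<otimes> x))"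
    using central[OF comm_mem[OF assms(1,3)] assms(2)] assms by (simp flip: m_assoc)
  finally show "x \<otimes> (y \<otimes> y') = comm x y \<otimes> comm x y' \<otimes> (y \<otimes> y' \<otimes> x)" using assms by (simp add: m_assoc)
qed (use assms in auto)

end

text \<open>The first map is an epimorphism with kernel \<open>Z\<close> rather than an isomorphism
  from the quotient, which keeps cosets out of the counting.\<close>

definition frames where
  "frames p d s G Z = {(\<beta>, \<alpha>). \<beta> \<in> ehom G (vg p d) \<and> \<beta> ` carrier G = carrier (vg p d) \<and>
     (\<forall>x\<in>carrier G. \<beta> x = \<one>\<^bsub>vg p d\<^esub> \<longleftrightarrow> x \<in> Z) \<and>
     \<alpha> \<in> ehom (G\<lparr>carrier := Z\<rparr>) (vg p s) \<and> bij_betw \<alpha> Z (carrier (vg p s))}"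

text \<open>One fixed choice of preimage, depending on \<open>G\<close>, \<open>\<beta>\<close> and
  \<open>v\<close> alone. Prescribing the lifts of some basis vectors is later used to cut down the
  framings.\<close>

definition lift where
  "lift G \<beta> v = (SOME x. x \<in> carrier G \<and> \<beta> x = v)"

definition form where
  "form G \<beta> \<alpha> u v = \<alpha> (group.comm G (lift G \<beta> u) (lift G \<beta> v))"

locale framed = central_ext +
  fixes \<beta> \<alpha>
  assumes frame: "(\<beta>, \<alpha>) \<in> frames p d s G Z"
begin

lemma beta: "\<beta> \<in> hom G (vg p d)" "\<beta> \<in> ehom G (vg p d)" "\<beta> ` carrier G = carrier (vg p d)"
  using frame by (auto simp: frames_def ehom_def)

lemma beta_one: "x \<in> carrier G \<Longrightarrow> \<beta> x = \<one>\<^bsub>vg p d\<^esub> \<longleftrightarrow> x \<in> Z"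
  using frame by (auto simp: frames_def)

lemma alpha: "\<alpha> \<in> hom (G\<lparr>carrier := Z\<rparr>) (vg p s)" "\<alpha> \<in> ehom (G\<lparr>carrier := Z\<rparr>) (vg p s)" "bij_betw \<alpha> Z (carrier (vg p s))"
  using frame by (auto simp: frames_def ehom_def)

lemma alpha_mult: "z \<in> Z \<Longrightarrow> z' \<in> Z \<Longrightarrow> \<alpha> (z \<otimes> z') = \<alpha> z \<otimes>\<^bsub>vg p s\<^esub> \<alpha> z'"
  using alpha(1) by (auto simp: hom_def)

lemma alpha_closed: "z \<in> Z \<Longrightarrow> \<alpha> z \<in> carrier (vg p s)"
  using alpha(1) by (auto simp: hom_def)

lemma elab_V: "elab (vg p d) p" and elab_W: "elab (vg p s) p"
  by (rule elab_vg[OF prime_p])+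

lemma beta_group_hom: "group_hom G (vg p d) \<beta>"
proof -
  interpret V: elab "vg p d" p by (rule elab_V)
  show ?thesis using beta(1) by unfold_locales
qed

lemma lift: "v \<in> carrier (vg p d) \<Longrightarrow> lift G \<beta> v \<in> carrier G" "v \<in> carrier (vg p d) \<Longrightarrow> \<beta> (lift G \<beta> v) = v"
proof -
  assume "v \<in> carrier (vg p d)"
  then have "\<exists>x. x \<in> carrier G \<and> \<beta> x = v" using beta(3) by (metis imageE)
  from someI_ex[OF this] show "lift G \<beta> v \<in> carrier G" "\<beta> (lift G \<beta> v) = v" unfolding lift_def by auto
qed

lemma beta_eq: 
  assumes "x \<in> carrier G" "y \<in> carrier G" "\<beta> x = \<beta> y"
  obtains z where "z \<in> Z" "x = z \<otimes> y"
proof -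
  interpret V: elab "vg p d" p by (rule elab_V)
  interpret b: group_hom G "vg p d" \<beta> by (rule beta_group_hom)
  have "\<beta> (x \<otimes> inv y) = \<one>\<^bsub>vg p d\<^esub>" using assms by simp
  then have "x \<otimes> inv y \<in> Z" using beta_one assms(1,2) inv_closed m_closed by blast
  moreover have "x = (x \<otimes> inv y) \<otimes> y" using assms by (simp add: m_assoc)
  ultimately show ?thesis using that by blast
qed

lemma beta_closed: "x \<in> carrier G \<Longrightarrow> \<beta> x \<in> carrier (vg p d)"
  using beta(1) by (auto simp: hom_def)

lemma form_eq:
  assumes x: "x \<in> carrier G" and y: "y \<in> carrier G"
  shows "form G \<beta> \<alpha> (\<beta> x) (\<beta> y) = \<alpha> (comm x y)"
proof -
  obtain z where z: "z \<in> Z" "lift G \<beta> (\<beta> x) = z \<otimes> x"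
    using beta_eq[OF lift(1) x lift(2)] beta_closed[OF x] by blast
  obtain z' where z': "z' \<in> Z" "lift G \<beta> (\<beta> y) = z' \<otimes> y"
    using beta_eq[OF lift(1) y lift(2)] beta_closed[OF y] by blast
  show ?thesis using comm_shift[OF x y z(1) z'(1)] z z' by (simp add: form_def)
qed

lemma form_closed:
  "u \<in> carrier (vg p d) \<Longrightarrow> v \<in> carrier (vg p d) \<Longrightarrow> form G \<beta> \<alpha> u v \<in> carrier (vg p s)"
  unfolding form_def by (intro alpha_closed comm_mem lift)

lemma form_hom:
  assumes u: "u \<in> carrier (vg p d)"
  shows "restrict (form G \<beta> \<alpha> u) (carrier (vg p d)) \<in> ehom (vg p d) (vg p s)"
proof -
  interpret V: elab "vg p d" p by (rule elab_V)
  interpret b: group_hom G "vg p d" \<beta> by (rule beta_group_hom)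
  have "form G \<beta> \<alpha> u (v \<otimes>\<^bsub>vg p d\<^esub> w) = form G \<beta> \<alpha> u v \<otimes>\<^bsub>vg p s\<^esub> form G \<beta> \<alpha> u w"
    if v: "v \<in> carrier (vg p d)" and w: "w \<in> carrier (vg p d)" for v w
  proof -
    note l = lift(1)[OF u] lift(1)[OF v] lift(1)[OF w]
    have "form G \<beta> \<alpha> u (v \<otimes>\<^bsub>vg p d\<^esub> w) = form G \<beta> \<alpha> (\<beta> (lift G \<beta> u)) (\<beta> (lift G \<beta> v \<otimes> lift G \<beta> w))"
      using l lift u v w by simp
    also have "\<dots> = \<alpha> (comm (lift G \<beta> u) (lift G \<beta> v \<otimes> lift G \<beta> w))" using l by (intro form_eq) auto
    also have "\<dots> = form G \<beta> \<alpha> u v \<otimes>\<^bsub>vg p s\<^esub> form G \<beta> \<alpha> u w"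
      using l comm_mem by (simp add: comm_mult_right alpha_mult form_def)
    finally show ?thesis .
  qed
  then show ?thesis using form_closed[OF u] by (auto simp: ehom_def hom_def)
qed

end

lemma finite_ehom: "finite (carrier A) \<Longrightarrow> finite (carrier B) \<Longrightarrow> finite (ehom A B)"
proof -
  assume "finite (carrier A)" "finite (carrier B)"
  then have "finite (carrier A \<rightarrow>\<^sub>E carrier B)" by (simp add: finite_PiE)
  moreover have "ehom A B \<subseteq> carrier A \<rightarrow>\<^sub>E carrier B" by (auto simp: ehom_def hom_def PiE_def)
  ultimately show ?thesis by (rule rev_finite_subset)
qed

context central_ext
begin

lemma finite_frames: "finite (frames p d s G Z)"
proof -
  interpret V: elab "vg p d" p by (rule elab_vg[OF prime_p])
  interpret W: elab "vg p s" p by (rule elab_vg[OF prime_p])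
  interpret ZG: elab "G\<lparr>carrier := Z\<rparr>" p by (rule elab_Z)
  have "frames p d s G Z \<subseteq> ehom G (vg p d) \<times> ehom (G\<lparr>carrier := Z\<rparr>) (vg p s)"
    by (auto simp: frames_def)
  then show ?thesis using finite_ehom finG V.fin W.fin ZG.fin by (meson finite_SigmaI finite_subset)
qed

lemma frame_exists: "\<exists>\<beta> \<alpha>. (\<beta>, \<alpha>) \<in> frames p d s G Z"
proof -
  interpret Z: normal Z G by (rule normalZ)
  interpret Q: elab "G Mod Z" p by (rule elab_quotient)
  interpret ZG: elab "G\<lparr>carrier := Z\<rparr>" p by (rule elab_Z)
  obtain f where f: "f \<in> iso (G Mod Z) (vg p d)" using Q.iso_vg[OF order_quotient] by blast
  obtain h where h: "h \<in> iso (G\<lparr>carrier := Z\<rparr>) (vg p s)"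
    using ZG.iso_vg[of s] cardZ by (auto simp: order_def)
  interpret V: elab "vg p d" p by (rule elab_vg[OF prime_p])
  interpret f: group_hom "G Mod Z" "vg p d" f using f by unfold_locales (simp add: iso_def)
  define \<beta> where "\<beta> = restrict (\<lambda>x. f (Z #> x)) (carrier G)"
  define \<alpha> where "\<alpha> = restrict h Z"
  have Qc: "Z #> x \<in> carrier (G Mod Z)" if "x \<in> carrier G" for x using that by (auto simp: carrier_FactGroup)
  have bij: "bij_betw f (carrier (G Mod Z)) (carrier (vg p d))" using f by (simp add: iso_def)
  have "f (Z #> (x \<otimes> y)) = f (Z #> x) \<otimes>\<^bsub>vg p d\<^esub> f (Z #> y)" if "x \<in> carrier G" "y \<in> carrier G" for x y
    using f.hom_mult[OF Qc[OF that(1)] Qc[OF that(2)]] Z.rcos_sum[OF that] by simp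
  then have "\<beta> \<in> ehom G (vg p d)" using Qc by (auto simp: ehom_def hom_def \<beta>_def)
  moreover have "\<beta> ` carrier G = carrier (vg p d)"
    using bij unfolding bij_betw_def \<beta>_def carrier_FactGroup by (simp add: image_image)
  moreover have "\<beta> x = \<one>\<^bsub>vg p d\<^esub> \<longleftrightarrow> x \<in> Z" if x: "x \<in> carrier G" for x
  proof -
    have "\<beta> x = \<one>\<^bsub>vg p d\<^esub> \<longleftrightarrow> f (Z #> x) = f \<one>\<^bsub>G Mod Z\<^esub>" using x f.hom_one by (simp add: \<beta>_def)
    also have "\<dots> \<longleftrightarrow> Z #> x = \<one>\<^bsub>G Mod Z\<^esub>"
      by (rule inj_on_eq_iff[OF bij_betw_imp_inj_on[OF bij] Qc[OF x] Q.one_closed])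
    also have "\<dots> \<longleftrightarrow> x \<in> Z" using coset_join1[OF _ x subZ] coset_join2[OF x subZ] Z.subset by auto
    finally show ?thesis .
  qed
  moreover have "\<alpha> \<in> ehom (G\<lparr>carrier := Z\<rparr>) (vg p s)"
    using h subgroup.m_closed[OF subZ] by (auto simp: \<alpha>_def ehom_def iso_def hom_def)
  moreover have "bij_betw h Z (carrier (vg p s))" using h by (simp add: iso_def)
  then have "bij_betw \<alpha> Z (carrier (vg p s))" by (simp add: \<alpha>_def bij_betw_def inj_on_def)
  ultimately show ?thesis unfolding frames_def by blast
qed

text \<open>Composing one framing with automorphisms of both targets gives framings again, and
  different pairs give different ones because \<open>\<beta>\<close> and \<open>\<alpha>\<close> are
  onto.\<close>

lemma card_frames: "card (autos p d) * card (autos p s) \<le> card (frames p d s G Z)"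
proof -
  obtain \<beta> \<alpha> where fr: "(\<beta>, \<alpha>) \<in> frames p d s G Z" using frame_exists by blast
  interpret framed G p d s Z \<beta> \<alpha> using fr by unfold_locales
  interpret V: elab "vg p d" p by (rule elab_V)
  let ?F = "\<lambda>(g, h). (compose (carrier G) g \<beta>, compose Z h \<alpha>)"
  have "?F ` (autos p d \<times> autos p s) \<subseteq> frames p d s G Z"
  proof clarify
    fix g h assume g: "g \<in> autos p d" and h: "h \<in> autos p s"
    have gh: "g \<in> hom (vg p d) (vg p d)" "h \<in> hom (vg p s) (vg p s)" using g h by (auto simp: autos_def ehom_def)
    interpret g: group_hom "vg p d" "vg p d" g using gh by unfold_locales
    have bg: "bij_betw g (carrier (vg p d)) (carrier (vg p d))" and bh: "bij_betw h (carrier (vg p s)) (carrier (vg p s))"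
      using g h by (auto simp: autos_def)
    have "compose (carrier G) g \<beta> \<in> ehom G (vg p d)"
      using hom_compose[OF beta(1) gh(1)] by (simp add: ehom_def)
    moreover have "compose (carrier G) g \<beta> ` carrier G = carrier (vg p d)"
      using bg beta(3) by (auto simp: bij_betw_def compose_def image_image[symmetric])
    moreover have "compose (carrier G) g \<beta> x = \<one>\<^bsub>vg p d\<^esub> \<longleftrightarrow> x \<in> Z" if x: "x \<in> carrier G" for x
    proof -
      have "compose (carrier G) g \<beta> x = \<one>\<^bsub>vg p d\<^esub> \<longleftrightarrow> g (\<beta> x) = g \<one>\<^bsub>vg p d\<^esub>"
        using x by (simp add: compose_def)
      also have "\<dots> \<longleftrightarrow> \<beta> x = \<one>\<^bsub>vg p d\<^esub>"
        by (rule inj_on_eq_iff[OF bij_betw_imp_inj_on[OF bg] beta_closed[OF x] V.one_closed])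
      finally show ?thesis using beta_one[OF x] by simp
    qed
    moreover have "compose Z h \<alpha> \<in> ehom (G\<lparr>carrier := Z\<rparr>) (vg p s)"
      using group.hom_compose[OF subgroup_imp_group[OF subZ] alpha(1) gh(2)] by (simp add: ehom_def)
    moreover have "bij_betw (compose Z h \<alpha>) Z (carrier (vg p s))"
      using bij_betw_trans[OF alpha(3) bh] by (rule bij_betw_cong[THEN iffD1, rotated]) (simp add: compose_def)
    ultimately show "(compose (carrier G) g \<beta>, compose Z h \<alpha>) \<in> frames p d s G Z"
      unfolding frames_def by blast
  qed
  moreover have "inj_on ?F (autos p d \<times> autos p s)"
  proof (rule inj_onI, clarify)
    fix g h g' h' assume a: "g \<in> autos p d" "h \<in> autos p s" "g' \<in> autos p d" "h' \<in> autos p s"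
      and eq: "compose (carrier G) g \<beta> = compose (carrier G) g' \<beta>" "compose Z h \<alpha> = compose Z h' \<alpha>"
    have "g = g'"
    proof (rule ehom_eqI[of _ "vg p d" "vg p d"])
      fix v assume v: "v \<in> carrier (vg p d)"
      show "g v = g' v" using fun_cong[OF eq(1), of "lift G \<beta> v"] lift[OF v] by (simp add: compose_def)
    qed (use a in \<open>auto simp: autos_def\<close>)
    moreover have "h = h'"
    proof (rule ehom_eqI[of _ "vg p s" "vg p s"])
      fix w assume "w \<in> carrier (vg p s)"
      then obtain z where "z \<in> Z" "w = \<alpha> z" using alpha(3) by (auto simp: bij_betw_def)
      then show "h w = h' w" using fun_cong[OF eq(2), of z] by (simp add: compose_def)
    qed (use a in \<open>auto simp: autos_def\<close>)
    ultimately show "g = g' \<and> h = h'" by simp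
  qed
  ultimately have "card (autos p d \<times> autos p s) \<le> card (frames p d s G Z)"
    by (meson card_inj_on_le finite_frames)
  then show ?thesis by (simp add: card_cartesian_product)
qed

end

section \<open>Commutators and powers of a basis determine the group\<close>

context framed
begin

text \<open>The image of \<open>T\<close> under \<open>\<beta>\<close> contains all unit vectors, so
  it is everything, and \<open>T\<close> contains the kernel.\<close>

lemma covers:
  assumes T: "subgroup T G" and Z: "Z \<subseteq> T" and x: "\<And>i. i < d \<Longrightarrow> lift G \<beta> (unitv d i) \<in> T"
  shows "T = carrier G"
proof
  interpret V: elab "vg p d" p by (rule elab_V)
  interpret b: group_hom G "vg p d" \<beta> by (rule beta_group_hom)
  show "T \<subseteq> carrier G" by (rule subgroup.subset[OF T])
  have img: "subgroup (\<beta> ` T) (vg p d)" by (rule b.subgroup_img_is_subgroup[OF T])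
  have "unitv d i \<in> \<beta> ` T" if "i < d" for i
    using x[OF that] lift(2)[OF unitv_closed[OF p_gt_1], of i] by (metis image_eqI)
  then have bT: "\<beta> ` T = carrier (vg p d)" by (rule vg_generated[OF prime_p img])
  show "carrier G \<subseteq> T"
  proof
    fix g assume g: "g \<in> carrier G"
    then have "\<beta> g \<in> \<beta> ` T" using bT beta_closed by simp
    then obtain t where t: "t \<in> T" "\<beta> g = \<beta> t" by blast
    obtain z where "z \<in> Z" "g = z \<otimes> t" using beta_eq[OF g _ t(2)] t(1) T by (metis subgroup.mem_carrier)
    then show "g \<in> T" using t(1) Z subgroup.m_closed[OF T] by blast
  qed
qed

lemma alpha_inv: "z \<in> Z \<Longrightarrow> \<alpha> (inv z) = inv\<^bsub>vg p s\<^esub> \<alpha> z"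
proof -
  assume z: "z \<in> Z"
  interpret W: elab "vg p s" p by (rule elab_W)
  interpret ZG: group "G\<lparr>carrier := Z\<rparr>" by (rule subgroup_imp_group[OF subZ])
  interpret a: group_hom "G\<lparr>carrier := Z\<rparr>" "vg p s" \<alpha> using alpha(1) by unfold_locales
  show ?thesis using a.hom_inv[of z] z m_inv_consistent[OF subZ z] by simp
qed

lemma form_swap:
  assumes u: "u \<in> carrier (vg p d)" and v: "v \<in> carrier (vg p d)"
  shows "form G \<beta> \<alpha> v u = inv\<^bsub>vg p s\<^esub> form G \<beta> \<alpha> u v"
proof -
  note l = lift(1)[OF u] lift(1)[OF v]
  have "comm (lift G \<beta> v) (lift G \<beta> u) = inv (comm (lift G \<beta> u) (lift G \<beta> v))"
    using l by (simp add: comm_def inv_mult_group m_assoc)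
  then show ?thesis using comm_mem[OF l] by (simp add: form_def alpha_inv)
qed

end

lemma DirProd_nat_pow:
  "(x, y) [^]\<^bsub>G \<times>\<times> H\<^esub> (n::nat) = (x [^]\<^bsub>G\<^esub> n, y [^]\<^bsub>H\<^esub> n)"
  by (induction n) auto

text \<open>
  The subgroup of \<open>G \<times> H\<close> generated by the pairs of corresponding elements has at most
  \<open>|G| = |H|\<close> elements and projects onto both factors, so it is the graph of an isomorphism.
\<close>

lemma frames_determine:
  assumes "framed G p d s Z \<beta> \<alpha>" "framed H p d s Y \<gamma> \<delta>"
    and comms: "\<And>i j. i < j \<Longrightarrow> j < d \<Longrightarrow> form G \<beta> \<alpha> (unitv d i) (unitv d j) = form H \<gamma> \<delta> (unitv d i) (unitv d j)"
    and pows: "\<And>i. i < d \<Longrightarrow> \<alpha> (lift G \<beta> (unitv d i) [^]\<^bsub>G\<^esub> p) = \<delta> (lift H \<gamma> (unitv d i) [^]\<^bsub>H\<^esub> p)"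
  shows "G \<cong> H"
proof -
  interpret G: framed G p d s Z \<beta> \<alpha> by fact
  interpret H: framed H p d s Y \<gamma> \<delta> by fact
  interpret V: elab "vg p d" p by (rule G.elab_V)
  interpret W: elab "vg p s" p by (rule G.elab_W)
  interpret b: group_hom G "vg p d" \<beta> by (rule G.beta_group_hom)
  interpret c: group_hom H "vg p d" \<gamma> by (rule H.beta_group_hom)
  let ?P = "G \<times>\<times> H"
  interpret P: group ?P by (rule DirProd_group[OF G.is_group H.is_group])
  have finP: "finite (carrier ?P)" using G.finG H.finG by simp
  define x where "x = (\<lambda>i. lift G \<beta> (unitv d i))"
  define y where "y = (\<lambda>i. lift H \<gamma> (unitv d i))"
  have e: "unitv d i \<in> carrier (vg p d)" for i by (rule unitv_closed[OF G.p_gt_1])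
  have xc: "x i \<in> carrier G" "\<beta> (x i) = unitv d i" for i unfolding x_def by (rule G.lift[OF e])+
  have yc: "y i \<in> carrier H" "\<gamma> (y i) = unitv d i" for i unfolding y_def by (rule H.lift[OF e])+
  \<comment> \<open>The graph of the isomorphism between \<open>Z\<close> and \<open>Y\<close> that
    the framings induce; the pairs of generators are adjoined to it one by one.\<close>
  define K where "K = {(z, w). z \<in> Z \<and> w \<in> Y \<and> \<alpha> z = \<delta> w}"
  have Kc: "K \<subseteq> carrier ?P" unfolding K_def using G.Zc H.Zc by auto
  have K1: "(\<one>\<^bsub>G\<^esub>, \<one>\<^bsub>H\<^esub>) \<in> K"
  proof -
    have "\<alpha> \<one>\<^bsub>G\<^esub> = \<one>\<^bsub>vg p s\<^esub>" "\<delta> \<one>\<^bsub>H\<^esub> = \<one>\<^bsub>vg p s\<^esub>"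
      using hom_one[OF G.alpha(1) G.subgroup_imp_group[OF G.subZ] W.is_group]
        hom_one[OF H.alpha(1) H.subgroup_imp_group[OF H.subZ] W.is_group] by auto
    then show ?thesis unfolding K_def using G.subZ H.subZ by (simp add: subgroup.one_closed)
  qed
  have Ks: "subgroup K ?P"
  proof (rule P.finite_closed_subgroup[OF finP Kc])
    show "K \<noteq> {}" using K1 by blast
    fix a b assume "a \<in> K" "b \<in> K"
    then show "a \<otimes>\<^bsub>?P\<^esub> b \<in> K" unfolding K_def
      by (auto simp: G.alpha_mult H.alpha_mult subgroup.m_closed[OF G.subZ] subgroup.m_closed[OF H.subZ])
  qed
  have cK: "card K \<le> p ^ s"
  proof -
    have "inj_on fst K" using H.alpha(3) unfolding K_def by (auto simp: inj_on_def bij_betw_def)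
    moreover have "fst ` K \<subseteq> Z" unfolding K_def by auto
    moreover have "finite Z" using G.finG G.Zc by (meson finite_subset subsetI)
    ultimately show ?thesis using G.cardZ by (metis card_inj_on_le)
  qed
  define S where "S = rec_nat K (\<lambda>k T. P.adjoin T (x k, y k))"
  have S0: "S 0 = K" and SS: "S (Suc k) = P.adjoin (S k) (x k, y k)" for k by (auto simp: S_def)
  \<comment> \<open>The last clause, minimality of \<open>S k\<close>, is what lets an equation
    between homomorphisms be checked on the generators of \<open>S k\<close> alone.\<close>
  have S: "subgroup (S k) ?P \<and> card (S k) \<le> p ^ (k + s) \<and> K \<subseteq> S k \<and> (\<forall>i<k. (x i, y i) \<in> S k)
    \<and> (\<forall>N. subgroup N ?P \<longrightarrow> K \<subseteq> N \<longrightarrow> (\<forall>i<k. (x i, y i) \<in> N) \<longrightarrow> S k \<subseteq> N)"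
    if "k \<le> d" for k
    using that
  proof (induction k)
    case 0 then show ?case using Ks cK S0 by simp
  next
    case (Suc k)
    then have sk: "subgroup (S k) ?P" and ck: "card (S k) \<le> p ^ (k + s)" and Kk: "K \<subseteq> S k"
      and uk: "\<forall>i<k. (x i, y i) \<in> S k"
      and mink: "\<And>N. subgroup N ?P \<Longrightarrow> K \<subseteq> N \<Longrightarrow> \<forall>i<k. (x i, y i) \<in> N \<Longrightarrow> S k \<subseteq> N" by auto
    have kd: "k < d" using Suc.prems by simp
    have uc: "(x k, y k) \<in> carrier ?P" using xc yc by simp
    \<comment> \<open>\<open>?N\<close> below consists of the pairs whose commutators with
      \<open>x k\<close> and \<open>y k\<close> correspond to each other. Once \<open>S k\<close>
      lies in it, conjugation by \<open>(x k, y k)\<close> changes elements of \<open>S k\<close>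
      only by elements of \<open>K\<close>, so that \<open>S k\<close> is normalised.\<close>
    let ?A = "restrict (form G \<beta> \<alpha> (unitv d k)) (carrier (vg p d))"
    let ?B = "restrict (form H \<gamma> \<delta> (unitv d k)) (carrier (vg p d))"
    have AB: "?A \<in> hom (vg p d) (vg p s)" "?B \<in> hom (vg p d) (vg p s)"
      using G.form_hom[OF e] H.form_hom[OF e] by (auto simp: ehom_def)
    let ?N = "{h \<in> carrier ?P. (?A \<circ> \<beta> \<circ> fst) h = (?B \<circ> \<gamma> \<circ> snd) h}"
    have f: "fst \<in> hom ?P G" "snd \<in> hom ?P H" by (auto simp: hom_def)
    have N: "subgroup ?N ?P"
      by (rule equalizer_subgroup[OF P.is_group W.is_group
            Group.hom_compose[OF f(1) Group.hom_compose[OF G.beta(1) AB(1)]]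
            Group.hom_compose[OF f(2) Group.hom_compose[OF H.beta(1) AB(2)]]])
    have "K \<subseteq> ?N"
    proof
      fix h assume h: "h \<in> K"
      have "?A \<one>\<^bsub>vg p d\<^esub> = \<one>\<^bsub>vg p s\<^esub>" "?B \<one>\<^bsub>vg p d\<^esub> = \<one>\<^bsub>vg p s\<^esub>"
        by (rule hom_one[OF AB(1) V.is_group W.is_group], rule hom_one[OF AB(2) V.is_group W.is_group])
      moreover have "\<beta> (fst h) = \<one>\<^bsub>vg p d\<^esub>" "\<gamma> (snd h) = \<one>\<^bsub>vg p d\<^esub>"
        using h G.beta_one G.Zc H.beta_one H.Zc unfolding K_def by auto
      ultimately show "h \<in> ?N" using h Kc by auto
    qed
    moreover have "\<forall>i<k. (x i, y i) \<in> ?N"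
    proof (intro allI impI)
      fix i assume i: "i < k"
      have "form G \<beta> \<alpha> (unitv d k) (unitv d i) = form H \<gamma> \<delta> (unitv d k) (unitv d i)"
        unfolding G.form_swap[OF e[of i] e[of k]] H.form_swap[OF e[of i] e[of k]] using comms[OF i kd] by simp
      then show "(x i, y i) \<in> ?N" using xc yc e by simp
    qed
    ultimately have SN: "S k \<subseteq> ?N" by (intro mink N)
    have norm: "(x k, y k) \<otimes>\<^bsub>?P\<^esub> h \<otimes>\<^bsub>?P\<^esub> inv\<^bsub>?P\<^esub> (x k, y k) \<in> S k" if h: "h \<in> S k" for h
    proof -
      obtain a b where ab: "h = (a, b)" by (cases h)
      have hN: "h \<in> ?N" using SN h by blast
      then have c: "a \<in> carrier G" "b \<in> carrier H" using ab by auto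
      have "form G \<beta> \<alpha> (\<beta> (x k)) (\<beta> a) = form H \<gamma> \<delta> (\<gamma> (y k)) (\<gamma> b)"
        using hN ab c xc yc G.beta_closed H.beta_closed by simp
      then have "\<alpha> (G.comm (x k) a) = \<delta> (H.comm (y k) b)"
        using G.form_eq[OF xc(1) c(1)] H.form_eq[OF yc(1) c(2)] by simp
      then have "(G.comm (x k) a, H.comm (y k) b) \<in> S k"
        using Kk G.comm_mem[OF xc(1) c(1)] H.comm_mem[OF yc(1) c(2)] unfolding K_def by blast
      then have "(G.comm (x k) a, H.comm (y k) b) \<otimes>\<^bsub>?P\<^esub> h \<in> S k" using h subgroup.m_closed[OF sk] by blast
      moreover have "G.comm (x k) a \<otimes>\<^bsub>G\<^esub> a = x k \<otimes>\<^bsub>G\<^esub> a \<otimes>\<^bsub>G\<^esub> inv\<^bsub>G\<^esub> x k"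
        using c xc(1)[of k] by (simp add: G.comm_def G.m_assoc)
      moreover have "H.comm (y k) b \<otimes>\<^bsub>H\<^esub> b = y k \<otimes>\<^bsub>H\<^esub> b \<otimes>\<^bsub>H\<^esub> inv\<^bsub>H\<^esub> y k"
        using c yc(1)[of k] by (simp add: H.comm_def H.m_assoc)
      ultimately show ?thesis using ab xc(1) yc(1) by (simp add: inv_DirProd[OF G.is_group H.is_group])
    qed
    have pw: "(x k, y k) [^]\<^bsub>?P\<^esub> p \<in> S k"
    proof -
      have "(x k [^]\<^bsub>G\<^esub> p, y k [^]\<^bsub>H\<^esub> p) \<in> K"
        unfolding K_def using pows[OF kd] G.pow_mem[OF xc(1)] H.pow_mem[OF yc(1)] by (simp add: x_def y_def)
      then show ?thesis using Kk by (auto simp: DirProd_nat_pow)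
    qed
    have "subgroup (S (Suc k)) ?P" unfolding SS by (rule P.adjoin_subgroup[OF finP sk uc norm])
    moreover have "card (S (Suc k)) \<le> p * card (S k)"
      unfolding SS using P.card_adjoin_le[OF finP sk uc pw] G.p_gt_1 by simp
    then have "card (S (Suc k)) \<le> p ^ (Suc k + s)"
      using ck by (simp) (meson le_trans mult_le_mono2)
    moreover have inc: "S k \<subseteq> S (Suc k)" unfolding SS by (rule P.adjoin_incl[OF sk uc])
    then have "K \<subseteq> S (Suc k)" using Kk by blast
    moreover have "\<forall>i<Suc k. (x i, y i) \<in> S (Suc k)"
      using uk inc P.adjoin_self[OF sk uc] unfolding SS by (auto simp: less_Suc_eq)
    moreover have "S (Suc k) \<subseteq> N" if "subgroup N ?P" "K \<subseteq> N" "\<forall>i<Suc k. (x i, y i) \<in> N" for N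
      unfolding SS using mink[of N] that by (intro P.adjoin_minimal) auto
    ultimately show ?case by blast
  qed
  define T where "T = S d"
  have T: "subgroup T ?P" "card T \<le> p ^ (d + s)" "K \<subseteq> T" "\<And>i. i < d \<Longrightarrow> (x i, y i) \<in> T"
    unfolding T_def using S[of d] by auto
  have finT: "finite T" using finP subgroup.subset[OF T(1)] finite_subset by blast
  have TP: "T \<subseteq> carrier G \<times> carrier H" using subgroup.subset[OF T(1)] by simp
  interpret fh: group_hom ?P G fst by unfold_locales (auto simp: hom_def)
  interpret sh: group_hom ?P H snd by unfold_locales (auto simp: hom_def)
  have fT: "fst ` T = carrier G"
  proof (rule G.covers)
    show "subgroup (fst ` T) G" by (rule fh.subgroup_img_is_subgroup[OF T(1)])
    show "Z \<subseteq> fst ` T"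
    proof
      fix z assume z: "z \<in> Z"
      then have "\<alpha> z \<in> \<delta> ` Y" using H.alpha(3) G.alpha_closed[OF z] by (simp add: bij_betw_def)
      then obtain w where "w \<in> Y" "\<alpha> z = \<delta> w" by blast
      then have "(z, w) \<in> T" using z T(3) unfolding K_def by blast
      then show "z \<in> fst ` T" by force
    qed
    show "lift G \<beta> (unitv d i) \<in> fst ` T" if "i < d" for i using T(4)[OF that] unfolding x_def by force
  qed
  have sT: "snd ` T = carrier H"
  proof (rule H.covers)
    show "subgroup (snd ` T) H" by (rule sh.subgroup_img_is_subgroup[OF T(1)])
    show "Y \<subseteq> snd ` T"
    proof
      fix w assume w: "w \<in> Y"
      then have "\<delta> w \<in> \<alpha> ` Z" using G.alpha(3) H.alpha_closed[OF w] by (simp add: bij_betw_def)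
      then obtain z where "z \<in> Z" "\<delta> w = \<alpha> z" by blast
      then have "(z, w) \<in> T" using w T(3) unfolding K_def by auto
      then show "w \<in> snd ` T" by force
    qed
    show "lift H \<gamma> (unitv d i) \<in> snd ` T" if "i < d" for i using T(4)[OF that] unfolding y_def by force
  qed
  \<comment> \<open>A set of at most \<open>p ^ (d + s)\<close> elements that maps onto a group of
    this order does so bijectively.\<close>
  have "card T = card (carrier G)" "card T = card (carrier H)"
    using card_image_le[OF finT, of fst] card_image_le[OF finT, of snd] fT sT T(2) G.ordG H.ordG
    by (auto simp: order_def)
  then have inj: "inj_on fst T" "inj_on snd T"
    using fT sT finT by (auto intro: eq_card_imp_inj_on)
  let ?T = "?P\<lparr>carrier := T\<rparr>"
  interpret TG: group ?T by (rule P.subgroup_imp_group[OF T(1)])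
  have "fst \<in> iso ?T G" "snd \<in> iso ?T H"
    using inj fT sT TP by (auto simp: iso_def hom_def bij_betw_def)
  then have "?T \<cong> G" "?T \<cong> H" by (auto intro: is_isoI)
  then show ?thesis using TG.iso_sym iso_trans by blast
qed

section \<open>The average size of stabilisers\<close>

text \<open>The first \<open>m\<close> rows of the form are kept as whole linear maps, since
  intertwining is a condition on maps; of the other rows only the entries above the diagonal are
  kept. The redundancy, \<open>s * m * (m + 1) / 2\<close> in the exponent, is linear in
  \<open>l\<close>.\<close>

definition frame_data where
  "frame_data m p d G \<beta> \<alpha> =
    ((\<lambda>i\<in>{..<m}. restrict (form G \<beta> \<alpha> (unitv d i)) (carrier (vg p d))),
     restrict (\<lambda>(i, j). form G \<beta> \<alpha> (unitv d i) (unitv d j)) {(i, j). m \<le> i \<and> i < j \<and> j < d},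
     (\<lambda>i\<in>{..<d}. \<alpha> (lift G \<beta> (unitv d i) [^]\<^bsub>G\<^esub> p)))"

definition kron_autos where
  "kron_autos m p d s A = {(g, h) \<in> autos p d \<times> autos p s. \<forall>i<m. A i \<in> intertwiners (vg p d) (vg p s) g h}"

lemma card_le_fibres:
  assumes "finite C" "q ` F \<subseteq> C" "card C \<le> N"
    and "\<And>c. c \<in> C \<Longrightarrow> finite {t \<in> F. q t = c} \<and> card {t \<in> F. q t = c} \<le> M"
  shows "finite F \<and> card F \<le> N * M"
proof -
  have eq: "F = (\<Union>c\<in>C. {t \<in> F. q t = c})" using assms(2) by blast
  have fin: "finite F" by (subst eq) (use assms(1,4) in blast)
  have "card F \<le> (\<Sum>c\<in>C. card {t \<in> F. q t = c})" by (subst eq) (rule card_UN_le[OF assms(1)])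
  also have "\<dots> \<le> card C * M" using assms(4) by (intro sum_bounded_above[THEN order_trans]) auto
  also have "\<dots> \<le> N * M" using assms(3) by (rule mult_le_mono1)
  finally show ?thesis using fin by simp
qed

context central_ext
begin

text \<open>
  Two framings with the same data differ by a pair \<open>(g, h)\<close> that preserves the commutator form. As the
  lifts of the first \<open>m\<close> basis vectors agree, \<open>g\<close> fixes these vectors, so \<open>(g, h)\<close> intertwines the
  partial maps of the form.
\<close>

lemma card_frames_same_lifts:
  assumes m: "m \<le> d" and fr1: "(\<beta>1, \<alpha>1) \<in> frames p d s G Z" and D1: "frame_data m p d G \<beta>1 \<alpha>1 = D"
  defines "C \<equiv> {t \<in> frames p d s G Z. (case t of (\<beta>, \<alpha>) \<Rightarrow> frame_data m p d G \<beta> \<alpha> = D \<and>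
      (\<forall>i<m. lift G \<beta> (unitv d i) = lift G \<beta>1 (unitv d i)))}"
  shows "card C \<le> card (kron_autos m p d s (fst D))"
proof -
  interpret f1: framed G p d s Z \<beta>1 \<alpha>1 using fr1 by unfold_locales
  interpret V: elab "vg p d" p by (rule f1.elab_V)
  interpret W: elab "vg p s" p by (rule f1.elab_W)
  let ?V = "carrier (vg p d)" and ?W = "carrier (vg p s)"
  let ?F = "\<lambda>(\<beta>, \<alpha>). (\<lambda>v\<in>?V. \<beta> (lift G \<beta>1 v), \<lambda>w\<in>?W. \<alpha> (inv_into Z \<alpha>1 w))"
  have inv1: "inv_into Z \<alpha>1 w \<in> Z" "\<alpha>1 (inv_into Z \<alpha>1 w) = w" if "w \<in> ?W" for w
    using f1.alpha(3) that by (auto simp: bij_betw_def inv_into_into f_inv_into_f)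
  have inv2: "inv_into Z \<alpha>1 (\<alpha>1 z) = z" if "z \<in> Z" for z
    using f1.alpha(3) that by (auto simp: bij_betw_def inv_into_f_f)
  have inv_mult: "inv_into Z \<alpha>1 (u \<otimes>\<^bsub>vg p s\<^esub> w) = inv_into Z \<alpha>1 u \<otimes> inv_into Z \<alpha>1 w"
    if u: "u \<in> ?W" and w: "w \<in> ?W" for u w
  proof -
    have "u \<otimes>\<^bsub>vg p s\<^esub> w = \<alpha>1 (inv_into Z \<alpha>1 u \<otimes> inv_into Z \<alpha>1 w)"
      using f1.alpha_mult inv1[OF u] inv1[OF w] by simp
    then show ?thesis using inv2[of "inv_into Z \<alpha>1 u \<otimes> inv_into Z \<alpha>1 w"] inv1[OF u] inv1[OF w] subgroup.m_closed[OF subZ] by simp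
  qed
  \<comment> \<open>The element \<open>lift G \<beta>1 (\<beta>1 x)\<close> agrees with
    \<open>x\<close> only up to a factor in \<open>Z\<close>, but \<open>\<beta>\<close> is trivial
    on \<open>Z\<close>.\<close>
  have gb: "(\<lambda>v\<in>?V. \<beta> (lift G \<beta>1 v)) (\<beta>1 x) = \<beta> x" if fr: "(\<beta>, \<alpha>) \<in> frames p d s G Z" and x: "x \<in> carrier G" for \<beta> \<alpha> x
  proof -
    interpret f: framed G p d s Z \<beta> \<alpha> using fr by unfold_locales
    interpret b: group_hom G "vg p d" \<beta> by (rule f.beta_group_hom)
    obtain z where z: "z \<in> Z" "lift G \<beta>1 (\<beta>1 x) = z \<otimes> x"
      using f1.beta_eq[OF f1.lift(1) x f1.lift(2)] f1.beta_closed[OF x] by blast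
    have "\<beta> (z \<otimes> x) = \<beta> x" using f.beta_one[OF Zc[OF z(1)]] z(1) Zc x f.beta_closed[OF x] by simp
    then show ?thesis using z f1.beta_closed[OF x] by simp
  qed
  have "?F ` C \<subseteq> kron_autos m p d s (fst D)"
  proof clarify
    fix \<beta> \<alpha> assume t: "(\<beta>, \<alpha>) \<in> C"
    then have fr: "(\<beta>, \<alpha>) \<in> frames p d s G Z" and D: "frame_data m p d G \<beta> \<alpha> = D"
      and l: "\<And>i. i < m \<Longrightarrow> lift G \<beta> (unitv d i) = lift G \<beta>1 (unitv d i)" by (auto simp: C_def)
    interpret f: framed G p d s Z \<beta> \<alpha> using fr by unfold_locales
    interpret b: group_hom G "vg p d" \<beta> by (rule f.beta_group_hom)
    define g where "g = (\<lambda>v\<in>?V. \<beta> (lift G \<beta>1 v))"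
    define h where "h = (\<lambda>w\<in>?W. \<alpha> (inv_into Z \<alpha>1 w))"
    have gx: "g (\<beta>1 x) = \<beta> x" if "x \<in> carrier G" for x unfolding g_def by (rule gb[OF fr that])
    have "g (u \<otimes>\<^bsub>vg p d\<^esub> v) = g u \<otimes>\<^bsub>vg p d\<^esub> g v" if u: "u \<in> ?V" and v: "v \<in> ?V" for u v
    proof -
      interpret b1: group_hom G "vg p d" \<beta>1 by (rule f1.beta_group_hom)
      have "g (u \<otimes>\<^bsub>vg p d\<^esub> v) = g (\<beta>1 (lift G \<beta>1 u \<otimes> lift G \<beta>1 v))" using f1.lift[OF u] f1.lift[OF v] by simp
      also have "\<dots> = \<beta> (lift G \<beta>1 u \<otimes> lift G \<beta>1 v)" using f1.lift[OF u] f1.lift[OF v] by (intro gx) simp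
      also have "\<dots> = g u \<otimes>\<^bsub>vg p d\<^esub> g v" using f1.lift[OF u] f1.lift[OF v] u v by (simp add: g_def)
      finally show ?thesis .
    qed
    then have ge: "g \<in> ehom (vg p d) (vg p d)"
      using f1.lift f.beta_closed by (auto simp: ehom_def hom_def g_def)
    have "g ` ?V = ?V"
    proof -
      have "g ` ?V = g ` \<beta>1 ` carrier G" using f1.beta(3) by simp
      also have "\<dots> = \<beta> ` carrier G" unfolding image_image using gx by (intro image_cong) auto
      finally show ?thesis using f.beta(3) by simp
    qed
    then have "bij_betw g ?V ?V" using V.fin by (simp add: bij_betw_def eq_card_imp_inj_on)
    then have ga: "g \<in> autos p d" using ge by (simp add: autos_def)
    have "h (u \<otimes>\<^bsub>vg p s\<^esub> w) = h u \<otimes>\<^bsub>vg p s\<^esub> h w" if "u \<in> ?W" "w \<in> ?W" for u w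
      using that inv_mult[OF that] inv1 f.alpha_mult by (simp add: h_def)
    then have he: "h \<in> ehom (vg p s) (vg p s)"
      using inv1 f.alpha_closed by (auto simp: ehom_def hom_def h_def)
    have hz: "h (\<alpha>1 z) = \<alpha> z" if "z \<in> Z" for z using inv2[OF that] f1.alpha_closed[OF that] by (simp add: h_def)
    have "h ` ?W = ?W"
    proof -
      have "h ` ?W = h ` \<alpha>1 ` Z" using f1.alpha(3) by (simp add: bij_betw_def)
      also have "\<dots> = \<alpha> ` Z" unfolding image_image using hz by (intro image_cong) auto
      finally show ?thesis using f.alpha(3) by (simp add: bij_betw_def)
    qed
    then have "bij_betw h ?W ?W" using W.fin by (simp add: bij_betw_def eq_card_imp_inj_on)
    then have ha: "h \<in> autos p s" using he by (simp add: autos_def)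
    have "fst D i \<in> intertwiners (vg p d) (vg p s) g h" if i: "i < m" for i
    proof -
      have e: "unitv d i \<in> ?V" by (rule unitv_closed[OF p_gt_1])
      have A: "fst D i = restrict (form G \<beta> \<alpha> (unitv d i)) ?V" using D i by (auto simp: frame_data_def)
      have A1: "fst D i = restrict (form G \<beta>1 \<alpha>1 (unitv d i)) ?V" using D1 i by (auto simp: frame_data_def)
      have "fst D i (g v) = h (fst D i v)" if v: "v \<in> ?V" for v
      proof -
        \<comment> \<open>The element \<open>?x\<close> lifts the unit vector for both framings, so
          both rows are read off from the same commutator \<open>comm ?x ?y\<close>, once through
          \<open>\<alpha>\<close> and once through \<open>\<alpha>1\<close>.\<close>
        let ?x = "lift G \<beta> (unitv d i)" and ?y = "lift G \<beta>1 v"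
        have x: "?x \<in> carrier G" "\<beta> ?x = unitv d i" using f.lift[OF e] by auto
        have y: "?y \<in> carrier G" "\<beta>1 ?y = v" using f1.lift[OF v] by auto
        have gv: "g v = \<beta> ?y" using v by (simp add: g_def)
        have "fst D i (g v) = form G \<beta> \<alpha> (\<beta> ?x) (\<beta> ?y)" unfolding A gv using x f.beta_closed[OF y(1)] by simp
        also have "\<dots> = \<alpha> (comm ?x ?y)" by (rule f.form_eq[OF x(1) y(1)])
        also have "\<dots> = h (\<alpha>1 (comm ?x ?y))" using hz[OF comm_mem[OF x(1) y(1)]] by simp
        also have "\<alpha>1 (comm ?x ?y) = fst D i v" unfolding A1 l[OF i] form_def using v by simp
        finally show ?thesis .
      qed
      moreover have "fst D i \<in> ehom (vg p d) (vg p s)" unfolding A by (rule f.form_hom[OF e])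
      ultimately show ?thesis by (simp add: intertwiners_def)
    qed
    then show "(\<lambda>v\<in>?V. \<beta> (lift G \<beta>1 v), \<lambda>w\<in>?W. \<alpha> (inv_into Z \<alpha>1 w)) \<in> kron_autos m p d s (fst D)"
      using ga ha unfolding kron_autos_def g_def h_def by blast
  qed
  moreover have "inj_on ?F C"
  proof (rule inj_onI, clarify)
    fix \<beta> \<alpha> \<beta>' \<alpha>' assume "(\<beta>, \<alpha>) \<in> C" "(\<beta>', \<alpha>') \<in> C"
      and eq: "(\<lambda>v\<in>?V. \<beta> (lift G \<beta>1 v)) = (\<lambda>v\<in>?V. \<beta>' (lift G \<beta>1 v))"
        "(\<lambda>w\<in>?W. \<alpha> (inv_into Z \<alpha>1 w)) = (\<lambda>w\<in>?W. \<alpha>' (inv_into Z \<alpha>1 w))"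
    then have fr: "(\<beta>, \<alpha>) \<in> frames p d s G Z" "(\<beta>', \<alpha>') \<in> frames p d s G Z" by (auto simp: C_def)
    have "\<beta> = \<beta>'"
    proof (rule ehom_eqI[of _ G "vg p d"])
      show "\<beta> x = \<beta>' x" if x: "x \<in> carrier G" for x
        using gb[OF fr(1) x] gb[OF fr(2) x] eq(1) by metis
    qed (use fr in \<open>auto simp: frames_def\<close>)
    moreover have "\<alpha> = \<alpha>'"
    proof (rule ehom_eqI[of _ "G\<lparr>carrier := Z\<rparr>" "vg p s"])
      show "\<alpha> z = \<alpha>' z" if "z \<in> carrier (G\<lparr>carrier := Z\<rparr>)" for z
      proof -
        have z: "z \<in> Z" using that by simp
        show ?thesis using fun_cong[OF eq(2), of "\<alpha>1 z"] inv2[OF z] f1.alpha_closed[OF z] by simp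
      qed
    qed (use fr in \<open>auto simp: frames_def\<close>)
    ultimately show "\<beta> = \<beta>' \<and> \<alpha> = \<alpha>'" by simp
  qed
  moreover have "finite (kron_autos m p d s (fst D))"
    by (rule finite_subset[of _ "autos p d \<times> autos p s"]) (use card_autos(1)[OF prime_p] in \<open>auto simp: kron_autos_def\<close>)
  ultimately show ?thesis by (meson card_inj_on_le)
qed

text \<open>Framings with data \<open>D\<close> are sorted by their lifts of the first
  \<open>m\<close> unit vectors; there are at most \<open>|G|^m\<close> tuples of lifts.\<close>

lemma card_frames_fibre:
  assumes m: "m \<le> d"
  shows "card {t \<in> frames p d s G Z. (case t of (\<beta>, \<alpha>) \<Rightarrow> frame_data m p d G \<beta> \<alpha> = D)}
    \<le> (p ^ (d + s)) ^ m * card (kron_autos m p d s (fst D))"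
proof -
  let ?F = "{t \<in> frames p d s G Z. (case t of (\<beta>, \<alpha>) \<Rightarrow> frame_data m p d G \<beta> \<alpha> = D)}"
  let ?q = "\<lambda>(\<beta>, \<alpha>). \<lambda>i\<in>{..<m}. lift G \<beta> (unitv d i)"
  let ?C = "{..<m} \<rightarrow>\<^sub>E carrier G"
  have "finite ?F \<and> card ?F \<le> (p ^ (d + s)) ^ m * card (kron_autos m p d s (fst D))"
  proof (rule card_le_fibres[where q = ?q and C = ?C])
    show "finite ?C" using finG by (simp add: finite_PiE)
    show "card ?C \<le> (p ^ (d + s)) ^ m" using ordG by (simp add: card_funcsetE order_def)
    show "?q ` ?F \<subseteq> ?C"
    proof clarify
      fix \<beta> \<alpha> assume fr: "(\<beta>, \<alpha>) \<in> frames p d s G Z"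
      interpret f: framed G p d s Z \<beta> \<alpha> using fr by unfold_locales
      show "(\<lambda>i\<in>{..<m}. lift G \<beta> (unitv d i)) \<in> ?C" using f.lift(1)[OF unitv_closed[OF p_gt_1]] by auto
    qed
    fix c assume "c \<in> ?C"
    have fin: "finite {t \<in> ?F. ?q t = c}" using finite_frames by simp
    moreover have "card {t \<in> ?F. ?q t = c} \<le> card (kron_autos m p d s (fst D))"
    proof (cases "{t \<in> ?F. ?q t = c} = {}")
      case False
      then obtain \<beta>1 \<alpha>1 where t1: "(\<beta>1, \<alpha>1) \<in> frames p d s G Z" "frame_data m p d G \<beta>1 \<alpha>1 = D"
        "(\<lambda>i\<in>{..<m}. lift G \<beta>1 (unitv d i)) = c" by auto
      let ?D = "{t \<in> frames p d s G Z. (case t of (\<beta>, \<alpha>) \<Rightarrow> frame_data m p d G \<beta> \<alpha> = D \<and>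
        (\<forall>i<m. lift G \<beta> (unitv d i) = lift G \<beta>1 (unitv d i)))}"
      have "{t \<in> ?F. ?q t = c} \<subseteq> ?D"
      proof
        fix t assume t: "t \<in> {t \<in> ?F. ?q t = c}"
        obtain \<beta> \<alpha> where ba: "t = (\<beta>, \<alpha>)" by (cases t)
        have c: "(\<lambda>i\<in>{..<m}. lift G \<beta> (unitv d i)) = c" using t ba by simp
        have "lift G \<beta> (unitv d i) = lift G \<beta>1 (unitv d i)" if "i < m" for i
          using fun_cong[OF c, of i] fun_cong[OF t1(3), of i] that by simp
        then show "t \<in> ?D" using t ba by simp
      qed
      then have "card {t \<in> ?F. ?q t = c} \<le> card ?D" by (rule card_mono[rotated]) (use finite_frames in simp)
      also have "\<dots> \<le> card (kron_autos m p d s (fst D))" by (rule card_frames_same_lifts[OF m t1(1,2)])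
      finally show ?thesis .
    next
      case True
      show ?thesis unfolding True by simp
    qed
    ultimately show "finite {t \<in> ?F. ?q t = c} \<and> card {t \<in> ?F. ?q t = c} \<le> card (kron_autos m p d s (fst D))" by blast
  qed
  then show ?thesis by blast
qed

end

text \<open>Double counting: for a fixed pair \<open>(g, h)\<close> the \<open>m\<close> rows range
  independently over the intertwiners, whence the power.\<close>

lemma sum_card_kron_autos:
  assumes p: "prime p"
  shows "(\<Sum>A\<in>{..<m} \<rightarrow>\<^sub>E ehom (vg p d) (vg p s). card (kron_autos m p d s A))
    = (\<Sum>g\<in>autos p d. \<Sum>h\<in>autos p s. card (intertwiners (vg p d) (vg p s) g h) ^ m)"
proof -
  interpret V: elab "vg p d" p by (rule elab_vg[OF p])
  interpret W: elab "vg p s" p by (rule elab_vg[OF p])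
  let ?E = "ehom (vg p d) (vg p s)" and ?T = "autos p d \<times> autos p s"
  let ?P = "\<lambda>A (g, h). \<forall>i<m. A i \<in> intertwiners (vg p d) (vg p s) g h"
  have finA: "finite ({..<m} \<rightarrow>\<^sub>E ?E)" using finite_ehom[OF V.fin W.fin] by (simp add: finite_PiE)
  have finT: "finite ?T" using card_autos(1)[OF p] by simp
  have "(\<Sum>A\<in>{..<m} \<rightarrow>\<^sub>E ?E. card (kron_autos m p d s A)) = (\<Sum>A\<in>{..<m} \<rightarrow>\<^sub>E ?E. \<Sum>t\<in>?T. if ?P A t then 1 else 0)"
    by (intro sum.cong refl card_as_sums finT) (auto simp: kron_autos_def)
  also have "\<dots> = (\<Sum>t\<in>?T. \<Sum>A\<in>{..<m} \<rightarrow>\<^sub>E ?E. if ?P A t then 1 else 0)" by (rule sum.swap)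
  also have "\<dots> = (\<Sum>t\<in>?T. case t of (g, h) \<Rightarrow> card (intertwiners (vg p d) (vg p s) g h) ^ m)"
  proof (rule sum.cong[OF refl])
    fix t assume "t \<in> ?T"
    obtain g h where t: "t = (g, h)" by (cases t)
    let ?I = "intertwiners (vg p d) (vg p s) g h"
    have "?I \<subseteq> ?E" by (auto simp: intertwiners_def)
    then have "{A \<in> {..<m} \<rightarrow>\<^sub>E ?E. ?P A t} = {..<m} \<rightarrow>\<^sub>E ?I" using t by (auto simp: PiE_def Pi_def)
    then have "card {A \<in> {..<m} \<rightarrow>\<^sub>E ?E. ?P A t} = card ?I ^ m" by (simp add: card_funcsetE)
    then show "(\<Sum>A\<in>{..<m} \<rightarrow>\<^sub>E ?E. if ?P A t then 1 else 0) = (case t of (g, h) \<Rightarrow> card (intertwiners (vg p d) (vg p s) g h) ^ m)"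
      using card_as_sums[OF refl finA, of "\<lambda>A. ?P A t"] t by simp
  qed
  also have "\<dots> = (\<Sum>g\<in>autos p d. \<Sum>h\<in>autos p s. card (intertwiners (vg p d) (vg p s) g h) ^ m)"
    by (simp add: sum.cartesian_product)
  finally show ?thesis .
qed

lemma card_increasing_pairs: "card {(i, j). m \<le> i \<and> i < j \<and> j < (d::nat)} = (d - m) * (d - m - 1) div 2"
  "finite {(i, j). m \<le> i \<and> i < j \<and> j < (d::nat)}"
proof -
  have eq': "{(i, j). m \<le> i \<and> i < j \<and> j < d} = (\<lambda>(j, i). (i, j)) ` (SIGMA j:{..<d}. {m..<j})"
    by force
  show "finite {(i, j). m \<le> i \<and> i < j \<and> j < d}" unfolding eq' by simp
  have "card {(i, j). m \<le> i \<and> i < j \<and> j < d} = card (SIGMA j:{..<d}. {m..<j})"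
    unfolding eq' by (rule card_image) (auto simp: inj_on_def)
  also have "\<dots> = (\<Sum>j<d. j - m)" by (simp add: card_SigmaI)
  also have "2 * (\<Sum>j<d. j - m) = (d - m) * (d - m - 1)"
  proof (induction d)
    case (Suc d)
    show ?case
    proof (cases "m \<le> d")
      case True
      then obtain k where "d = m + k" using le_Suc_ex by blast
      then show ?thesis using Suc by (cases k) (auto simp: algebra_simps)
    qed (use Suc in simp)
  qed simp
  then have "(\<Sum>j<d. j - m) = (d - m) * (d - m - 1) div 2" by simp
  finally show "card {(i, j). m \<le> i \<and> i < j \<and> j < d} = (d - m) * (d - m - 1) div 2" .
qed

text \<open>Pairs of a group and a framing are counted twice. From below, each group has many
  framings; from above, equal data force isomorphic groups, hence the same representative, so a
  fibre consists of framings of one group. \<open>Q\<close> bounds where \<open>p\<close>-th powers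
  land: the trivial subgroup for exponent \<open>p\<close>, all of \<open>vg p s\<close> in
  general.\<close>

theorem card_central_exts:
  fixes R :: "('a, 'b) monoid_scheme set"
  assumes p: "prime p" and finR: "finite R"
    and ext: "\<And>G. G \<in> R \<Longrightarrow> central_ext G p d s (Zf G)"
    and niso: "\<And>G H. G \<in> R \<Longrightarrow> H \<in> R \<Longrightarrow> G \<cong> H \<Longrightarrow> G = H"
    and Q: "finite Q" "\<And>G \<beta> \<alpha> x. G \<in> R \<Longrightarrow> (\<beta>, \<alpha>) \<in> frames p d s G (Zf G) \<Longrightarrow> x \<in> carrier G \<Longrightarrow> \<alpha> (x [^]\<^bsub>G\<^esub> p) \<in> Q"
    and m: "m \<le> d"
  shows "card R * (card (autos p d) * card (autos p s)) \<le>
    p ^ ((d + s) * m) * (p ^ (s * ((d - m) * (d - m - 1) div 2)) * card Q ^ d) *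
    (\<Sum>g\<in>autos p d. \<Sum>h\<in>autos p s. card (intertwiners (vg p d) (vg p s) g h) ^ m)"
proof -
  interpret V: elab "vg p d" p by (rule elab_vg[OF p])
  interpret W: elab "vg p s" p by (rule elab_vg[OF p])
  define T where "T = (SIGMA G:R. frames p d s G (Zf G))"
  define dat where "dat = (\<lambda>(G :: ('a, 'b) monoid_scheme, \<beta>, \<alpha> :: 'a \<Rightarrow> nat \<Rightarrow> nat). frame_data m p d G \<beta> \<alpha>)"
  let ?E = "ehom (vg p d) (vg p s)"
  let ?P = "{(i, j). m \<le> i \<and> i < j \<and> j < d}"
  let ?XA = "{..<m} \<rightarrow>\<^sub>E ?E" and ?Y = "(?P \<rightarrow>\<^sub>E carrier (vg p s)) \<times> ({..<d} \<rightarrow>\<^sub>E Q)"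
  let ?X = "?XA \<times> ?Y"
  have finX: "finite ?XA" "finite ?Y"
    using finite_ehom[OF V.fin W.fin] W.fin Q(1) card_increasing_pairs(2)[of m d] by (auto simp: finite_PiE)
  have e: "unitv d i \<in> carrier (vg p d)" for i by (rule unitv_closed[OF V.p_gt_1])
  have frm: "framed G p d s (Zf G) \<beta> \<alpha>" if "(G, \<beta>, \<alpha>) \<in> T" for G \<beta> \<alpha>
    using that ext[of G] unfolding T_def by (auto simp: framed_def framed_axioms_def)
  have finT: "finite T" unfolding T_def using finR central_ext.finite_frames[OF ext] by blast
  have "card R * (card (autos p d) * card (autos p s)) = (\<Sum>G\<in>R. card (autos p d) * card (autos p s))" by simp
  also have "\<dots> \<le> (\<Sum>G\<in>R. card (frames p d s G (Zf G)))"
    by (intro sum_mono central_ext.card_frames ext)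
  also have "\<dots> = card T" unfolding T_def using finR central_ext.finite_frames[OF ext] by (simp add: card_SigmaI)
  also have "\<dots> = card (\<Union>D\<in>?X. {t \<in> T. dat t = D})"
  proof -
    have "dat t \<in> ?X" if t: "t \<in> T" for t
    proof -
      obtain G \<beta> \<alpha> where tt: "t = (G, \<beta>, \<alpha>)" by (cases t)
      interpret f: framed G p d s "Zf G" \<beta> \<alpha> using frm t tt by blast
      have GR: "G \<in> R" "(\<beta>, \<alpha>) \<in> frames p d s G (Zf G)" using t tt unfolding T_def by auto
      show ?thesis unfolding dat_def tt frame_data_def
        using f.form_hom[OF e] f.form_closed[OF e e] Q(2)[OF GR f.lift(1)[OF e]] by auto
    qed
    then have "T = (\<Union>D\<in>?X. {t \<in> T. dat t = D})" by blast
    then show ?thesis by simp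
  qed
  also have "\<dots> \<le> (\<Sum>D\<in>?X. card {t \<in> T. dat t = D})" by (rule card_UN_le) (use finX in simp)
  also have "\<dots> \<le> (\<Sum>D\<in>?X. p ^ ((d + s) * m) * card (kron_autos m p d s (fst D)))"
  proof (rule sum_mono)
    fix D assume "D \<in> ?X"
    show "card {t \<in> T. dat t = D} \<le> p ^ ((d + s) * m) * card (kron_autos m p d s (fst D))"
    proof (cases "{t \<in> T. dat t = D} = {}")
      case False
      then obtain G \<beta> \<alpha> where t: "(G, \<beta>, \<alpha>) \<in> T" "frame_data m p d G \<beta> \<alpha> = D"
        unfolding dat_def by auto
      interpret f: framed G p d s "Zf G" \<beta> \<alpha> using frm t by blast
      have same: "H = G" if h: "(H, \<gamma>, \<delta>) \<in> T" "frame_data m p d H \<gamma> \<delta> = D" for H \<gamma> \<delta>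
      proof -
        interpret h: framed H p d s "Zf H" \<gamma> \<delta> using frm h by blast
        have eq: "frame_data m p d G \<beta> \<alpha> = frame_data m p d H \<gamma> \<delta>" using t h by simp
        have "G \<cong> H"
        proof (rule frames_determine[OF f.framed_axioms h.framed_axioms])
          fix i j :: nat assume ij: "i < j" "j < d"
          show "form G \<beta> \<alpha> (unitv d i) (unitv d j) = form H \<gamma> \<delta> (unitv d i) (unitv d j)"
          proof (cases "i < m")
            case True
            have "restrict (form G \<beta> \<alpha> (unitv d i)) (carrier (vg p d)) = restrict (form H \<gamma> \<delta> (unitv d i)) (carrier (vg p d))"
              using fun_cong[OF arg_cong[OF eq, of fst], of i] True by (simp add: frame_data_def)
            from fun_cong[OF this, of "unitv d j"] show ?thesis using e by simp
          next
            case False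
            then show ?thesis using fun_cong[OF arg_cong[OF eq, of "\<lambda>D. fst (snd D)"], of "(i, j)"] ij
              by (simp add: frame_data_def)
          qed
        next
          fix i assume "i < d"
          then show "\<alpha> (lift G \<beta> (unitv d i) [^]\<^bsub>G\<^esub> p) = \<delta> (lift H \<gamma> (unitv d i) [^]\<^bsub>H\<^esub> p)"
            using fun_cong[OF arg_cong[OF eq, of "\<lambda>D. snd (snd D)"], of i] by (simp add: frame_data_def)
        qed
        then show ?thesis using niso h t unfolding T_def by auto
      qed
      let ?F = "{t \<in> frames p d s G (Zf G). (case t of (\<beta>, \<alpha>) \<Rightarrow> frame_data m p d G \<beta> \<alpha> = D)}"
      have "{t \<in> T. dat t = D} \<subseteq> Pair G ` ?F"
      proof
        fix t assume t': "t \<in> {t \<in> T. dat t = D}"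
        obtain H \<gamma> \<delta> where tt: "t = (H, \<gamma>, \<delta>)" by (cases t)
        have "H = G" using same t' tt unfolding dat_def by auto
        then show "t \<in> Pair G ` ?F" using t' tt unfolding dat_def T_def by auto
      qed
      then have "card {t \<in> T. dat t = D} \<le> card (Pair G ` ?F)" by (rule card_mono[rotated]) (use f.finite_frames in simp)
      also have "\<dots> \<le> card ?F" by (rule card_image_le) (use f.finite_frames in simp)
      also have "\<dots> \<le> (p ^ (d + s)) ^ m * card (kron_autos m p d s (fst D))" by (rule f.card_frames_fibre[OF m])
      finally show ?thesis by (simp add: power_mult)
    next
      case True
      show ?thesis unfolding True by simp
    qed
  qed
  also have "\<dots> = p ^ ((d + s) * m) * (card ?Y * (\<Sum>A\<in>?XA. card (kron_autos m p d s A)))"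
  proof -
    have "(\<Sum>D\<in>?X. p ^ ((d + s) * m) * card (kron_autos m p d s (fst D)))
      = (\<Sum>A\<in>?XA. \<Sum>y\<in>?Y. p ^ ((d + s) * m) * card (kron_autos m p d s A))"
      by (subst sum.cartesian_product) (simp add: case_prod_beta)
    also have "\<dots> = (\<Sum>A\<in>?XA. (p ^ ((d + s) * m) * card ?Y) * card (kron_autos m p d s A))"
      by (intro sum.cong refl) simp
    finally show ?thesis by (simp only: sum_distrib_left[symmetric] mult.assoc)
  qed
  also have "card ?Y = p ^ (s * ((d - m) * (d - m - 1) div 2)) * card Q ^ d"
    using card_increasing_pairs[of m d] order_vg[of p s]
    by (simp add: card_cartesian_product card_funcsetE order_def power_mult)
  finally show ?thesis unfolding sum_card_kron_autos[OF p] by (simp add: ac_simps)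
qed

section \<open>Upper bounds for the number of isomorphism classes\<close>

text \<open>The case \<open>m = 0\<close>: nothing has to be intertwined, so the sum is the number
  of pairs of automorphisms and cancels.\<close>

lemma card_central_exts_trivial:
  fixes R :: "('a, 'b) monoid_scheme set"
  assumes p: "prime p" and finR: "finite R"
    and ext: "\<And>G. G \<in> R \<Longrightarrow> central_ext G p d s (Zf G)"
    and niso: "\<And>G H. G \<in> R \<Longrightarrow> H \<in> R \<Longrightarrow> G \<cong> H \<Longrightarrow> G = H"
    and Q: "finite Q" "\<And>G \<beta> \<alpha> x. G \<in> R \<Longrightarrow> (\<beta>, \<alpha>) \<in> frames p d s G (Zf G) \<Longrightarrow> x \<in> carrier G \<Longrightarrow> \<alpha> (x [^]\<^bsub>G\<^esub> p) \<in> Q"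
    and cQ: "card Q = p ^ q"
  shows "card R \<le> p ^ (s * (d * (d - 1) div 2) + q * d)"
proof -
  let ?A = "card (autos p d) * card (autos p s)"
  have cQd: "card Q ^ d = p ^ (q * d)" by (simp add: cQ power_mult)
  have "card R * ?A \<le> p ^ ((d + s) * 0) * (p ^ (s * ((d - 0) * (d - 0 - 1) div 2)) * card Q ^ d) *
    (\<Sum>g\<in>autos p d. \<Sum>h\<in>autos p s. card (intertwiners (vg p d) (vg p s) g h) ^ 0)"
    by (rule card_central_exts[where Zf = Zf]) (use p finR ext niso Q in blast)+
  then have "card R * ?A \<le> p ^ (s * (d * (d - 1) div 2) + q * d) * ?A"
    unfolding cQd by (simp add: power_add)
  moreover have "?A > 0"
    using card_autos(2)[OF p, of d] card_autos(2)[OF p, of s] prime_gt_0_nat[OF p]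
    by (metis gr_zeroI le_zero_eq mult_eq_0_iff power_eq_0_iff not_gr_zero)
  ultimately show ?thesis by simp
qed

text \<open>The case \<open>m = 2 * r\<close>. The sum is enlarged from automorphisms to
  endomorphisms, for which the bound on intertwiners was proved.\<close>

lemma card_central_exts_main:
  fixes R :: "('a, 'b) monoid_scheme set"
  assumes p: "prime p" and finR: "finite R"
    and ext: "\<And>G. G \<in> R \<Longrightarrow> central_ext G p d s (Zf G)"
    and niso: "\<And>G H. G \<in> R \<Longrightarrow> H \<in> R \<Longrightarrow> G \<cong> H \<Longrightarrow> G = H"
    and Q: "finite Q" "\<And>G \<beta> \<alpha> x. G \<in> R \<Longrightarrow> (\<beta>, \<alpha>) \<in> frames p d s G (Zf G) \<Longrightarrow> x \<in> carrier G \<Longrightarrow> \<alpha> (x [^]\<^bsub>G\<^esub> p) \<in> Q"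
    and cQ: "card Q = p ^ q"
    and r: "4 * d \<le> r * s" "4 * s \<le> r * d" "2 * r \<le> d"
  shows "card R * p ^ ((d - 1) * d + (s - 1) * s) \<le>
    p ^ ((d + s) * (2 * r) + s * ((d - 2 * r) * (d - 2 * r - 1) div 2) + q * d + (2 * r * d * s + 2 * d + 2 * s + 2))"
proof -
  interpret V: elab "vg p d" p by (rule elab_vg[OF p])
  interpret W: elab "vg p s" p by (rule elab_vg[OF p])
  let ?c = "\<lambda>g h. card (intertwiners (vg p d) (vg p s) g h) ^ (2 * r)"
  have cQd: "card Q ^ d = p ^ (q * d)" by (simp add: cQ power_mult)
  have sub: "autos p d \<subseteq> ehom (vg p d) (vg p d)" "autos p s \<subseteq> ehom (vg p s) (vg p s)"
    by (auto simp: autos_def)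
  have "card R * p ^ ((d - 1) * d + (s - 1) * s) \<le> card R * (card (autos p d) * card (autos p s))"
    unfolding power_add by (intro mult_le_mono card_autos(2)[OF p] order_refl)
  also have "\<dots> \<le> p ^ ((d + s) * (2 * r)) * (p ^ (s * ((d - 2 * r) * (d - 2 * r - 1) div 2)) * card Q ^ d) *
    (\<Sum>g\<in>autos p d. \<Sum>h\<in>autos p s. ?c g h)"
    by (rule card_central_exts[where Zf = Zf]) (use p finR ext niso Q r(3) in blast)+
  also have "\<dots> \<le> p ^ ((d + s) * (2 * r)) * (p ^ (s * ((d - 2 * r) * (d - 2 * r - 1) div 2)) * card Q ^ d) *
    p ^ (2 * r * d * s + 2 * d + 2 * s + 2)"
  proof (rule mult_le_mono2)
    have "(\<Sum>g\<in>autos p d. \<Sum>h\<in>autos p s. ?c g h) \<le> (\<Sum>g\<in>autos p d. \<Sum>h\<in>ehom (vg p s) (vg p s). ?c g h)"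
      by (intro sum_mono sum_mono2 sub finite_ehom W.fin) auto
    also have "\<dots> \<le> (\<Sum>g\<in>ehom (vg p d) (vg p d). \<Sum>h\<in>ehom (vg p s) (vg p s). ?c g h)"
      by (intro sum_mono2 sub finite_ehom V.fin) auto
    also have "\<dots> \<le> p ^ (2 * r * d * s + 2 * d + 2 * s + 2)"
      by (rule sum_card_intertwiners[OF elab_vg[OF p] elab_vg[OF p] order_vg order_vg r(1,2)])
    finally show "(\<Sum>g\<in>autos p d. \<Sum>h\<in>autos p s. ?c g h) \<le> p ^ (2 * r * d * s + 2 * d + 2 * s + 2)" .
  qed
  finally show ?thesis unfolding cQd by (simp only: power_add ac_simps)
qed

section \<open>Both classes consist of central extensions\<close>

lemma (in group) center_subgroup: "subgroup (group_center G) G"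
proof (rule subgroupI)
  show "group_center G \<subseteq> carrier G" by (auto simp: group_center_def)
  show "group_center G \<noteq> {}" by (auto simp: group_center_def intro!: exI[of _ \<one>])
next
  fix a assume "a \<in> group_center G"
  then have a: "a \<in> carrier G" "\<And>g. g \<in> carrier G \<Longrightarrow> a \<otimes> g = g \<otimes> a" by (auto simp: group_center_def)
  have "inv a \<otimes> g = g \<otimes> inv a" if g: "g \<in> carrier G" for g
  proof -
    have "inv a \<otimes> (g \<otimes> a) \<otimes> inv a = inv a \<otimes> (a \<otimes> g) \<otimes> inv a" using a(2)[OF g] by simp
    moreover have "inv a \<otimes> (g \<otimes> a) \<otimes> inv a = inv a \<otimes> g" using a(1) g by (simp add: m_assoc)
    moreover have "inv a \<otimes> (a \<otimes> g) \<otimes> inv a = g \<otimes> inv a" using a(1) g by (simp flip: m_assoc)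
    ultimately show ?thesis by simp
  qed
  then show "inv a \<in> group_center G" using a(1) by (simp add: group_center_def)
next
  fix a b assume "a \<in> group_center G" "b \<in> group_center G"
  then have a: "a \<in> carrier G" "\<And>g. g \<in> carrier G \<Longrightarrow> a \<otimes> g = g \<otimes> a"
    and b: "b \<in> carrier G" "\<And>g. g \<in> carrier G \<Longrightarrow> b \<otimes> g = g \<otimes> b" by (auto simp: group_center_def)
  have "a \<otimes> b \<otimes> g = g \<otimes> (a \<otimes> b)" if g: "g \<in> carrier G" for g
  proof -
    have "a \<otimes> b \<otimes> g = a \<otimes> (g \<otimes> b)" using a(1) b(1) b(2)[OF g] g by (simp add: m_assoc)
    also have "\<dots> = (a \<otimes> g) \<otimes> b" using a(1) b(1) g by (simp add: m_assoc)
    also have "\<dots> = g \<otimes> (a \<otimes> b)" using a(1) a(2)[OF g] b(1) g by (simp add: m_assoc)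
    finally show ?thesis .
  qed
  then show "a \<otimes> b \<in> group_center G" using a(1) b(1) by (simp add: group_center_def)
qed

lemma central_extI:
  assumes "group G" and p: "prime p" and "subgroup Z G" and ord: "order G = p ^ l"
    and "Z \<subseteq> group_center G" "\<And>z. z \<in> Z \<Longrightarrow> z [^]\<^bsub>G\<^esub> p = \<one>\<^bsub>G\<^esub>"
    and "\<And>x. x \<in> carrier G \<Longrightarrow> x [^]\<^bsub>G\<^esub> p \<in> Z"
    and "\<And>x y. x \<in> carrier G \<Longrightarrow> y \<in> carrier G \<Longrightarrow> group.comm G x y \<in> Z"
  shows "\<exists>d\<le>l. central_ext G p d (l - d) Z"
proof -
  interpret group G by fact
  have "card Z dvd p ^ l" using lagrange[OF assms(3)] ord by (metis dvd_triv_right)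
  then obtain s where s: "s \<le> l" "card Z = p ^ s" using p by (metis divides_primepow_nat)
  have "central_ext G p (l - s) s Z"
    by (intro central_ext.intro central_ext_axioms.intro)
      (use assms s in \<open>auto simp: group_center_def subset_iff\<close>)
  then show ?thesis using s by (intro exI[of _ "l - s"]) auto
qed

lemma class_B_central_ext:
  fixes G (structure)
  assumes p: "prime p" and G: "class_B p G" and ord: "order G = p ^ l"
  shows "\<exists>d\<le>l. central_ext G p d (l - d) (group_center G)"
proof -
  interpret group G using G by (simp add: class_B_def p_group_def)
  have pw: "g [^] p = \<one>" if "g \<in> carrier G" for g using G that by (simp add: class_B_def)
  have "comm x y \<in> group_center G" if "x \<in> carrier G" "y \<in> carrier G" for x y
  proof -
    have "comm x y \<in> derived G (carrier G)"
      unfolding derived_def comm_def using that by (intro generate.incl) blast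
    then show ?thesis using G by (auto simp: class_B_def)
  qed
  then show ?thesis
    using subgroup.one_closed[OF center_subgroup]
    by (intro central_extI[OF is_group p center_subgroup ord])
      (auto simp: pw group_center_def)
qed

text \<open>The Frattini subgroup contains all \<open>p\<close>-th powers and commutators because
  every maximal subgroup does; that it is a subgroup is read off from the assumption that it carries
  a group structure.\<close>

lemma class_H_central_ext:
  fixes G (structure)
  assumes p: "prime p" and G: "class_H p G" and ord: "order G = p ^ l"
  shows "\<exists>d\<le>l. central_ext G p d (l - d) (frattini G)"
proof -
  interpret group G using G by (simp add: class_H_def p_group_def)
  have sub: "frattini G \<subseteq> carrier G" by (auto simp: frattini_def)
  have el: "comm_group (G\<lparr>carrier := frattini G\<rparr>)"
    "\<And>x. x \<in> frattini G \<Longrightarrow> x [^]\<^bsub>G\<lparr>carrier := frattini G\<rparr>\<^esub> p = \<one>"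
    using G by (auto simp: class_H_def elementary_abelian_def)
  have "subgroup (frattini G) G"
    by (rule group_incl_imp_subgroup[OF sub]) (use el(1) in \<open>simp add: comm_group_def\<close>)
  then show ?thesis
  proof (rule central_extI[OF is_group p _ ord])
    show "frattini G \<subseteq> group_center G" using G by (simp add: class_H_def)
    show "z [^] p = \<one>" if "z \<in> frattini G" for z
      using el(2)[OF that] nat_pow_consistent[of z p "frattini G"] by simp
    show "x [^] p \<in> frattini G" if "x \<in> carrier G" for x
      using maximal_subgroup_pow[OF p ord _ that] that by (simp add: frattini_def)
    show "comm x y \<in> frattini G" if "x \<in> carrier G" "y \<in> carrier G" for x y
      using maximal_subgroup_comm[OF p ord _ that] that by (simp add: frattini_def)
  qed
qed

section \<open>From sets of representatives to isomorphism classes\<close>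

abbreviation (input) iso_rel where
  "iso_rel P n \<equiv> {(G, H). G \<in> groups_of_order P n \<and> H \<in> groups_of_order P n \<and> G \<cong> H}"

text \<open>A uniform bound on finite sets of pairwise non-isomorphic groups also makes the quotient
  finite. This matters for the lower bounds, as \<open>card\<close> of an infinite set would be
  0.\<close>

lemma num_iso_classes_le:
  assumes "\<And>R. finite R \<Longrightarrow> R \<subseteq> groups_of_order P n \<Longrightarrow>
    (\<And>G H. G \<in> R \<Longrightarrow> H \<in> R \<Longrightarrow> G \<cong> H \<Longrightarrow> G = H) \<Longrightarrow> card R \<le> N"
  shows "finite (groups_of_order P n // iso_rel P n)"
    "num_iso_classes P n \<le> N"
proof -
  let ?r = "iso_rel P n"
  let ?X = "groups_of_order P n"
  have eqv: "equiv ?X ?r" by (rule equiv_iso_groups_of_order)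
  have "finite (?X // ?r) \<and> card (?X // ?r) \<le> N"
  proof (rule finite_if_finite_subsets_card_bdd)
    fix C assume C: "C \<subseteq> ?X // ?r" "finite C"
    define rep where "rep = (\<lambda>c :: nat monoid set. SOME x. x \<in> c)"
    have rep: "rep c \<in> c" "rep c \<in> ?X" if "c \<in> C" for c
    proof -
      obtain x where "x \<in> ?X" "c = ?r `` {x}" using C(1) \<open>c \<in> C\<close> by (meson quotientE subsetD)
      then have "x \<in> c" using equiv_class_self[OF eqv] by blast
      then show "rep c \<in> c" unfolding rep_def by (rule someI)
      then show "rep c \<in> ?X" using C(1) \<open>c \<in> C\<close> in_quotient_imp_subset[OF eqv] by blast
    qed
    have same: "c = c'" if "c \<in> C" "c' \<in> C" "rep c \<cong> rep c'" for c c'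
      using quotient_eqI[OF eqv, of c c' "rep c" "rep c'"] that rep C(1) by auto
    have "inj_on rep C"
    proof (rule inj_onI)
      fix c c' assume "c \<in> C" "c' \<in> C" "rep c = rep c'"
      then show "c = c'" using same[of c c'] iso_refl[of "rep c"] by simp
    qed
    moreover have "card (rep ` C) \<le> N"
    proof (rule assms)
      show "finite (rep ` C)" using C by simp
      show "rep ` C \<subseteq> ?X" using rep by blast
      show "G = H" if "G \<in> rep ` C" "H \<in> rep ` C" "G \<cong> H" for G H using that same by blast
    qed
    ultimately show "card C \<le> N" by (simp add: card_image)
  qed
  then show "finite (?X // ?r)" "num_iso_classes P n \<le> N" by (auto simp: num_iso_classes_def)
qed

lemma num_iso_classes_ge:
  assumes fin: "finite (groups_of_order P n // iso_rel P n)"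
    and F: "\<And>t. t \<in> D \<Longrightarrow> F t \<in> groups_of_order P n"
    and fib: "\<And>t. t \<in> D \<Longrightarrow> finite {u \<in> D. F u \<cong> F t} \<and> card {u \<in> D. F u \<cong> F t} \<le> M"
  shows "card D \<le> num_iso_classes P n * M"
proof -
  let ?r = "iso_rel P n"
  let ?X = "groups_of_order P n"
  have eqv: "equiv ?X ?r" by (rule equiv_iso_groups_of_order)
  have "finite D \<and> card D \<le> num_iso_classes P n * M"
  proof (rule card_le_fibres[OF fin, where q = "\<lambda>t. ?r `` {F t}"])
    show "(\<lambda>t. ?r `` {F t}) ` D \<subseteq> ?X // ?r" by (intro image_subsetI quotientI F)
    show "card (?X // ?r) \<le> num_iso_classes P n" by (simp add: num_iso_classes_def)
    fix c assume "c \<in> ?X // ?r"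
    show "finite {t \<in> D. ?r `` {F t} = c} \<and> card {t \<in> D. ?r `` {F t} = c} \<le> M"
    proof (cases "{t \<in> D. ?r `` {F t} = c} = {}")
      case True show ?thesis unfolding True by simp
    next
      case False
      then obtain t where t: "t \<in> D" "?r `` {F t} = c" by blast
      have "{u \<in> D. ?r `` {F u} = c} \<subseteq> {u \<in> D. F u \<cong> F t}"
        using t F eq_equiv_class_iff[OF eqv] by auto
      then show ?thesis using fib[OF t(1)] by (meson card_mono finite_subset le_trans)
    qed
  qed
  then show ?thesis by blast
qed

section \<open>Cubic inequalities for the exponents\<close>

text \<open>For \<open>S <= L/5\<close> the cubic coefficient is largest at \<open>S = L/5\<close>,
  where it is \<open>8/125\<close>, and \<open>2/27 - 8/125\<close> exceeds \<open>1/100\<close>.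
  The quadratic loss has coefficient \<open>2/3 + 1/4 = 11/12\<close>, the \<open>1/4\<close> coming
  from \<open>S * D\<close>, and is made up by \<open>1000 * L\<close>. For \<open>D <= 32\<close>
  the left side is linear in \<open>L\<close>.\<close>

lemma exponent_bound_far:
  fixes D S :: real
  assumes D: "D \<ge> 0" and S: "S \<ge> 0" and L: "L = D + S"
    and far: "S \<le> L / 5 \<or> D \<le> L / 5 \<or> D \<le> 32"
  shows "S * D\<^sup>2 / 2 + S * D \<le> 2/27 * L ^ 3 - 2/3 * L\<^sup>2 + 1000 * L"
proof -
  have L0: "L \<ge> 0" using assms by simp
  have SD: "S * D \<le> L\<^sup>2 / 4"
  proof -
    have "0 \<le> (D - S)\<^sup>2" by simp
    then show ?thesis unfolding L by (simp add: power2_eq_square algebra_simps)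
  qed
  show ?thesis
  proof (cases "D \<le> 32")
    case True
    have "S * D\<^sup>2 / 2 \<le> L * 512"
    proof -
      have "D\<^sup>2 \<le> 32\<^sup>2" using D True by (intro power_mono) auto
      then have "S * D\<^sup>2 \<le> L * 1024" using S D L by (intro mult_mono) auto
      then show ?thesis by simp
    qed
    moreover have "S * D \<le> L * 32" using S D L True by (intro mult_mono) auto
    moreover have "0 \<le> L * (2/27 * L\<^sup>2 - 2/3 * L + 2)"
    proof -
      have "2/27 * L\<^sup>2 - 2/3 * L + 2 = 2/27 * (L - 9/2)\<^sup>2 + 1/2" by (simp add: power2_eq_square algebra_simps)
      then show ?thesis using L0 by simp
    qed
    ultimately show ?thesis using L0 by (simp add: power2_eq_square power3_eq_cube algebra_simps)
  next
    case False
    have "S * D\<^sup>2 \<le> 16/125 * L ^ 3"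
    proof (cases "S \<le> L / 5")
      case True
      \<comment> \<open>The difference has the root \<open>S = L / 5\<close>; the cofactor is
        nonnegative because \<open>S * L\<close> is at most a fifth of the square of
        \<open>L\<close>.\<close>
      have eq: "16/125 * L ^ 3 - S * D\<^sup>2 = (L / 5 - S) * (S\<^sup>2 + 16/25 * L\<^sup>2 - 9/5 * (S * L))"
      proof -
        have DL: "D = L - S" using L by simp
        show ?thesis unfolding DL by (simp add: power2_eq_square power3_eq_cube field_simps)
      qed
      have "S * L \<le> L / 5 * L" using True L0 by (intro mult_right_mono) auto
      then have "S * L \<le> L\<^sup>2 / 5" by (simp add: power2_eq_square)
      moreover have "S\<^sup>2 \<ge> 0" "L\<^sup>2 \<ge> 0" by simp_all
      ultimately have "S\<^sup>2 + 16/25 * L\<^sup>2 - 9/5 * (S * L) \<ge> 0" by linarith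
      then have "0 \<le> (L / 5 - S) * (S\<^sup>2 + 16/25 * L\<^sup>2 - 9/5 * (S * L))"
        using True by (intro mult_nonneg_nonneg) auto
      then show ?thesis using eq by linarith
    next
      case S5: False
      then have "D \<le> L / 5" using far False by simp
      then have "D\<^sup>2 \<le> (L / 5)\<^sup>2" using D by (intro power_mono) auto
      then have "S * D\<^sup>2 \<le> L * (L / 5)\<^sup>2" using S D L by (intro mult_mono) auto
      moreover have "L * (L / 5)\<^sup>2 = L ^ 3 / 25" by (simp add: power2_eq_square power3_eq_cube)
      moreover have "L ^ 3 \<ge> 0" using L0 by simp
      ultimately show ?thesis by linarith
    qed
    moreover have "0 \<le> L * (1/100 * L\<^sup>2 - 11/12 * L + 1000)"
    proof -
      \<comment> \<open>\<open>275/6\<close> is where the quadratic attains its minimum.\<close>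
      have "1/100 * L\<^sup>2 - 11/12 * L + 1000 = 1/100 * (L - 275/6)\<^sup>2 + (1000 - 1/100 * (275/6)\<^sup>2)"
        by (simp add: power2_eq_square algebra_simps)
      then show ?thesis using L0 by (simp add: power2_eq_square)
    qed
    moreover have "L ^ 3 \<ge> 0" using L0 by simp
    moreover have "L * (1/100 * L\<^sup>2 - 11/12 * L + 1000) = 1/100 * L ^ 3 - 11/12 * L\<^sup>2 + 1000 * L"
      by (simp add: power2_eq_square power3_eq_cube algebra_simps)
    ultimately show ?thesis using SD by linarith
  qed
qed

text \<open>\<open>e\<close> measures the deviation from the optimum \<open>D = 2/3 L\<close>. There
  the cubic part has no linear term in \<open>e\<close>, and its deficit is
  \<open>e^2 (L + e) / 2\<close>, at least \<open>4/15 e^2 L\<close> because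
  \<open>S <= 4 D\<close>. This absorbs the mixed term in \<open>L e\<close> by completing a square,
  at the price of the summand \<open>L\<close>.\<close>

lemma exponent_bound_near:
  fixes D S k :: real
  assumes D: "D \<ge> 0" and S: "S \<ge> 0" and L: "L = D + S" and near: "S \<le> 4 * D" and k: "k = 0 \<or> k = 1"
  shows "S * (D\<^sup>2 - D) / 2 - D\<^sup>2 - S\<^sup>2 + k * (S * D) \<le> 2/27 * L ^ 3 - 2/3 * L\<^sup>2 + k * (2/9 * L\<^sup>2) + L"
proof -
  define e where "e = D - 2/3 * L"
  have L0: "L \<ge> 0" using assms by simp
  have De: "D = 2/3 * L + e" and Se: "S = L/3 - e" using L by (simp_all add: e_def field_simps)
  have "5 * D \<ge> L" using near L by simp
  then have "L + e \<ge> 8/15 * L" using De by simp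
  then have "e\<^sup>2 * (L + e) \<ge> e\<^sup>2 * (8/15 * L)" by (intro mult_left_mono) auto
  then have h1: "e\<^sup>2 * L + e\<^sup>2 * e \<ge> 8/15 * (e\<^sup>2 * L)" by (simp add: algebra_simps)
  \<comment> \<open>Completed squares for the mixed terms \<open>5/6 L e\<close> of the case
    \<open>k = 1\<close> and \<open>1/2 L e\<close> of the case \<open>k = 0\<close>.\<close>
  have h2: "0 \<le> L * (4/15 * (e + 25/16)\<^sup>2 + (1 - 4/15 * (25/16)\<^sup>2))"
    using L0 by (intro mult_nonneg_nonneg add_nonneg_nonneg) (auto simp: power2_eq_square)
  have h3: "0 \<le> L * (4/15 * (e + 15/16)\<^sup>2 + (1 - 4/15 * (15/16)\<^sup>2))"
    using L0 by (intro mult_nonneg_nonneg add_nonneg_nonneg) (auto simp: power2_eq_square)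
  have e2: "e\<^sup>2 \<ge> 0" by simp
  show ?thesis using k
  proof
    assume "k = 0"
    have "2/27 * L ^ 3 - 2/3 * L\<^sup>2 + L - (S * (D\<^sup>2 - D) / 2 - D\<^sup>2 - S\<^sup>2)
      = (e\<^sup>2 * L + e\<^sup>2 * e) / 2 + L * e / 2 + 3/2 * e\<^sup>2 + L"
      unfolding De Se by (simp add: power2_eq_square power3_eq_cube field_simps)
    moreover have "L * (4/15 * (e + 15/16)\<^sup>2 + (1 - 4/15 * (15/16)\<^sup>2)) = 4/15 * (e\<^sup>2 * L) + L * e / 2 + L"
      by (simp add: power2_eq_square field_simps)
    moreover have "0 \<le> (e\<^sup>2 * L + e\<^sup>2 * e) / 2 + L * e / 2 + 3/2 * e\<^sup>2 + L"
    proof -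
      \<comment> \<open>With the products replaced by variables the inequality is linear.\<close>
      have "0 \<le> (X + Y) / 2 + W / 2 + 3/2 * U + L"
        if "8/15 * X \<le> X + Y" "0 \<le> 4/15 * X + W / 2 + L" "0 \<le> U" for X Y W U :: real
        using that by (simp add: field_simps)
      from this[OF h1 h3[unfolded calculation(2)] e2] show ?thesis .
    qed
    ultimately show ?thesis unfolding \<open>k = 0\<close> by simp
  next
    assume "k = 1"
    have "2/27 * L ^ 3 - 2/3 * L\<^sup>2 + 2/9 * L\<^sup>2 + L - (S * (D\<^sup>2 - D) / 2 - D\<^sup>2 - S\<^sup>2 + S * D)
      = (e\<^sup>2 * L + e\<^sup>2 * e) / 2 + 5 * (L * e) / 6 + 5/2 * e\<^sup>2 + L"
      unfolding De Se by (simp add: power2_eq_square power3_eq_cube field_simps)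
    moreover have "L * (4/15 * (e + 25/16)\<^sup>2 + (1 - 4/15 * (25/16)\<^sup>2)) = 4/15 * (e\<^sup>2 * L) + 5 * (L * e) / 6 + L"
      by (simp add: power2_eq_square field_simps)
    moreover have "0 \<le> (e\<^sup>2 * L + e\<^sup>2 * e) / 2 + 5 * (L * e) / 6 + 5/2 * e\<^sup>2 + L"
    proof -
      have "0 \<le> (X + Y) / 2 + 5 * W / 6 + 5/2 * U + L"
        if "8/15 * X \<le> X + Y" "0 \<le> 4/15 * X + 5 * W / 6 + L" "0 \<le> U" for X Y W U :: real
        using that by (simp add: field_simps)
      from this[OF h1 h2[unfolded calculation(2)] e2] show ?thesis .
    qed
    ultimately show ?thesis unfolding \<open>k = 1\<close> by simp
  qed
qed

lemma real_div_two_le: "real (d * (d - 1) div 2) \<le> ((real d)\<^sup>2 - real d) / 2"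
proof -
  have "2 * (d * (d - 1) div 2) \<le> d * (d - 1)" by simp
  then have "real (2 * (d * (d - 1) div 2)) \<le> real (d * (d - 1))" by (rule of_nat_mono)
  then have "real (d * (d - 1) div 2) \<le> real (d * (d - 1)) / 2" by simp
  also have "real (d * (d - 1)) = (real d)\<^sup>2 - real d"
    by (cases d) (auto simp: power2_eq_square algebra_simps)
  finally show ?thesis .
qed

section \<open>Upper bounds with real exponents\<close>

lemma card_le_powr:
  assumes p: "p > (1::nat)" and "c * p ^ a \<le> p ^ b" and "real b - real a \<le> x"
  shows "real c \<le> real p powr x"
proof -
  have "real (c * p ^ a) \<le> real (p ^ b)" using assms(2) by (rule of_nat_mono)
  then have "real c * real p powr real a \<le> real p powr real b"
    using p by (simp add: powr_realpow)
  then have "real c \<le> real p powr (real b - real a)"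
    using p by (simp add: powr_diff field_simps)
  also have "\<dots> \<le> real p powr x" using p assms(3) by (intro powr_mono) auto
  finally show ?thesis .
qed

text \<open>For \<open>k = 0\<close>, exponent \<open>p\<close>, the powers of a basis carry no
  information; for \<open>k = 1\<close> they contribute \<open>s * d\<close> to the exponent, which
  is \<open>2/9 l^2\<close> at the optimum.\<close>

theorem card_central_exts_powr:
  fixes R :: "('a, 'b) monoid_scheme set" and k :: nat
  assumes p: "prime p" and finR: "finite R"
    and ext: "\<And>G. G \<in> R \<Longrightarrow> central_ext G p d s (Zf G)"
    and niso: "\<And>G H. G \<in> R \<Longrightarrow> H \<in> R \<Longrightarrow> G \<cong> H \<Longrightarrow> G = H"
    and k: "k = 0 \<and> (\<forall>G\<in>R. \<forall>x\<in>carrier G. x [^]\<^bsub>G\<^esub> p = \<one>\<^bsub>G\<^esub>) \<or> k = 1"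
    and l: "l = d + s" "l \<ge> 1"
  shows "real (card R) \<le> real p powr (2/27 * real l ^ 3 - 2/3 * (real l)\<^sup>2 + real k * (2/9 * (real l)\<^sup>2) + 1000 * real l)"
proof -
  interpret W: elab "vg p s" p by (rule elab_vg[OF p])
  define Q where "Q = (if k = 0 then {\<one>\<^bsub>vg p s\<^esub>} else carrier (vg p s))"
  have finQ: "finite Q" using W.fin by (simp add: Q_def)
  have cQ: "card Q = p ^ (k * s)" using k order_vg[of p s] by (auto simp: Q_def order_def)
  have Q: "\<alpha> (x [^]\<^bsub>G\<^esub> p) \<in> Q" if G: "G \<in> R" and fr: "(\<beta>, \<alpha>) \<in> frames p d s G (Zf G)" and x: "x \<in> carrier G" for G \<beta> \<alpha> x
  proof -
    interpret f: framed G p d s "Zf G" \<beta> \<alpha> using ext[OF G] fr by (auto simp: framed_def framed_axioms_def)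
    show ?thesis
    proof (cases "k = 0")
      case True
      then have "x [^]\<^bsub>G\<^esub> p = \<one>\<^bsub>G\<^esub>" using k G x by auto
      moreover have "\<alpha> \<one>\<^bsub>G\<^esub> = \<one>\<^bsub>vg p s\<^esub>"
        using hom_one[OF f.alpha(1) f.subgroup_imp_group[OF f.subZ] W.is_group] by simp
      ultimately show ?thesis using True by (simp add: Q_def)
    qed (use f.alpha_closed[OF f.pow_mem[OF x]] in \<open>simp add: Q_def\<close>)
  qed
  have k01: "real k = 0 \<or> real k = 1" using k by auto
  have k2: "0 \<le> real k * (2/9 * (real l)\<^sup>2)" by simp
  have L: "real l = real d + real s" using l by simp
  show ?thesis
  \<comment> \<open>These are the conditions of \<open>card_central_exts_main\<close> for
    \<open>r = 16\<close>. If they fail, then \<open>d > 4 s\<close>, \<open>s > 4 d\<close> or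
    \<open>d < 32\<close>, and the trivial count is enough.\<close>
  proof (cases "4 * d \<le> 16 * s \<and> 4 * s \<le> 16 * d \<and> 32 \<le> d")
    case False
    have "card R \<le> p ^ (s * (d * (d - 1) div 2) + k * s * d)"
      by (rule card_central_exts_trivial[where Zf = Zf and Q = Q]) (use p finR ext niso finQ Q cQ in blast)+
    then have "card R * p ^ 0 \<le> p ^ (s * (d * (d - 1) div 2) + k * s * d)" by simp
    then show ?thesis
    proof (rule card_le_powr[OF W.p_gt_1])
      have "real s * real (d * (d - 1) div 2) \<le> real s * (((real d)\<^sup>2 - real d) / 2)"
        by (intro mult_left_mono real_div_two_le) simp
      also have "\<dots> \<le> real s * (real d)\<^sup>2 / 2" by (simp add: algebra_simps)
      finally have "real s * real (d * (d - 1) div 2) \<le> real s * (real d)\<^sup>2 / 2" .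
      moreover have "real k * real s * real d \<le> real s * real d" using k01 by auto
      moreover have "real s * (real d)\<^sup>2 / 2 + real s * real d \<le> 2/27 * real l ^ 3 - 2/3 * (real l)\<^sup>2 + 1000 * real l"
      proof (rule exponent_bound_far)
        show "real s \<le> real l / 5 \<or> real d \<le> real l / 5 \<or> real d \<le> 32"
          using False unfolding l by auto
      qed (use L in auto)
      ultimately show "real (s * (d * (d - 1) div 2) + k * s * d) - real 0
        \<le> 2/27 * real l ^ 3 - 2/3 * (real l)\<^sup>2 + real k * (2/9 * (real l)\<^sup>2) + 1000 * real l"
        using k2 unfolding of_nat_add of_nat_mult by linarith
    qed
  next
    case True
    have "card R * p ^ ((d - 1) * d + (s - 1) * s) \<le>
      p ^ ((d + s) * (2 * 16) + s * ((d - 2 * 16) * (d - 2 * 16 - 1) div 2) + k * s * d + (2 * 16 * d * s + 2 * d + 2 * s + 2))"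
      by (rule card_central_exts_main[where Zf = Zf and Q = Q]) (use p finR ext niso finQ Q cQ True in \<open>blast | simp\<close>)+
    then show ?thesis
    proof (rule card_le_powr[OF W.p_gt_1])
      have sq: "real ((n - 1) * n) = (real n)\<^sup>2 - real n" for n :: nat
        by (cases n) (auto simp: power2_eq_square algebra_simps)
      have a: "real ((d - 1) * d + (s - 1) * s) = (real d)\<^sup>2 - real d + (real s)\<^sup>2 - real s"
        using sq[of d] sq[of s] by simp
      have d32: "real (d - 2 * 16) = real d - 32" using True by (simp add: of_nat_diff)
      \<comment> \<open>Leaving out 32 rows saves \<open>32 d s\<close>, exactly what the sum over
        intertwiners brings in; \<open>528 = 32 * 33 / 2\<close> is the redundancy of the rows kept
        as whole maps.\<close>
      have "real s * real ((d - 2 * 16) * (d - 2 * 16 - 1) div 2) \<le> real s * (((real d - 32)\<^sup>2 - (real d - 32)) / 2)"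
        using real_div_two_le[of "d - 2 * 16"] unfolding d32 by (intro mult_left_mono) auto
      also have "\<dots> = real s * ((real d)\<^sup>2 - real d) / 2 - 32 * (real d * real s) + 528 * real s"
        by (simp add: power2_eq_square field_simps)
      finally have b: "real s * real ((d - 2 * 16) * (d - 2 * 16 - 1) div 2)
        \<le> real s * ((real d)\<^sup>2 - real d) / 2 - 32 * (real d * real s) + 528 * real s" .
      have n: "real s * ((real d)\<^sup>2 - real d) / 2 - (real d)\<^sup>2 - (real s)\<^sup>2 + real k * (real s * real d)
        \<le> 2/27 * real l ^ 3 - 2/3 * (real l)\<^sup>2 + real k * (2/9 * (real l)\<^sup>2) + real l"
        by (rule exponent_bound_near) (use L k01 True in auto)
      have e: "real ((d + s) * (2 * 16) + s * ((d - 2 * 16) * (d - 2 * 16 - 1) div 2) + k * s * d + (2 * 16 * d * s + 2 * d + 2 * s + 2))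
        = 32 * real l + real s * real ((d - 2 * 16) * (d - 2 * 16 - 1) div 2) + real k * (real s * real d)
          + 32 * (real d * real s) + 2 * real d + 2 * real s + 2"
        using L by (simp del: of_nat_diff)
      show "real ((d + s) * (2 * 16) + s * ((d - 2 * 16) * (d - 2 * 16 - 1) div 2) + k * s * d + (2 * 16 * d * s + 2 * d + 2 * s + 2))
        - real ((d - 1) * d + (s - 1) * s)
        \<le> 2/27 * real l ^ 3 - 2/3 * (real l)\<^sup>2 + real k * (2/9 * (real l)\<^sup>2) + 1000 * real l"
        unfolding e a using b n L l(2) by linarith
    qed
  qed
qed

text \<open>The parameter \<open>d\<close> varies with the group. Summing over it costs a factor
  \<open>l + 1\<close>, at most \<open>p ^ l\<close>, which raises the constant from 1000 to
  1001.\<close>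

lemma card_reps_powr:
  fixes R :: "('a, 'b) monoid_scheme set" and k :: nat
  assumes p: "prime p" and finR: "finite R"
    and ext: "\<And>G. G \<in> R \<Longrightarrow> \<exists>d\<le>l. central_ext G p d (l - d) (Zf G)"
    and niso: "\<And>G H. G \<in> R \<Longrightarrow> H \<in> R \<Longrightarrow> G \<cong> H \<Longrightarrow> G = H"
    and k: "k = 0 \<and> (\<forall>G\<in>R. \<forall>x\<in>carrier G. x [^]\<^bsub>G\<^esub> p = \<one>\<^bsub>G\<^esub>) \<or> k = 1"
    and l: "l \<ge> 1"
  shows "real (card R) \<le> real p powr (2/27 * real l ^ 3 - 2/3 * (real l)\<^sup>2 + real k * (2/9 * (real l)\<^sup>2) + 1001 * real l)"
proof -
  define B where "B = 2/27 * real l ^ 3 - 2/3 * (real l)\<^sup>2 + real k * (2/9 * (real l)\<^sup>2) + 1000 * real l"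
  have p1: "p > 1" by (rule prime_gt_1_nat[OF p])
  define Rd where "Rd = (\<lambda>d. {G \<in> R. central_ext G p d (l - d) (Zf G)})"
  have "R = (\<Union>d\<le>l. Rd d)" using ext unfolding Rd_def by blast
  then have "card R \<le> (\<Sum>d\<le>l. card (Rd d))" by (metis card_UN_le finite_atMost)
  then have "real (card R) \<le> (\<Sum>d\<le>l. real (card (Rd d)))" by (metis of_nat_le_iff of_nat_sum)
  also have "\<dots> \<le> (\<Sum>d\<le>l. real p powr B)"
  proof (rule sum_mono)
    fix d assume "d \<in> {..l}"
    then have "l = d + (l - d)" by simp
    then show "real (card (Rd d)) \<le> real p powr B" unfolding B_def
      by (intro card_central_exts_powr[where Zf = Zf and s = "l - d"])
        (use p finR niso k l in \<open>auto simp: Rd_def\<close>)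
  qed
  also have "\<dots> = real (l + 1) * real p powr B" by simp
  also have "\<dots> \<le> real p powr real l * real p powr B"
  proof (rule mult_right_mono)
    have "l + 1 \<le> 2 ^ l" by (simp add: Suc_leI)
    also have "(2::nat) ^ l \<le> p ^ l" using p1 by (intro power_mono) auto
    finally have "real (l + 1) \<le> real (p ^ l)" by (rule of_nat_mono)
    then show "real (l + 1) \<le> real p powr real l" using p1 by (simp add: powr_realpow)
  qed simp
  also have "\<dots> = real p powr (2/27 * real l ^ 3 - 2/3 * (real l)\<^sup>2 + real k * (2/9 * (real l)\<^sup>2) + 1001 * real l)"
    unfolding powr_add[symmetric] by (rule arg_cong[of _ _ "\<lambda>x. real p powr x"]) (simp add: B_def)
  finally show ?thesis .
qed

lemma num_iso_classes_powr:
  assumes "\<And>R. finite R \<Longrightarrow> R \<subseteq> groups_of_order P n \<Longrightarrow>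
    (\<And>G H. G \<in> R \<Longrightarrow> H \<in> R \<Longrightarrow> G \<cong> H \<Longrightarrow> G = H) \<Longrightarrow> real (card R) \<le> b"
  shows "finite (groups_of_order P n // iso_rel P n)" "real (num_iso_classes P n) \<le> b"
proof -
  have b: "b \<ge> 0" using assms[of "{}"] by simp
  have *: "card R \<le> nat \<lfloor>b\<rfloor>" if "finite R" "R \<subseteq> groups_of_order P n"
    "\<And>G H. G \<in> R \<Longrightarrow> H \<in> R \<Longrightarrow> G \<cong> H \<Longrightarrow> G = H" for R
    using assms[OF that] by (simp add: le_nat_floor)
  show "finite (groups_of_order P n // iso_rel P n)" by (rule num_iso_classes_le(1)[OF *])
  have "num_iso_classes P n \<le> nat \<lfloor>b\<rfloor>" by (rule num_iso_classes_le(2)[OF *])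
  then show "real (num_iso_classes P n) \<le> b" using b by linarith
qed

lemma f_B_upper:
  assumes p: "prime p" and l: "l \<ge> 1"
  shows "finite (groups_of_order (class_B p) (p ^ l) // iso_rel (class_B p) (p ^ l))"
    "real (f_B p (p ^ l)) \<le> real p powr (2/27 * real l ^ 3 - 2/3 * real l ^ 2 + 1001 * real l)"
proof -
  have *: "real (card R) \<le> real p powr (2/27 * real l ^ 3 - 2/3 * real l ^ 2 + 1001 * real l)"
    if R: "finite R" "R \<subseteq> groups_of_order (class_B p) (p ^ l)"
      "\<And>G H. G \<in> R \<Longrightarrow> H \<in> R \<Longrightarrow> G \<cong> H \<Longrightarrow> G = H" for R
  proof -
    have "real (card R) \<le> real p powr (2/27 * real l ^ 3 - 2/3 * real l ^ 2 + real 0 * (2/9 * (real l)\<^sup>2) + 1001 * real l)"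
    proof (rule card_reps_powr[where Zf = group_center, OF p R(1) _ _ _ l])
      fix G assume "G \<in> R"
      then have "class_B p G" "order G = p ^ l" using R(2) by (auto simp: groups_of_order_def)
      then show "\<exists>d\<le>l. central_ext G p d (l - d) (group_center G)" by (rule class_B_central_ext[OF p])
    next
      show "0 = 0 \<and> (\<forall>G\<in>R. \<forall>x\<in>carrier G. x [^]\<^bsub>G\<^esub> p = \<one>\<^bsub>G\<^esub>) \<or> 0 = (1::nat)"
        using R(2) by (auto simp: groups_of_order_def class_B_def)
    qed (use R(3) in blast)
    then show ?thesis by simp
  qed
  show "finite (groups_of_order (class_B p) (p ^ l) // iso_rel (class_B p) (p ^ l))"
    by (rule num_iso_classes_powr(1)[OF *])
  show "real (f_B p (p ^ l)) \<le> real p powr (2/27 * real l ^ 3 - 2/3 * real l ^ 2 + 1001 * real l)"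
    unfolding f_B_def by (rule num_iso_classes_powr(2)[OF *])
qed

lemma f_H_upper:
  assumes p: "prime p" and l: "l \<ge> 1"
  shows "finite (groups_of_order (class_H p) (p ^ l) // iso_rel (class_H p) (p ^ l))"
    "real (f_H p (p ^ l)) \<le> real p powr (2/27 * real l ^ 3 - 4/9 * real l ^ 2 + 1001 * real l)"
proof -
  have *: "real (card R) \<le> real p powr (2/27 * real l ^ 3 - 4/9 * real l ^ 2 + 1001 * real l)"
    if R: "finite R" "R \<subseteq> groups_of_order (class_H p) (p ^ l)"
      "\<And>G H. G \<in> R \<Longrightarrow> H \<in> R \<Longrightarrow> G \<cong> H \<Longrightarrow> G = H" for R
  proof -
    have "real (card R) \<le> real p powr (2/27 * real l ^ 3 - 2/3 * real l ^ 2 + real 1 * (2/9 * (real l)\<^sup>2) + 1001 * real l)"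
    proof (rule card_reps_powr[where Zf = frattini, OF p R(1) _ _ _ l])
      fix G assume "G \<in> R"
      then have "class_H p G" "order G = p ^ l" using R(2) by (auto simp: groups_of_order_def)
      then show "\<exists>d\<le>l. central_ext G p d (l - d) (frattini G)" by (rule class_H_central_ext[OF p])
    qed (use R(3) in auto)
    then show ?thesis by simp
  qed
  show "finite (groups_of_order (class_H p) (p ^ l) // iso_rel (class_H p) (p ^ l))"
    by (rule num_iso_classes_powr(1)[OF *])
  show "real (f_H p (p ^ l)) \<le> real p powr (2/27 * real l ^ 3 - 4/9 * real l ^ 2 + 1001 * real l)"
    unfolding f_H_def by (rule num_iso_classes_powr(2)[OF *])
qed

section \<open>Twisted products\<close>

text \<open>The central extension of \<open>vg p d\<close> by \<open>vg p s\<close> with 2-cocycle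
  \<open>\<omega>\<close>; its values are natural numbers, reduced modulo \<open>p\<close> only
  inside the product.\<close>

definition twisted :: "nat \<Rightarrow> nat \<Rightarrow> nat \<Rightarrow> ((nat \<Rightarrow> nat) \<Rightarrow> (nat \<Rightarrow> nat) \<Rightarrow> nat \<Rightarrow> nat) \<Rightarrow> ((nat \<Rightarrow> nat) \<times> (nat \<Rightarrow> nat)) monoid" where
  "twisted p d s \<omega> = \<lparr>carrier = carrier (vg p d) \<times> carrier (vg p s),
     monoid.mult = (\<lambda>(a, b) (a', b'). (a \<otimes>\<^bsub>vg p d\<^esub> a', \<lambda>k\<in>{..<s}. (b k + b' k + \<omega> a a' k) mod p)),
     one = (\<one>\<^bsub>vg p d\<^esub>, \<one>\<^bsub>vg p s\<^esub>)\<rparr>"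

lemma mod_add_inner:
  fixes p :: nat
  shows "(x mod p + y + z) mod p = (x + y + z) mod p" "(y + x mod p + z) mod p = (y + x + z) mod p"
  by (metis add.assoc mod_add_left_eq, metis add.assoc add.commute mod_add_left_eq)

locale twisted_group =
  fixes p d s :: nat and \<omega> :: "(nat \<Rightarrow> nat) \<Rightarrow> (nat \<Rightarrow> nat) \<Rightarrow> nat \<Rightarrow> nat"
  assumes prime_p: "prime p"
    and cocycle: "\<And>a b c k. a \<in> carrier (vg p d) \<Longrightarrow> b \<in> carrier (vg p d) \<Longrightarrow> c \<in> carrier (vg p d) \<Longrightarrow>
      [\<omega> a b k + \<omega> (a \<otimes>\<^bsub>vg p d\<^esub> b) c k = \<omega> b c k + \<omega> a (b \<otimes>\<^bsub>vg p d\<^esub> c) k] (mod p)"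
    and normalized: "\<And>a k. a \<in> carrier (vg p d) \<Longrightarrow> \<omega> a \<one>\<^bsub>vg p d\<^esub> k = 0"
      "\<And>a k. a \<in> carrier (vg p d) \<Longrightarrow> \<omega> \<one>\<^bsub>vg p d\<^esub> a k = 0"
begin

abbreviation E where "E \<equiv> twisted p d s \<omega>"

definition incl_W :: "(nat \<Rightarrow> nat) \<Rightarrow> (nat \<Rightarrow> nat) \<times> (nat \<Rightarrow> nat)" where
  "incl_W b = (\<one>\<^bsub>vg p d\<^esub>, b)"

lemma p_gt_1: "p > 1" using prime_gt_1_nat[OF prime_p] .

sublocale V: elab "vg p d" p by (rule elab_vg[OF prime_p])
sublocale W: elab "vg p s" p by (rule elab_vg[OF prime_p])

lemma carrier_E: "carrier E = carrier (vg p d) \<times> carrier (vg p s)"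
  by (simp add: twisted_def)

lemma mult_E: "(a, b) \<otimes>\<^bsub>E\<^esub> (a', b') = (a \<otimes>\<^bsub>vg p d\<^esub> a', \<lambda>k\<in>{..<s}. (b k + b' k + \<omega> a a' k) mod p)"
  by (simp add: twisted_def)

lemma one_E: "\<one>\<^bsub>E\<^esub> = (\<one>\<^bsub>vg p d\<^esub>, \<one>\<^bsub>vg p s\<^esub>)"
  by (simp add: twisted_def)

lemma order_E: "order E = p ^ (d + s)"
  using order_vg[of p d] order_vg[of p s] by (simp add: order_def carrier_E card_cartesian_product power_add)

lemma mod_W: "(\<lambda>k\<in>{..<s}. f k mod p) \<in> carrier (vg p s)"
  using p_gt_1 by (auto simp: carrier_vg)

lemma W_mod: "b \<in> carrier (vg p s) \<Longrightarrow> (\<lambda>k\<in>{..<s}. b k mod p) = b"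
  by (rule vg_eqI[OF mod_W]) (auto simp: carrier_vg PiE_iff)

lemma group_E: "group E"
proof (rule groupI)
  show "x \<otimes>\<^bsub>E\<^esub> y \<in> carrier E" if "x \<in> carrier E" "y \<in> carrier E" for x y
    using that mod_W by (auto simp: carrier_E mult_E)
  show "\<one>\<^bsub>E\<^esub> \<in> carrier E" by (simp add: carrier_E one_E)
  show "x \<otimes>\<^bsub>E\<^esub> y \<otimes>\<^bsub>E\<^esub> z = x \<otimes>\<^bsub>E\<^esub> (y \<otimes>\<^bsub>E\<^esub> z)" if "x \<in> carrier E" "y \<in> carrier E" "z \<in> carrier E" for x y z
  proof -
    obtain a b a' b' a'' b'' where e: "x = (a, b)" "y = (a', b')" "z = (a'', b'')" by (metis surj_pair)
    have c: "a \<in> carrier (vg p d)" "a' \<in> carrier (vg p d)" "a'' \<in> carrier (vg p d)" using that e by (auto simp: carrier_E)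
    have "((b k + b' k + \<omega> a a' k) mod p + b'' k + \<omega> (a \<otimes>\<^bsub>vg p d\<^esub> a') a'' k) mod p
      = (b k + (b' k + b'' k + \<omega> a' a'' k) mod p + \<omega> a (a' \<otimes>\<^bsub>vg p d\<^esub> a'') k) mod p" for k
    proof -
      have "((b k + b' k + \<omega> a a' k) mod p + b'' k + \<omega> (a \<otimes>\<^bsub>vg p d\<^esub> a') a'' k) mod p
        = (b k + b' k + b'' k + (\<omega> a a' k + \<omega> (a \<otimes>\<^bsub>vg p d\<^esub> a') a'' k)) mod p"
        unfolding mod_add_inner by (simp add: ac_simps)
      also have "\<dots> = (b k + b' k + b'' k + (\<omega> a' a'' k + \<omega> a (a' \<otimes>\<^bsub>vg p d\<^esub> a'') k)) mod p"
        using cocycle[OF c, of k] unfolding cong_def by (metis mod_add_right_eq)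
      also have "\<dots> = (b k + (b' k + b'' k + \<omega> a' a'' k) mod p + \<omega> a (a' \<otimes>\<^bsub>vg p d\<^esub> a'') k) mod p"
        unfolding mod_add_inner by (simp add: ac_simps)
      finally show ?thesis .
    qed
    then show ?thesis using c by (auto simp: e mult_E V.m_assoc intro!: restrict_ext)
  qed
  show "\<one>\<^bsub>E\<^esub> \<otimes>\<^bsub>E\<^esub> x = x" if "x \<in> carrier E" for x
  proof -
    obtain a b where e: "x = (a, b)" by (cases x)
    have c: "a \<in> carrier (vg p d)" "b \<in> carrier (vg p s)" using that e by (auto simp: carrier_E)
    have "(\<lambda>k\<in>{..<s}. (\<one>\<^bsub>vg p s\<^esub> k + b k + \<omega> \<one>\<^bsub>vg p d\<^esub> a k) mod p) = (\<lambda>k\<in>{..<s}. b k mod p)"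
      using c by (auto simp: one_vg normalized(2)[unfolded one_vg] intro!: restrict_ext)
    then show ?thesis using c W_mod by (simp add: e one_E mult_E)
  qed
  show "\<exists>y\<in>carrier E. y \<otimes>\<^bsub>E\<^esub> x = \<one>\<^bsub>E\<^esub>" if "x \<in> carrier E" for x
  proof -
    obtain a b where e: "x = (a, b)" by (cases x)
    have c: "a \<in> carrier (vg p d)" "b \<in> carrier (vg p s)" using that e by (auto simp: carrier_E)
    let ?a = "inv\<^bsub>vg p d\<^esub> a"
    \<comment> \<open>Multiplication by \<open>p - 1\<close> is negation modulo
      \<open>p\<close>.\<close>
    let ?b = "\<lambda>k\<in>{..<s}. ((p - 1) * (b k + \<omega> ?a a k)) mod p"
    have "((p - 1) * (b k + \<omega> ?a a k) mod p + b k + \<omega> ?a a k) mod p = 0" for k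
    proof -
      have "((p - 1) * (b k + \<omega> ?a a k) mod p + b k + \<omega> ?a a k) mod p = (p * (b k + \<omega> ?a a k)) mod p"
        unfolding mod_add_inner using p_gt_1 by (cases p) (simp_all add: ac_simps)
      also have "\<dots> = 0" by simp
      finally show ?thesis .
    qed
    then have "(?a, ?b) \<otimes>\<^bsub>E\<^esub> x = \<one>\<^bsub>E\<^esub>" using c by (auto simp: e mult_E one_E one_vg[of p s] intro!: restrict_ext)
    moreover have "(?a, ?b) \<in> carrier E" using c mod_W by (simp add: carrier_E)
    ultimately show ?thesis by blast
  qed
qed

sublocale E: group E by (rule group_E)

lemma finite_E: "finite (carrier E)"
  using V.fin W.fin by (simp add: carrier_E)

lemma fst_hom: "fst \<in> hom E (vg p d)"
  by (rule homI) (auto simp: carrier_E mult_E)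

lemma incl_W_mult:
  assumes "a \<in> carrier (vg p d)"
  shows "incl_W w \<otimes>\<^bsub>E\<^esub> (a, b) = (a, w \<otimes>\<^bsub>vg p s\<^esub> b)" "(a, b) \<otimes>\<^bsub>E\<^esub> incl_W w = (a, w \<otimes>\<^bsub>vg p s\<^esub> b)"
  using assms normalized by (auto simp: incl_W_def mult_E mult_vg[of p s] ac_simps intro!: restrict_ext)

lemma incl_W_closed: "w \<in> carrier (vg p s) \<Longrightarrow> incl_W w \<in> carrier E"
  by (simp add: incl_W_def carrier_E)

lemma incl_W_hom: "incl_W \<in> hom (vg p s) E"
proof (rule homI)
  show "incl_W (u \<otimes>\<^bsub>vg p s\<^esub> w) = incl_W u \<otimes>\<^bsub>E\<^esub> incl_W w" for u w
    using incl_W_mult(1)[OF V.one_closed, of u w] by (simp add: incl_W_def)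
qed (rule incl_W_closed)

lemma incl_W_central: "w \<in> carrier (vg p s) \<Longrightarrow> x \<in> carrier E \<Longrightarrow> incl_W w \<otimes>\<^bsub>E\<^esub> x = x \<otimes>\<^bsub>E\<^esub> incl_W w"
  using incl_W_mult by (cases x) (simp add: carrier_E)

lemma incl_W_pow: "w \<in> carrier (vg p s) \<Longrightarrow> incl_W w [^]\<^bsub>E\<^esub> p = \<one>\<^bsub>E\<^esub>"
  using hom_nat_pow[OF incl_W_hom, of w p] W.pow_p[of w] W.is_group group_E by (simp add: incl_W_def one_E)

lemma fst_one: "x \<in> carrier E \<Longrightarrow> fst x = \<one>\<^bsub>vg p d\<^esub> \<Longrightarrow> x = incl_W (snd x) \<and> snd x \<in> carrier (vg p s)"
  by (cases x) (auto simp: carrier_E incl_W_def)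

lemma same_fst:
  assumes "x \<in> carrier E" "y \<in> carrier E" "fst x = fst y"
  obtains w where "w \<in> carrier (vg p s)" "x = y \<otimes>\<^bsub>E\<^esub> incl_W w"
proof -
  interpret f: group_hom E "vg p d" fst using fst_hom by unfold_locales
  have "fst (inv\<^bsub>E\<^esub> y \<otimes>\<^bsub>E\<^esub> x) = \<one>\<^bsub>vg p d\<^esub>" using assms f.hom_closed by simp
  then have "inv\<^bsub>E\<^esub> y \<otimes>\<^bsub>E\<^esub> x = incl_W (snd (inv\<^bsub>E\<^esub> y \<otimes>\<^bsub>E\<^esub> x))" "snd (inv\<^bsub>E\<^esub> y \<otimes>\<^bsub>E\<^esub> x) \<in> carrier (vg p s)"
    using fst_one[of "inv\<^bsub>E\<^esub> y \<otimes>\<^bsub>E\<^esub> x"] assms by auto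
  moreover have "x = y \<otimes>\<^bsub>E\<^esub> (inv\<^bsub>E\<^esub> y \<otimes>\<^bsub>E\<^esub> x)" using assms by (simp flip: E.m_assoc)
  ultimately show ?thesis using that by metis
qed

end

section \<open>Cocycles from structure constants\<close>

definition pairs :: "nat \<Rightarrow> (nat \<times> nat) set" where
  "pairs d = {(i, j). i < j \<and> j < d}"

text \<open>
  \<open>(a i + b i) div p\<close> is the carry in the addition of the \<open>i\<close>-th exponents; because of it the \<open>p\<close>-th
  power of the \<open>i\<close>-th generator is \<open>e i\<close>. For \<open>i < j\<close>, \<open>c (i, j)\<close> is the commutator of the generators
  \<open>j\<close> and \<open>i\<close>, in this order.
\<close>

definition sc_cocycle where
  "sc_cocycle p d c e a b k =
    (\<Sum>(i, j)\<in>pairs d. a j * b i * c (i, j) k) + (\<Sum>i<d. e i k * ((a i + b i) div (p :: nat)))"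

lemma finite_pairs: "finite (pairs d)"
  by (rule finite_subset[of _ "{..<d} \<times> {..<d}"]) (auto simp: pairs_def)

text \<open>The total carry of a threefold sum does not depend on the bracketing: this is the
  cocycle identity for carries.\<close>

lemma carry_assoc: "(x + y) div p + ((x + y) mod p + z) div p = (x + y + z) div (p :: nat)"
proof (cases "p = 0")
  case False
  have "(x + y + z) div p = (((x + y) mod p + z) + p * ((x + y) div p)) div p"
    by (simp add: algebra_simps)
  also have "\<dots> = (x + y) div p + ((x + y) mod p + z) div p"
    using False by (subst div_mult_self2) simp_all
  finally show ?thesis by simp
qed simp

lemma cong_bilinear:
  fixes p :: nat
  shows "[(\<Sum>(i, j)\<in>pairs d. (a \<otimes>\<^bsub>vg p d\<^esub> b) j * c i * f (i, j) k)
      = (\<Sum>(i, j)\<in>pairs d. a j * c i * f (i, j) k) + (\<Sum>(i, j)\<in>pairs d. b j * c i * f (i, j) k)] (mod p)"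
    "[(\<Sum>(i, j)\<in>pairs d. c j * (a \<otimes>\<^bsub>vg p d\<^esub> b) i * f (i, j) k)
      = (\<Sum>(i, j)\<in>pairs d. c j * a i * f (i, j) k) + (\<Sum>(i, j)\<in>pairs d. c j * b i * f (i, j) k)] (mod p)"
proof -
  have m: "[(a \<otimes>\<^bsub>vg p d\<^esub> b) i = a i + b i] (mod p)" if "i < d" for i
    using that by (simp add: mult_vg cong_def)
  have d1: "[(a \<otimes>\<^bsub>vg p d\<^esub> b) j * c i * f (i, j) k = a j * c i * f (i, j) k + b j * c i * f (i, j) k] (mod p)"
    and d2: "[c j * (a \<otimes>\<^bsub>vg p d\<^esub> b) i * f (i, j) k = c j * a i * f (i, j) k + c j * b i * f (i, j) k] (mod p)"
    if "(i, j) \<in> pairs d" for i j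
  proof -
    have ij: "i < d" "j < d" using that by (auto simp: pairs_def)
    have "[(a \<otimes>\<^bsub>vg p d\<^esub> b) j * c i * f (i, j) k = (a j + b j) * c i * f (i, j) k] (mod p)"
      by (intro cong_scalar_right m ij)
    then show "[(a \<otimes>\<^bsub>vg p d\<^esub> b) j * c i * f (i, j) k = a j * c i * f (i, j) k + b j * c i * f (i, j) k] (mod p)"
      by (simp add: add_mult_distrib)
    have "[c j * (a \<otimes>\<^bsub>vg p d\<^esub> b) i * f (i, j) k = c j * (a i + b i) * f (i, j) k] (mod p)"
      by (intro cong_scalar_right cong_scalar_left m ij)
    then show "[c j * (a \<otimes>\<^bsub>vg p d\<^esub> b) i * f (i, j) k = c j * a i * f (i, j) k + c j * b i * f (i, j) k] (mod p)"
      by (simp add: add_mult_distrib add_mult_distrib2)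
  qed
  have "[(\<Sum>(i, j)\<in>pairs d. (a \<otimes>\<^bsub>vg p d\<^esub> b) j * c i * f (i, j) k)
      = (\<Sum>(i, j)\<in>pairs d. a j * c i * f (i, j) k + b j * c i * f (i, j) k)] (mod p)"
    by (rule cong_sum) (use d1 d2 in auto)
  then show "[(\<Sum>(i, j)\<in>pairs d. (a \<otimes>\<^bsub>vg p d\<^esub> b) j * c i * f (i, j) k)
      = (\<Sum>(i, j)\<in>pairs d. a j * c i * f (i, j) k) + (\<Sum>(i, j)\<in>pairs d. b j * c i * f (i, j) k)] (mod p)"
    by (simp add: case_prod_beta sum.distrib)
  have "[(\<Sum>(i, j)\<in>pairs d. c j * (a \<otimes>\<^bsub>vg p d\<^esub> b) i * f (i, j) k)
      = (\<Sum>(i, j)\<in>pairs d. c j * a i * f (i, j) k + c j * b i * f (i, j) k)] (mod p)"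
    by (rule cong_sum) (use d1 d2 in auto)
  then show "[(\<Sum>(i, j)\<in>pairs d. c j * (a \<otimes>\<^bsub>vg p d\<^esub> b) i * f (i, j) k)
      = (\<Sum>(i, j)\<in>pairs d. c j * a i * f (i, j) k) + (\<Sum>(i, j)\<in>pairs d. c j * b i * f (i, j) k)] (mod p)"
    by (simp add: case_prod_beta sum.distrib)
qed

text \<open>The bilinear part satisfies the cocycle identity modulo \<open>p\<close>, as coordinates
  are reduced; the carry part satisfies it exactly. Carries prescribe the \<open>p\<close>-th powers
  for every prime, including 2.\<close>

lemma twisted_sc:
  assumes p: "prime p"
  shows "twisted_group p d (sc_cocycle p d c e)"
proof
  show "prime p" by fact
  have p0: "p > 1" by (rule prime_gt_1_nat[OF p])
  have lt: "a i < p" if "a \<in> carrier (vg p d)" "i < d" for a i using that by (auto simp: carrier_vg PiE_iff)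
  fix a b f k assume V: "a \<in> carrier (vg p d)" "b \<in> carrier (vg p d)" "f \<in> carrier (vg p d)"
  let ?B = "\<lambda>a b. \<Sum>(i, j)\<in>pairs d. a j * b i * c (i, j) k"
  let ?C = "\<lambda>a b. \<Sum>i<d. e i k * ((a i + b i) div p)"
  have C: "?C a b + ?C (a \<otimes>\<^bsub>vg p d\<^esub> b) f = ?C b f + ?C a (b \<otimes>\<^bsub>vg p d\<^esub> f)"
  proof -
    have "(a i + b i) div p + ((a \<otimes>\<^bsub>vg p d\<^esub> b) i + f i) div p = (b i + f i) div p + (a i + (b \<otimes>\<^bsub>vg p d\<^esub> f) i) div p"
      if "i < d" for i
      using that carry_assoc[of "a i" "b i" p "f i"] carry_assoc[of "b i" "f i" p "a i"]
      by (simp add: mult_vg ac_simps)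
    then show ?thesis by (simp flip: sum.distrib add_mult_distrib2)
  qed
  have "[?B a b + ?B (a \<otimes>\<^bsub>vg p d\<^esub> b) f = ?B a b + (?B a f + ?B b f)] (mod p)"
    by (intro cong_add cong_refl cong_bilinear(1))
  also have "?B a b + (?B a f + ?B b f) = ?B b f + (?B a b + ?B a f)" by simp
  also have "[?B b f + (?B a b + ?B a f) = ?B b f + ?B a (b \<otimes>\<^bsub>vg p d\<^esub> f)] (mod p)"
    by (intro cong_add cong_refl cong_sym[OF cong_bilinear(2)])
  finally have R: "[?B a b + ?B (a \<otimes>\<^bsub>vg p d\<^esub> b) f = ?B b f + ?B a (b \<otimes>\<^bsub>vg p d\<^esub> f)] (mod p)" .
  have "[(?B a b + ?B (a \<otimes>\<^bsub>vg p d\<^esub> b) f) + (?C a b + ?C (a \<otimes>\<^bsub>vg p d\<^esub> b) f)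
    = (?B b f + ?B a (b \<otimes>\<^bsub>vg p d\<^esub> f)) + (?C b f + ?C a (b \<otimes>\<^bsub>vg p d\<^esub> f))] (mod p)"
    unfolding C by (rule cong_add[OF R cong_refl])
  then show "[sc_cocycle p d c e a b k + sc_cocycle p d c e (a \<otimes>\<^bsub>vg p d\<^esub> b) f k
    = sc_cocycle p d c e b f k + sc_cocycle p d c e a (b \<otimes>\<^bsub>vg p d\<^esub> f) k] (mod p)"
    unfolding sc_cocycle_def by (simp only: ac_simps)
next
  fix a k assume a: "a \<in> carrier (vg p d)"
  have lt: "a i < p" if "i < d" for i using that a by (auto simp: carrier_vg PiE_iff)
  show "sc_cocycle p d c e a \<one>\<^bsub>vg p d\<^esub> k = 0" "sc_cocycle p d c e \<one>\<^bsub>vg p d\<^esub> a k = 0"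
    using lt by (auto simp: sc_cocycle_def one_vg pairs_def intro!: sum.neutral)
qed

section \<open>Recognising the two classes\<close>

text \<open>The kernel of a coordinate of \<open>\<beta>\<close> is a maximal subgroup as soon as it
  is proper, so the Frattini subgroup lies in the kernel of \<open>\<beta>\<close>.\<close>

lemma class_H_criterion:
  fixes G (structure)
  assumes "group G" and p: "prime p" and ord: "order G = p ^ l"
    and \<beta>: "\<beta> \<in> hom G (vg p d)"
    and ker: "\<And>x. x \<in> carrier G \<Longrightarrow> \<beta> x = \<one>\<^bsub>vg p d\<^esub> \<Longrightarrow> x \<in> group_center G \<and> x [^] p = \<one>"
  shows "class_H p G"
proof -
  interpret group G by fact
  interpret V: elab "vg p d" p by (rule elab_vg[OF p])
  interpret b: group_hom G "vg p d" \<beta> using \<beta> by unfold_locales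
  have fin: "finite (carrier G)" using ord V.p_gt_1 order_gt_0_iff_finite by simp
  have sub: "frattini G \<subseteq> {x \<in> carrier G. \<beta> x = \<one>\<^bsub>vg p d\<^esub>}"
  proof
    fix x assume x: "x \<in> frattini G"
    then have xc: "x \<in> carrier G" by (simp add: frattini_def)
    have "\<beta> x = \<one>\<^bsub>vg p d\<^esub>"
    proof (rule ccontr)
      assume "\<beta> x \<noteq> \<one>\<^bsub>vg p d\<^esub>"
      then obtain i where i: "i < d" "\<beta> x i \<noteq> 0"
        using vg_eqI[OF b.hom_closed[OF xc] V.one_closed] by (auto simp: one_vg)
      define M where "M = {y \<in> carrier G. \<beta> y i = 0}"
      have M: "subgroup M G"
      proof (rule finite_closed_subgroup[OF fin])
        show "M \<noteq> {}" using i by (auto simp: M_def one_vg intro!: exI[of _ \<one>])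
        show "a \<otimes> b \<in> M" if "a \<in> M" "b \<in> M" for a b using that i by (auto simp: M_def mult_vg)
      qed (auto simp: M_def)
      have xM: "x \<notin> M" using i by (simp add: M_def)
      have "H = M \<or> H = carrier G" if H: "subgroup H G" "M \<subseteq> H" for H
      proof (cases "H = M")
        case False
        then obtain y where y: "y \<in> H" "y \<notin> M" using H(2) by blast
        have yc: "y \<in> carrier G" using y(1) H(1) by (simp add: subgroup.mem_carrier)
        have "\<beta> y i < p" using b.hom_closed[OF yc] i by (auto simp: carrier_vg PiE_iff)
        moreover have "\<beta> y i > 0" using y yc by (simp add: M_def)
        ultimately have "coprime (\<beta> y i) p"
          using p by (metis coprime_commute nat_dvd_not_less prime_imp_coprime)
        then obtain c where c: "[\<beta> y i * c = Suc 0] (mod p)" using cong_solve_coprime_nat by blast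
        have "g \<in> H" if g: "g \<in> carrier G" for g
        proof -
          \<comment> \<open>As \<open>c\<close> inverts the \<open>i\<close>-th coordinate of
            \<open>y\<close> modulo \<open>p\<close>, the power \<open>y [^] n\<close> cancels the
            \<open>i\<close>-th coordinate of \<open>g\<close> and brings \<open>g\<close> into
            \<open>M\<close>.\<close>
          define n where "n = c * (p - \<beta> g i)"
          have gi: "\<beta> g i < p" using b.hom_closed[OF g] i by (auto simp: carrier_vg PiE_iff)
          have "[\<beta> g i + n * \<beta> y i = \<beta> g i + Suc 0 * (p - \<beta> g i)] (mod p)"
            using cong_scalar_right[OF c, of "p - \<beta> g i"] unfolding n_def
            by (intro cong_add cong_refl) (simp add: ac_simps)
          then have z: "(\<beta> g i + n * \<beta> y i) mod p = 0" using gi by (simp add: cong_def)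
          have "\<beta> (g \<otimes> y [^] n) i = (\<beta> g i + n * \<beta> y i) mod p"
            using g yc i V.p_gt_1 by (simp add: b.hom_nat_pow pow_vg mult_vg mod_simps)
          then have gM: "g \<otimes> y [^] n \<in> M" using z g yc by (simp add: M_def)
          have "y [^] n \<in> H" for n :: nat
            by (induction n) (use y(1) H(1) in \<open>auto simp: subgroup.one_closed subgroup.m_closed\<close>)
          then have "(g \<otimes> y [^] n) \<otimes> inv (y [^] n) \<in> H"
            using gM H by (meson subgroup.m_closed subgroup.m_inv_closed subsetD)
          then show ?thesis using g yc by (simp add: m_assoc)
        qed
        then have "H = carrier G" using subgroup.subset[OF H(1)] by blast
        then show ?thesis by simp
      qed simp
      then have "maximal_subgroup M G" using M xM xc unfolding maximal_subgroup_def by blast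
      then show False using x xM by (auto simp: frattini_def)
    qed
    then show "x \<in> {x \<in> carrier G. \<beta> x = \<one>\<^bsub>vg p d\<^esub>}" using xc by simp
  qed
  have fsub: "subgroup (frattini G) G"
  proof (rule finite_closed_subgroup[OF fin])
    have "\<one> \<in> frattini G" by (simp add: frattini_def maximal_subgroup_def subgroup.one_closed)
    then show "frattini G \<noteq> {}" by blast
    show "a \<otimes> b \<in> frattini G" if "a \<in> frattini G" "b \<in> frattini G" for a b
      using that by (auto simp: frattini_def maximal_subgroup_def intro: subgroup.m_closed)
  qed (auto simp: frattini_def)
  have cen: "frattini G \<subseteq> group_center G" and pw: "\<And>x. x \<in> frattini G \<Longrightarrow> x [^] p = \<one>"
    using sub ker by auto
  interpret F: group "G\<lparr>carrier := frattini G\<rparr>" by (rule subgroup_imp_group[OF fsub])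
  have "comm_group (G\<lparr>carrier := frattini G\<rparr>)"
    by (rule F.group_comm_groupI) (use cen in \<open>auto simp: group_center_def\<close>)
  moreover have "x [^]\<^bsub>G\<lparr>carrier := frattini G\<rparr>\<^esub> p = \<one>" if "x \<in> frattini G" for x
    using pw[OF that] nat_pow_consistent[of x p "frattini G"] by simp
  ultimately have "elementary_abelian p (G\<lparr>carrier := frattini G\<rparr>)" by (simp add: elementary_abelian_def)
  then show ?thesis using cen ord is_group by (auto simp: class_H_def p_group_def)
qed

lemma class_B_criterion:
  fixes G (structure)
  assumes "group G" and p: "prime p" and ord: "order G = p ^ l"
    and \<beta>: "\<beta> \<in> hom G (vg p d)"
    and ker: "\<And>x. x \<in> carrier G \<Longrightarrow> \<beta> x = \<one>\<^bsub>vg p d\<^esub> \<Longrightarrow> x \<in> group_center G"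
    and pw: "\<And>x. x \<in> carrier G \<Longrightarrow> x [^] p = \<one>"
  shows "class_B p G"
proof -
  interpret group G by fact
  interpret V: elab "vg p d" p by (rule elab_vg[OF p])
  interpret b: group_hom G "vg p d" \<beta> using \<beta> by unfold_locales
  have "h1 \<otimes> h2 \<otimes> inv h1 \<otimes> inv h2 \<in> group_center G" if h: "h1 \<in> carrier G" "h2 \<in> carrier G" for h1 h2
  proof (rule ker)
    have "\<beta> h1 \<otimes>\<^bsub>vg p d\<^esub> \<beta> h2 \<otimes>\<^bsub>vg p d\<^esub> inv\<^bsub>vg p d\<^esub> \<beta> h1 \<otimes>\<^bsub>vg p d\<^esub> inv\<^bsub>vg p d\<^esub> \<beta> h2
      = \<beta> h2 \<otimes>\<^bsub>vg p d\<^esub> (\<beta> h1 \<otimes>\<^bsub>vg p d\<^esub> inv\<^bsub>vg p d\<^esub> \<beta> h1) \<otimes>\<^bsub>vg p d\<^esub> inv\<^bsub>vg p d\<^esub> \<beta> h2"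
      using V.m_comm[OF b.hom_closed[OF h(1)] b.hom_closed[OF h(2)]] h by (simp add: V.m_assoc)
    then show "\<beta> (h1 \<otimes> h2 \<otimes> inv h1 \<otimes> inv h2) = \<one>\<^bsub>vg p d\<^esub>" using h by simp
  qed (use h in simp)
  then have "derived G (carrier G) \<subseteq> group_center G"
    unfolding derived_def by (intro generate_subgroup_incl[OF _ center_subgroup]) auto
  then show ?thesis using pw ord is_group by (auto simp: class_B_def p_group_def)
qed

text \<open>Classes are counted among groups on subsets of \<open>nat\<close>, whereas the twisted
  products live on pairs of functions.\<close>

lemma nat_copy:
  fixes G :: "('a, 'b) monoid_scheme" (structure)
  assumes "group G" "finite (carrier G)"
  obtains N :: "nat monoid" and f where "group N" "f \<in> iso N G"
proof -
  interpret group G by fact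
  obtain g :: "'a \<Rightarrow> nat" where inj: "inj_on g (carrier G)"
    using finite_imp_inj_to_nat_seg[OF assms(2)] by auto
  let ?i = "inv_into (carrier G) g"
  define N where "N = \<lparr>carrier = g ` carrier G, monoid.mult = (\<lambda>x y. g (?i x \<otimes> ?i y)), one = g \<one>\<rparr>"
  have i: "?i (g x) = x" if "x \<in> carrier G" for x using that inj by simp
  have "monoid N"
    by (rule monoidI) (auto simp: N_def i m_assoc)
  moreover have giso: "g \<in> iso G N" using inj by (auto simp: iso_def hom_def bij_betw_def N_def i)
  ultimately have N: "group N" using iso_imp_group[of N] by (auto intro: is_isoI)
  obtain f where "f \<in> iso N G" using iso_set_sym[OF giso] by blast
  then show ?thesis using that N by blast
qed

lemma sc_cocycle_unit:
  assumes ij: "i < j" "j < d" and p: "p > 1"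
  shows "sc_cocycle p d c e (unitv d j) (unitv d i) k = c (i, j) k"
    "sc_cocycle p d c e (unitv d i) (unitv d j) k = 0"
proof -
  have carry: "(\<Sum>n<d. e n k * ((unitv d i n + unitv d j n) div p)) = 0"
    using ij p by (intro sum.neutral) (auto simp: unitv_def)
  have carry': "(\<Sum>n<d. e n k * ((unitv d j n + unitv d i n) div p)) = 0"
    using ij p by (intro sum.neutral) (auto simp: unitv_def)
  have mem: "(i, j) \<in> pairs d" using ij by (simp add: pairs_def)
  have "(\<Sum>(i', j')\<in>pairs d. unitv d j j' * unitv d i i' * c (i', j') k)
    = (\<Sum>q\<in>pairs d. if q = (i, j) then c (i, j) k else 0)"
    by (rule sum.cong) (auto simp: unitv_def pairs_def split: if_splits)
  also have "\<dots> = c (i, j) k" using mem finite_pairs by simp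
  finally show "sc_cocycle p d c e (unitv d j) (unitv d i) k = c (i, j) k"
    unfolding sc_cocycle_def carry' by simp
  have "(\<Sum>(i', j')\<in>pairs d. unitv d i j' * unitv d j i' * c (i', j') k) = 0"
    using ij by (intro sum.neutral) (auto simp: unitv_def pairs_def)
  then show "sc_cocycle p d c e (unitv d i) (unitv d j) k = 0"
    unfolding sc_cocycle_def carry by simp
qed

section \<open>Commutators and powers in the twisted products\<close>

locale sc_group =
  fixes p d s :: nat and c :: "nat \<times> nat \<Rightarrow> nat \<Rightarrow> nat" and e :: "nat \<Rightarrow> nat \<Rightarrow> nat"
  assumes prime: "prime p"
    and c_mem: "\<And>i j. (i, j) \<in> pairs d \<Longrightarrow> c (i, j) \<in> carrier (vg p s)"
    and e_mem: "\<And>i. i < d \<Longrightarrow> e i \<in> carrier (vg p s)"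

sublocale sc_group \<subseteq> twisted_group p d s "sc_cocycle p d c e"
  by (rule twisted_sc[OF prime])

context sc_group
begin

definition gen :: "nat \<Rightarrow> (nat \<Rightarrow> nat) \<times> (nat \<Rightarrow> nat)" where
  "gen i = (unitv d i, \<one>\<^bsub>vg p s\<^esub>)"

lemma gen_closed: "gen i \<in> carrier E"
  using unitv_closed[OF p_gt_1] by (simp add: gen_def carrier_E)

lemma gen_comm:
  assumes "i < j" "j < d"
  shows "gen j \<otimes>\<^bsub>E\<^esub> gen i = incl_W (c (i, j)) \<otimes>\<^bsub>E\<^esub> (gen i \<otimes>\<^bsub>E\<^esub> gen j)"
proof -
  have cm: "c (i, j) \<in> carrier (vg p s)" using c_mem assms by (simp add: pairs_def)
  have u: "unitv d i \<in> carrier (vg p d)" "unitv d j \<in> carrier (vg p d)" by (rule unitv_closed[OF p_gt_1])+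
  have "gen j \<otimes>\<^bsub>E\<^esub> gen i = (unitv d j \<otimes>\<^bsub>vg p d\<^esub> unitv d i, \<lambda>k\<in>{..<s}. c (i, j) k mod p)"
    by (auto simp: sc_cocycle_unit[OF assms p_gt_1] gen_def mult_E one_vg[of p s] intro!: restrict_ext)
  also have "\<dots> = (unitv d j \<otimes>\<^bsub>vg p d\<^esub> unitv d i, c (i, j))" using W_mod[OF cm] by simp
  finally have 1: "gen j \<otimes>\<^bsub>E\<^esub> gen i = (unitv d j \<otimes>\<^bsub>vg p d\<^esub> unitv d i, c (i, j))" .
  have 2: "gen i \<otimes>\<^bsub>E\<^esub> gen j = (unitv d i \<otimes>\<^bsub>vg p d\<^esub> unitv d j, \<one>\<^bsub>vg p s\<^esub>)"
    by (auto simp: sc_cocycle_unit[OF assms p_gt_1] gen_def mult_E one_vg[of p s] intro!: restrict_ext)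
  show ?thesis unfolding 1 2 using incl_W_mult(1)[of "unitv d i \<otimes>\<^bsub>vg p d\<^esub> unitv d j" "c (i, j)"] cm u V.m_comm[OF u]
    by simp
qed

text \<open>Up to the exponent \<open>p - 1\<close> there is no carry and the second component stays
  trivial; the last factor produces a single carry, in coordinate \<open>i\<close>, and with it
  \<open>e i\<close>.\<close>

lemma gen_pow:
  assumes i: "i < d"
  shows "gen i [^]\<^bsub>E\<^esub> p = incl_W (e i)"
proof -
  define u where "u = (\<lambda>n. \<lambda>k\<in>{..<d}. if k = i then n else (0::nat))"
  have B0: "(\<Sum>(i', j')\<in>pairs d. u n j' * unitv d i i' * c (i', j') k) = 0" for n k
    by (rule sum.neutral) (auto simp: u_def unitv_def pairs_def)
  have carry: "(\<Sum>m<d. e m k * ((u n m + unitv d i m) div p)) = e i k * ((n + 1) div p)" for n k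
  proof -
    have "(\<Sum>m<d. e m k * ((u n m + unitv d i m) div p)) = (\<Sum>m<d. if m = i then e i k * ((n + 1) div p) else 0)"
      by (rule sum.cong) (use p_gt_1 in \<open>auto simp: u_def unitv_def\<close>)
    then show ?thesis using i by simp
  qed
  have step: "(u n, \<one>\<^bsub>vg p s\<^esub>) \<otimes>\<^bsub>E\<^esub> gen i = (u n \<otimes>\<^bsub>vg p d\<^esub> unitv d i, \<lambda>k\<in>{..<s}. (e i k * ((n + 1) div p)) mod p)" for n
    unfolding gen_def mult_E sc_cocycle_def B0 carry by (auto simp: one_vg[of p s] intro!: restrict_ext)
  have pw: "gen i [^]\<^bsub>E\<^esub> n = (u n, \<one>\<^bsub>vg p s\<^esub>)" if "n < p" for n
    using that
  proof (induction n)
    case 0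
    then show ?case by (auto simp: one_E u_def one_vg[of p d])
  next
    case (Suc n)
    then have "gen i [^]\<^bsub>E\<^esub> Suc n = (u n, \<one>\<^bsub>vg p s\<^esub>) \<otimes>\<^bsub>E\<^esub> gen i" by simp
    also have "\<dots> = (u (Suc n), \<one>\<^bsub>vg p s\<^esub>)"
      unfolding step using Suc.prems by (auto simp: mult_vg u_def unitv_def one_vg intro!: restrict_ext)
    finally show ?case .
  qed
  have "gen i [^]\<^bsub>E\<^esub> Suc (p - 1) = (u (p - 1), \<one>\<^bsub>vg p s\<^esub>) \<otimes>\<^bsub>E\<^esub> gen i"
    unfolding Group.nat_pow_Suc using pw[of "p - 1"] p_gt_1 by simp
  also have "\<dots> = (\<one>\<^bsub>vg p d\<^esub>, \<lambda>k\<in>{..<s}. e i k mod p)"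
    unfolding step using p_gt_1 by (auto simp: mult_vg u_def unitv_def one_vg intro!: restrict_ext)
  finally show ?thesis using p_gt_1 W_mod[OF e_mem[OF i]] by (simp add: incl_W_def)
qed

text \<open>Without carries the cocycle is bilinear modulo \<open>p\<close>, so its value at
  \<open>a [^] m\<close> and \<open>a\<close> is \<open>m\<close> times that at \<open>a\<close> and
  \<open>a\<close>; summing over \<open>m < n\<close> gives the binomial coefficient.\<close>

lemma pow_formula:
  assumes e0: "\<And>i k. i < d \<Longrightarrow> k < s \<Longrightarrow> e i k = 0" and a: "a \<in> carrier (vg p d)" and b: "b \<in> carrier (vg p s)"
  shows "(a, b) [^]\<^bsub>E\<^esub> n = (a [^]\<^bsub>vg p d\<^esub> n, \<lambda>k\<in>{..<s}. (n * b k + (n choose 2) * sc_cocycle p d c e a a k) mod p)"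
proof (induction n)
  case 0
  then show ?case by (auto simp: one_E one_vg numeral_2_eq_2 intro!: restrict_ext)
next
  case (Suc n)
  let ?\<omega> = "sc_cocycle p d c e"
  have lin: "[?\<omega> (a [^]\<^bsub>vg p d\<^esub> m) a k = m * ?\<omega> a a k] (mod p)" if k: "k < s" for m k
  proof (induction m)
    case 0
    then show ?case using normalized(2)[OF a] by simp
  next
    case (Suc m)
    have nc: "?\<omega> x y k = (\<Sum>(i, j)\<in>pairs d. x j * y i * c (i, j) k)" for x y
      using e0 k by (simp add: sc_cocycle_def)
    have "[?\<omega> (a [^]\<^bsub>vg p d\<^esub> Suc m) a k = ?\<omega> (a [^]\<^bsub>vg p d\<^esub> m) a k + ?\<omega> a a k] (mod p)"
      using cong_bilinear(1)[of p d "a [^]\<^bsub>vg p d\<^esub> m" a a c k] unfolding nc by simp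
    also have "[?\<omega> (a [^]\<^bsub>vg p d\<^esub> m) a k + ?\<omega> a a k = m * ?\<omega> a a k + ?\<omega> a a k] (mod p)"
      by (rule cong_add[OF Suc cong_refl])
    finally show ?case by (simp add: add.commute)
  qed
  have st: "((n * b k + (n choose 2) * ?\<omega> a a k) mod p + b k + ?\<omega> (a [^]\<^bsub>vg p d\<^esub> n) a k) mod p
    = (Suc n * b k + (Suc n choose 2) * ?\<omega> a a k) mod p" if "k < s" for k
  proof -
    have "((n * b k + (n choose 2) * ?\<omega> a a k) mod p + b k + ?\<omega> (a [^]\<^bsub>vg p d\<^esub> n) a k) mod p
      = (n * b k + (n choose 2) * ?\<omega> a a k + b k + ?\<omega> (a [^]\<^bsub>vg p d\<^esub> n) a k) mod p"
      unfolding mod_add_inner ..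
    also have "\<dots> = (n * b k + (n choose 2) * ?\<omega> a a k + b k + n * ?\<omega> a a k) mod p"
      using lin[OF that, of n] unfolding cong_def by (metis mod_add_right_eq)
    also have "\<dots> = (Suc n * b k + (Suc n choose 2) * ?\<omega> a a k) mod p"
      by (rule arg_cong[of _ _ "\<lambda>x. x mod p"]) (simp add: numeral_2_eq_2 algebra_simps)
    finally show ?thesis .
  qed
  have "(a, b) [^]\<^bsub>E\<^esub> Suc n = (a [^]\<^bsub>vg p d\<^esub> Suc n,
      \<lambda>k\<in>{..<s}. ((\<lambda>k\<in>{..<s}. (n * b k + (n choose 2) * ?\<omega> a a k) mod p) k + b k + ?\<omega> (a [^]\<^bsub>vg p d\<^esub> n) a k) mod p)"
    unfolding Group.nat_pow_Suc Suc mult_E by (rule refl)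
  also have "\<dots> = (a [^]\<^bsub>vg p d\<^esub> Suc n, \<lambda>k\<in>{..<s}. (Suc n * b k + (Suc n choose 2) * ?\<omega> a a k) mod p)"
  proof (intro arg_cong2[of _ _ _ _ Pair] refl restrict_ext)
    fix k assume k: "k \<in> {..<s}"
    then have "k < s" by simp
    from st[OF this] show "((\<lambda>k\<in>{..<s}. (n * b k + (n choose 2) * ?\<omega> a a k) mod p) k + b k + ?\<omega> (a [^]\<^bsub>vg p d\<^esub> n) a k) mod p
      = (Suc n * b k + (Suc n choose 2) * ?\<omega> a a k) mod p"
      unfolding restrict_apply'[OF k] .
  qed
  finally show ?case .
qed

text \<open>For odd \<open>p\<close> the coefficient \<open>p choose 2\<close> is divisible by
  \<open>p\<close>; this is where \<open>p \<ge> 3\<close> enters.\<close>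

lemma exponent_p:
  assumes "\<And>i k. i < d \<Longrightarrow> k < s \<Longrightarrow> e i k = 0" "p \<ge> 3" "x \<in> carrier E"
  shows "x [^]\<^bsub>E\<^esub> p = \<one>\<^bsub>E\<^esub>"
proof -
  obtain a b where x: "x = (a, b)" "a \<in> carrier (vg p d)" "b \<in> carrier (vg p s)"
    using assms(3) by (auto simp: carrier_E)
  have "odd p" using prime assms(2) prime_odd_nat by simp
  then have "p choose 2 = p * ((p - 1) div 2)" by (simp add: choose_two div_mult_swap)
  then have "(p * b k + (p choose 2) * sc_cocycle p d c e a a k) mod p = 0" for k
    by (simp add: mult.assoc flip: add_mult_distrib2)
  then show ?thesis using pow_formula[OF assms(1) x(2,3), of p] V.pow_p[OF x(2)] x(1)
    by (simp add: one_E one_vg[of p s])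
qed

end

section \<open>Rigidity of normalised structure constants\<close>

text \<open>Central factors drop out of commutators and, having order dividing \<open>p\<close>, out
  of \<open>p\<close>-th powers; so \<open>\<theta>\<close> carries \<open>c1\<close> to
  \<open>c2\<close> and \<open>e1\<close> to \<open>e2\<close>. By \<open>norm\<close> every unit
  vector of \<open>vg p s\<close> occurs at the same place in both systems, hence
  \<open>\<theta>\<close> acts as the identity on \<open>vg p s\<close>, and all constants
  agree.\<close>

lemma sc_rigid:
  assumes g1: "sc_group p d s c1 e1" and g2: "sc_group p d s c2 e2"
    and \<theta>: "\<theta> \<in> iso (twisted p d s (sc_cocycle p d c1 e1)) (twisted p d s (sc_cocycle p d c2 e2))"
    and gens: "\<And>i. i < d \<Longrightarrow> \<exists>w\<in>carrier (twisted p d s (sc_cocycle p d c2 e2)).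
      (\<forall>x\<in>carrier (twisted p d s (sc_cocycle p d c2 e2)). w \<otimes>\<^bsub>twisted p d s (sc_cocycle p d c2 e2)\<^esub> x = x \<otimes>\<^bsub>twisted p d s (sc_cocycle p d c2 e2)\<^esub> w) \<and>
      w [^]\<^bsub>twisted p d s (sc_cocycle p d c2 e2)\<^esub> p = \<one>\<^bsub>twisted p d s (sc_cocycle p d c2 e2)\<^esub> \<and>
      \<theta> (sc_group.gen p d s i) = sc_group.gen p d s i \<otimes>\<^bsub>twisted p d s (sc_cocycle p d c2 e2)\<^esub> w"
    and norm: "\<And>k. k < s \<Longrightarrow> (\<exists>q\<in>pairs d. c1 q = unitv s k \<and> c2 q = unitv s k) \<or> (\<exists>i<d. e1 i = unitv s k \<and> e2 i = unitv s k)"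
  shows "\<And>q. q \<in> pairs d \<Longrightarrow> c1 q = c2 q" "\<And>i. i < d \<Longrightarrow> e1 i = e2 i"
proof -
  interpret A: sc_group p d s c1 e1 by fact
  interpret B: sc_group p d s c2 e2 by fact
  have \<theta>h: "\<theta> \<in> hom A.E B.E" using \<theta> by (simp add: iso_def)
  interpret t: group_hom A.E B.E \<theta> using \<theta>h by unfold_locales
  have Bc: "\<theta> (A.incl_W (c1 q)) = B.incl_W (c2 q)" if q: "q \<in> pairs d" for q
  proof -
    obtain i j where ij: "q = (i, j)" "i < j" "j < d" using q by (auto simp: pairs_def)
    obtain u where u: "u \<in> carrier B.E" "\<And>x. x \<in> carrier B.E \<Longrightarrow> u \<otimes>\<^bsub>B.E\<^esub> x = x \<otimes>\<^bsub>B.E\<^esub> u"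
      "\<theta> (A.gen i) = B.gen i \<otimes>\<^bsub>B.E\<^esub> u" using gens[of i] ij by auto
    obtain v where v: "v \<in> carrier B.E" "\<And>x. x \<in> carrier B.E \<Longrightarrow> v \<otimes>\<^bsub>B.E\<^esub> x = x \<otimes>\<^bsub>B.E\<^esub> v"
      "\<theta> (A.gen j) = B.gen j \<otimes>\<^bsub>B.E\<^esub> v" using gens[of j] ij by auto
    note gc = B.gen_closed[of i] B.gen_closed[of j]
    have cm: "c1 (i, j) \<in> carrier (vg p s)" "c2 (i, j) \<in> carrier (vg p s)" using A.c_mem B.c_mem q ij by auto
    have zc: "\<theta> (A.incl_W (c1 (i, j))) \<in> carrier B.E" using A.incl_W_closed[OF cm(1)] by simp
    have prod: "(x \<otimes>\<^bsub>B.E\<^esub> u') \<otimes>\<^bsub>B.E\<^esub> (y \<otimes>\<^bsub>B.E\<^esub> v') = (x \<otimes>\<^bsub>B.E\<^esub> y) \<otimes>\<^bsub>B.E\<^esub> (u' \<otimes>\<^bsub>B.E\<^esub> v')"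
      if "x \<in> carrier B.E" "y \<in> carrier B.E" "u' \<in> carrier B.E" "v' \<in> carrier B.E" "u' \<otimes>\<^bsub>B.E\<^esub> y = y \<otimes>\<^bsub>B.E\<^esub> u'" for x y u' v'
    proof -
      have "(x \<otimes>\<^bsub>B.E\<^esub> u') \<otimes>\<^bsub>B.E\<^esub> (y \<otimes>\<^bsub>B.E\<^esub> v') = x \<otimes>\<^bsub>B.E\<^esub> (u' \<otimes>\<^bsub>B.E\<^esub> y) \<otimes>\<^bsub>B.E\<^esub> v'"
        using that(1-4) by (simp add: B.E.m_assoc)
      also have "\<dots> = x \<otimes>\<^bsub>B.E\<^esub> (y \<otimes>\<^bsub>B.E\<^esub> u') \<otimes>\<^bsub>B.E\<^esub> v'" using that(5) by simp
      finally show ?thesis using that(1-4) by (simp add: B.E.m_assoc)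
    qed
    have "\<theta> (A.gen j \<otimes>\<^bsub>A.E\<^esub> A.gen i) = (B.gen j \<otimes>\<^bsub>B.E\<^esub> v) \<otimes>\<^bsub>B.E\<^esub> (B.gen i \<otimes>\<^bsub>B.E\<^esub> u)"
      using A.gen_closed u(3) v(3) by simp
    also have "\<dots> = (B.gen j \<otimes>\<^bsub>B.E\<^esub> B.gen i) \<otimes>\<^bsub>B.E\<^esub> (v \<otimes>\<^bsub>B.E\<^esub> u)"
      by (rule prod) (use gc u(1) v(1,2) in auto)
    also have "\<dots> = B.incl_W (c2 (i, j)) \<otimes>\<^bsub>B.E\<^esub> ((B.gen i \<otimes>\<^bsub>B.E\<^esub> B.gen j) \<otimes>\<^bsub>B.E\<^esub> (v \<otimes>\<^bsub>B.E\<^esub> u))"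
      unfolding B.gen_comm[OF ij(2,3)] using gc u(1) v(1) B.incl_W_closed[OF cm(2)] by (simp add: B.E.m_assoc)
    finally have l: "\<theta> (A.gen j \<otimes>\<^bsub>A.E\<^esub> A.gen i) = B.incl_W (c2 (i, j)) \<otimes>\<^bsub>B.E\<^esub> ((B.gen i \<otimes>\<^bsub>B.E\<^esub> B.gen j) \<otimes>\<^bsub>B.E\<^esub> (v \<otimes>\<^bsub>B.E\<^esub> u))" .
    have "\<theta> (A.gen j \<otimes>\<^bsub>A.E\<^esub> A.gen i) = \<theta> (A.incl_W (c1 (i, j))) \<otimes>\<^bsub>B.E\<^esub> ((B.gen i \<otimes>\<^bsub>B.E\<^esub> u) \<otimes>\<^bsub>B.E\<^esub> (B.gen j \<otimes>\<^bsub>B.E\<^esub> v))"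
      unfolding A.gen_comm[OF ij(2,3)] using A.gen_closed u(3) v(3) A.incl_W_closed[OF cm(1)] by simp
    also have "(B.gen i \<otimes>\<^bsub>B.E\<^esub> u) \<otimes>\<^bsub>B.E\<^esub> (B.gen j \<otimes>\<^bsub>B.E\<^esub> v) = (B.gen i \<otimes>\<^bsub>B.E\<^esub> B.gen j) \<otimes>\<^bsub>B.E\<^esub> (u \<otimes>\<^bsub>B.E\<^esub> v)"
      by (rule prod) (use gc v(1) u(1,2) in auto)
    also have "u \<otimes>\<^bsub>B.E\<^esub> v = v \<otimes>\<^bsub>B.E\<^esub> u" using u(2)[OF v(1)] .
    finally have "\<theta> (A.incl_W (c1 (i, j))) \<otimes>\<^bsub>B.E\<^esub> ((B.gen i \<otimes>\<^bsub>B.E\<^esub> B.gen j) \<otimes>\<^bsub>B.E\<^esub> (v \<otimes>\<^bsub>B.E\<^esub> u))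
      = B.incl_W (c2 (i, j)) \<otimes>\<^bsub>B.E\<^esub> ((B.gen i \<otimes>\<^bsub>B.E\<^esub> B.gen j) \<otimes>\<^bsub>B.E\<^esub> (v \<otimes>\<^bsub>B.E\<^esub> u))" using l by simp
    moreover have "(B.gen i \<otimes>\<^bsub>B.E\<^esub> B.gen j) \<otimes>\<^bsub>B.E\<^esub> (v \<otimes>\<^bsub>B.E\<^esub> u) \<in> carrier B.E" using gc u(1) v(1) by simp
    ultimately show ?thesis using zc B.incl_W_closed[OF cm(2)] ij(1) B.E.right_cancel by blast
  qed
  have Be: "\<theta> (A.incl_W (e1 i)) = B.incl_W (e2 i)" if i: "i < d" for i
  proof -
    obtain u where u: "u \<in> carrier B.E" "\<And>x. x \<in> carrier B.E \<Longrightarrow> u \<otimes>\<^bsub>B.E\<^esub> x = x \<otimes>\<^bsub>B.E\<^esub> u"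
      "u [^]\<^bsub>B.E\<^esub> p = \<one>\<^bsub>B.E\<^esub>" "\<theta> (A.gen i) = B.gen i \<otimes>\<^bsub>B.E\<^esub> u" using gens[of i] i by auto
    have "\<theta> (A.incl_W (e1 i)) = \<theta> (A.gen i) [^]\<^bsub>B.E\<^esub> p"
      using A.gen_pow[OF i] A.gen_closed by (simp flip: t.hom_nat_pow)
    also have "\<dots> = B.gen i [^]\<^bsub>B.E\<^esub> p \<otimes>\<^bsub>B.E\<^esub> u [^]\<^bsub>B.E\<^esub> p"
      unfolding u(4) by (rule B.E.pow_mult_distrib[OF u(2)[OF B.gen_closed, symmetric] B.gen_closed u(1)])
    also have "\<dots> = B.incl_W (e2 i)" using B.gen_pow[OF i] u(3) B.incl_W_closed[OF B.e_mem[OF i]] by simp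
    finally show ?thesis .
  qed
  have same: "\<theta> (A.incl_W w) = B.incl_W w" if w: "w \<in> carrier (vg p s)" for w
  proof (rule vg_hom_eq[OF A.prime B.E.is_group _ _ _ w])
    show "(\<lambda>w. \<theta> (A.incl_W w)) \<in> hom (vg p s) B.E" using Group.hom_compose[OF A.incl_W_hom \<theta>h] by (simp add: comp_def)
    show "(\<lambda>w. B.incl_W w) \<in> hom (vg p s) B.E" by (rule B.incl_W_hom)
    show "\<theta> (A.incl_W (unitv s k)) = B.incl_W (unitv s k)" if "k < s" for k
      using norm[OF that] Bc Be by metis
  qed
  show "c1 q = c2 q" if "q \<in> pairs d" for q
    using Bc[OF that] same[of "c1 q"] A.c_mem that by (cases q) (simp add: B.incl_W_def)
  show "e1 i = e2 i" if "i < d" for i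
    using Be[OF that] same[of "e1 i"] A.e_mem that by (simp add: B.incl_W_def)
qed

text \<open>\<open>CQ\<close> and \<open>EI\<close> say where each structure constant may lie, a
  singleton being a normalised one. Parameters whose groups are isomorphic to that of a fixed
  \<open>t\<close> are told apart by the images of the \<open>d\<close> generators in
  \<open>vg p d\<close>, which leaves at most \<open>p ^ (d * d)\<close> of them.\<close>

theorem card_sc_le:
  assumes p: "prime p"
    and CQ: "\<And>q. q \<in> pairs d \<Longrightarrow> CQ q \<subseteq> carrier (vg p s)" and EI: "\<And>i. i < d \<Longrightarrow> EI i \<subseteq> carrier (vg p s)"
    and norm: "\<And>k. k < s \<Longrightarrow> (\<exists>q\<in>pairs d. CQ q = {unitv s k}) \<or> (\<exists>i<d. EI i = {unitv s k})"
    and fin: "finite (groups_of_order P (p ^ (d + s)) // iso_rel P (p ^ (d + s)))"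
    and P: "\<And>c e N. c \<in> Pi\<^sub>E (pairs d) CQ \<Longrightarrow> e \<in> Pi\<^sub>E {..<d} EI \<Longrightarrow> group N \<Longrightarrow>
      N \<cong> twisted p d s (sc_cocycle p d c e) \<Longrightarrow> P N"
  shows "(\<Prod>q\<in>pairs d. card (CQ q)) * (\<Prod>i<d. card (EI i)) \<le> num_iso_classes P (p ^ (d + s)) * p ^ (d * d)"
proof -
  interpret V: elab "vg p d" p by (rule elab_vg[OF p])
  interpret W: elab "vg p s" p by (rule elab_vg[OF p])
  define D where "D = Pi\<^sub>E (pairs d) CQ \<times> Pi\<^sub>E {..<d} EI"
  define T where "T = (\<lambda>(c, e). twisted p d s (sc_cocycle p d c e))"
  have sc: "sc_group p d s c e" if "(c, e) \<in> D" for c e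
  proof
    show "c (i, j) \<in> carrier (vg p s)" if "(i, j) \<in> pairs d" for i j
      using \<open>(c, e) \<in> D\<close> CQ[OF that] that PiE_mem[of c "pairs d" CQ "(i, j)"] by (auto simp: D_def)
    show "e i \<in> carrier (vg p s)" if "i < d" for i
      using \<open>(c, e) \<in> D\<close> EI[OF that] that PiE_mem[of e "{..<d}" EI i] by (auto simp: D_def)
  qed (rule p)
  have finD: "finite D" unfolding D_def
    by (intro finite_cartesian_product finite_PiE finite_pairs finite_lessThan
        finite_subset[OF CQ W.fin] finite_subset[OF EI W.fin]) auto
  have "\<exists>N :: nat monoid. group N \<and> N \<cong> T t" if t: "t \<in> D" for t
  proof -
    obtain c e where ce: "t = (c, e)" by (cases t)
    interpret sc_group p d s c e using sc t ce by blast
    obtain N :: "nat monoid" and f where "group N" "f \<in> iso N E" by (rule nat_copy[OF group_E finite_E])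
    then show ?thesis unfolding ce T_def using is_isoI by auto
  qed
  then have "\<forall>t\<in>D. \<exists>N :: nat monoid. group N \<and> N \<cong> T t" by blast
  from bchoice[OF this] obtain F :: "_ \<Rightarrow> nat monoid" where F: "\<And>t. t \<in> D \<Longrightarrow> group (F t) \<and> F t \<cong> T t"
    by blast
  have "card D \<le> num_iso_classes P (p ^ (d + s)) * p ^ (d * d)"
  proof (rule num_iso_classes_ge[OF fin, where F = F])
    fix t assume t: "t \<in> D"
    obtain c e where ce: "t = (c, e)" by (cases t)
    interpret sc_group p d s c e using sc t ce by blast
    have "order (F t) = p ^ (d + s)" using iso_same_order[of _ "F t" "T t"] F[OF t] order_E
      unfolding is_iso_def ce T_def by auto
    then show "F t \<in> groups_of_order P (p ^ (d + s))"
      using F[OF t] P[of c e "F t"] t unfolding ce T_def D_def by (auto simp: groups_of_order_def)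
    let ?S = "{u \<in> D. F u \<cong> F t}"
    have iso: "\<exists>\<theta>. \<theta> \<in> iso (T u) (T t)" if u: "u \<in> ?S" for u
    proof -
      interpret Fu: group "F u" using F u by blast
      have uD: "u \<in> D" and ut: "F u \<cong> F t" using u by auto
      have "T u \<cong> F u" by (rule Fu.iso_sym[OF conjunct2[OF F[OF uD]]])
      then have "T u \<cong> T t" by (rule iso_trans[OF _ iso_trans[OF ut conjunct2[OF F[OF t]]]])
      then show ?thesis unfolding is_iso_def by auto
    qed
    then have "\<forall>u\<in>?S. \<exists>\<theta>. \<theta> \<in> iso (T u) (T t)" by blast
    from bchoice[OF this] obtain \<theta> where \<theta>: "\<And>u. u \<in> ?S \<Longrightarrow> \<theta> u \<in> iso (T u) (T t)" by blast
    define Q where "Q = (\<lambda>u. \<lambda>i\<in>{..<d}. fst (\<theta> u (sc_group.gen p d s i)))"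
    have "Q ` ?S \<subseteq> {..<d} \<rightarrow>\<^sub>E carrier (vg p d)"
    proof clarify
      fix c' e' assume u: "(c', e') \<in> D" "F (c', e') \<cong> F t"
      interpret u: sc_group p d s c' e' using sc u by blast
      have "\<theta> (c', e') (u.gen i) \<in> carrier E" for i
        using \<theta>[of "(c', e')"] u u.gen_closed[of i] unfolding T_def ce by (auto simp: iso_def hom_def)
      then have "fst (\<theta> (c', e') (u.gen i)) \<in> carrier (vg p d)" for i
        unfolding carrier_E mem_Times_iff by blast
      then show "Q (c', e') \<in> {..<d} \<rightarrow>\<^sub>E carrier (vg p d)" unfolding Q_def restrict_PiE_iff by blast
    qed
    moreover have "inj_on Q ?S"
    proof (rule inj_onI)
      fix u u' assume u: "u \<in> ?S" and u': "u' \<in> ?S" and eq: "Q u = Q u'"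
      obtain c1 e1 c2 e2 where cc: "u = (c1, e1)" "u' = (c2, e2)" by (cases u, cases u')
      have D1: "(c1, e1) \<in> D" "(c2, e2) \<in> D" using u u' cc by auto
      interpret A: sc_group p d s c1 e1 using sc D1 by blast
      interpret B: sc_group p d s c2 e2 using sc D1 by blast
      have i1: "\<theta> u \<in> iso A.E E" and i2: "\<theta> u' \<in> iso B.E E"
        using \<theta>[OF u] \<theta>[OF u'] unfolding cc ce T_def by auto
      \<comment> \<open>Equal records make the images of corresponding generators differ by an
        element of \<open>W\<close> inside \<open>E\<close>. Its image under \<open>\<phi>\<close>
        may fall outside \<open>W\<close> of \<open>B.E\<close> but is still central of order
        dividing \<open>p\<close>, whence the form of the hypothesis of
        \<open>sc_rigid\<close>.\<close>
      define \<phi> where "\<phi> = inv_into (carrier B.E) (\<theta> u')"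
      have i3: "\<phi> \<in> iso E B.E" unfolding \<phi>_def by (rule B.E.iso_set_sym[OF i2])
      have b2: "bij_betw (\<theta> u') (carrier B.E) (carrier E)" using i2 by (simp add: iso_def)
      have \<phi>\<theta>: "\<phi> (\<theta> u' x) = x" if "x \<in> carrier B.E" for x
        using b2 that unfolding \<phi>_def by (simp add: bij_betw_def)
      interpret f: group_hom E B.E \<phi> using i3 by unfold_locales (simp add: iso_def)
      have surj: "\<phi> ` carrier E = carrier B.E" using i3 by (simp add: iso_def bij_betw_def)
      have iso12: "\<phi> \<circ> \<theta> u \<in> iso A.E B.E" by (rule iso_set_trans[OF i1 i3])
      have gens: "\<exists>w\<in>carrier B.E. (\<forall>x\<in>carrier B.E. w \<otimes>\<^bsub>B.E\<^esub> x = x \<otimes>\<^bsub>B.E\<^esub> w) \<and> w [^]\<^bsub>B.E\<^esub> p = \<one>\<^bsub>B.E\<^esub> \<and>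
        (\<phi> \<circ> \<theta> u) (A.gen i) = B.gen i \<otimes>\<^bsub>B.E\<^esub> w" if i: "i < d" for i
      proof -
        have g: "\<theta> u (A.gen i) \<in> carrier E" "\<theta> u' (B.gen i) \<in> carrier E"
          using i1 i2 A.gen_closed B.gen_closed by (auto simp: iso_def hom_def)
        have fe: "fst (\<theta> u (A.gen i)) = fst (\<theta> u' (B.gen i))"
          using fun_cong[OF eq, of i] unfolding Q_def restrict_apply'[OF lessThan_iff[THEN iffD2, OF i]] .
        obtain w where w: "w \<in> carrier (vg p s)" "\<theta> u (A.gen i) = \<theta> u' (B.gen i) \<otimes>\<^bsub>E\<^esub> incl_W w"
          by (rule same_fst[OF g fe])
        have zc: "incl_W w \<in> carrier E" by (rule incl_W_closed[OF w(1)])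
        have "\<phi> (incl_W w) \<otimes>\<^bsub>B.E\<^esub> x = x \<otimes>\<^bsub>B.E\<^esub> \<phi> (incl_W w)" if "x \<in> carrier B.E" for x
        proof -
          have "x \<in> \<phi> ` carrier E" unfolding surj by fact
          then obtain y where y: "y \<in> carrier E" "x = \<phi> y" by (rule imageE) simp
          show ?thesis unfolding y(2) f.hom_mult[OF zc y(1), symmetric] f.hom_mult[OF y(1) zc, symmetric]
            using incl_W_central[OF w(1) y(1)] by simp
        qed
        moreover have "\<phi> (incl_W w) [^]\<^bsub>B.E\<^esub> p = \<one>\<^bsub>B.E\<^esub>"
          using incl_W_pow[OF w(1)] f.hom_nat_pow[OF zc, of p] by simp
        moreover have "(\<phi> \<circ> \<theta> u) (A.gen i) = B.gen i \<otimes>\<^bsub>B.E\<^esub> \<phi> (incl_W w)"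
          unfolding comp_def w(2) f.hom_mult[OF g(2) zc] \<phi>\<theta>[OF B.gen_closed] ..
        ultimately show ?thesis using f.hom_closed[OF zc] by (intro bexI[of _ "\<phi> (incl_W w)"]) auto
      qed
      have nrm: "(\<exists>q\<in>pairs d. c1 q = unitv s k \<and> c2 q = unitv s k) \<or> (\<exists>i<d. e1 i = unitv s k \<and> e2 i = unitv s k)" if "k < s" for k
        using norm[OF that]
      proof
        assume "\<exists>q\<in>pairs d. CQ q = {unitv s k}"
        then obtain q where q: "q \<in> pairs d" "CQ q = {unitv s k}" by blast
        then have "c1 q \<in> CQ q" "c2 q \<in> CQ q" using D1 unfolding D_def by (auto dest: PiE_mem)
        then show ?thesis using q by auto
      next
        assume "\<exists>i<d. EI i = {unitv s k}"
        then obtain i where i: "i < d" "EI i = {unitv s k}" by blast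
        then have "e1 i \<in> EI i" "e2 i \<in> EI i" using D1 unfolding D_def by (auto dest: PiE_mem)
        then show ?thesis using i by auto
      qed
      have PE: "c1 \<in> Pi\<^sub>E (pairs d) CQ" "c2 \<in> Pi\<^sub>E (pairs d) CQ" "e1 \<in> Pi\<^sub>E {..<d} EI" "e2 \<in> Pi\<^sub>E {..<d} EI"
        using D1 by (simp_all add: D_def)
      have r1: "c1 q = c2 q" if "q \<in> pairs d" for q
        by (rule sc_rigid(1)[OF A.sc_group_axioms B.sc_group_axioms iso12 gens nrm that])
      have r2: "e1 i = e2 i" if "i < d" for i
        by (rule sc_rigid(2)[OF A.sc_group_axioms B.sc_group_axioms iso12 gens nrm that])
      have "c1 = c2" by (rule PiE_ext[OF PE(1,2) r1])
      moreover have "e1 = e2" by (rule PiE_ext[OF PE(3,4)]) (simp add: r2)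
      ultimately show "u = u'" using cc by simp
    qed
    moreover have "finite ({..<d} \<rightarrow>\<^sub>E carrier (vg p d))" using V.fin by (simp add: finite_PiE)
    ultimately have "card ?S \<le> card ({..<d} \<rightarrow>\<^sub>E carrier (vg p d))" by (meson card_inj_on_le)
    also have "\<dots> = p ^ (d * d)" using order_vg[of p d] by (simp add: card_funcsetE order_def power_mult)
    finally show "finite ?S \<and> card ?S \<le> p ^ (d * d)" using finD by simp
  qed
  moreover have "card D = (\<Prod>q\<in>pairs d. card (CQ q)) * (\<Prod>i<d. card (EI i))"
    unfolding D_def by (simp add: card_cartesian_product card_PiE finite_pairs)
  ultimately show ?thesis by simp
qed

section \<open>The enumeration theorem\<close>

context sc_group
begin

lemma iso_copy_kernel:
  assumes N: "group N" and f: "f \<in> iso N E" and x: "x \<in> carrier N" "fst (f x) = \<one>\<^bsub>vg p d\<^esub>"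
  shows "x \<in> group_center N \<and> x [^]\<^bsub>N\<^esub> p = \<one>\<^bsub>N\<^esub>"
proof -
  interpret N: group N by fact
  interpret f: group_hom N E f using f by unfold_locales (simp add: iso_def)
  have inj: "inj_on f (carrier N)" using f by (simp add: iso_def bij_betw_def)
  have z: "f x = incl_W (snd (f x))" "snd (f x) \<in> carrier (vg p s)" using fst_one[OF f.hom_closed[OF x(1)] x(2)] by auto
  have "x \<otimes>\<^bsub>N\<^esub> g = g \<otimes>\<^bsub>N\<^esub> x" if g: "g \<in> carrier N" for g
  proof (rule inj_onD[OF inj])
    show "f (x \<otimes>\<^bsub>N\<^esub> g) = f (g \<otimes>\<^bsub>N\<^esub> x)"
      unfolding f.hom_mult[OF x(1) g] f.hom_mult[OF g x(1)] using incl_W_central[OF z(2) f.hom_closed[OF g]] z(1) by simp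
  qed (use x g in auto)
  moreover have "x [^]\<^bsub>N\<^esub> p = \<one>\<^bsub>N\<^esub>"
  proof (rule inj_onD[OF inj])
    show "f (x [^]\<^bsub>N\<^esub> p) = f \<one>\<^bsub>N\<^esub>"
      unfolding f.hom_nat_pow[OF x(1)] f.hom_one using incl_W_pow[OF z(2)] z(1) by simp
  qed (use x in auto)
  ultimately show ?thesis using x by (simp add: group_center_def)
qed

lemma iso_copy_class_H:
  assumes N: "group N" "N \<cong> E"
  shows "class_H p N"
proof -
  obtain f where f: "f \<in> iso N E" using N(2) by (auto simp: is_iso_def)
  have "order N = p ^ (d + s)" using iso_same_order[OF f] order_E by simp
  moreover have "fst \<circ> f \<in> hom N (vg p d)"
    using f fst_hom by (intro Group.hom_compose[of _ _ E]) (auto simp: iso_def)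
  ultimately show ?thesis
    by (rule class_H_criterion[OF N(1) prime]) (use iso_copy_kernel[OF N(1) f] in auto)
qed

lemma iso_copy_class_B:
  assumes N: "group N" "N \<cong> E" and "p \<ge> 3" and e0: "\<And>i k. i < d \<Longrightarrow> k < s \<Longrightarrow> e i k = 0"
  shows "class_B p N"
proof -
  obtain f where f: "f \<in> iso N E" using N(2) by (auto simp: is_iso_def)
  interpret N: group N by fact
  interpret f: group_hom N E f using f by unfold_locales (simp add: iso_def)
  have inj: "inj_on f (carrier N)" using f by (simp add: iso_def bij_betw_def)
  have ord: "order N = p ^ (d + s)" using iso_same_order[OF f] order_E by simp
  have h: "fst \<circ> f \<in> hom N (vg p d)"
    using f fst_hom by (intro Group.hom_compose[of _ _ E]) (auto simp: iso_def)
  have pw: "x [^]\<^bsub>N\<^esub> p = \<one>\<^bsub>N\<^esub>" if x: "x \<in> carrier N" for x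
  proof (rule inj_onD[OF inj])
    show "f (x [^]\<^bsub>N\<^esub> p) = f \<one>\<^bsub>N\<^esub>"
      unfolding f.hom_nat_pow[OF x] f.hom_one by (rule exponent_p[OF e0 assms(3) f.hom_closed[OF x]])
  qed (use x in auto)
  show ?thesis
    by (rule class_B_criterion[OF N(1) prime ord h _ pw]) (use iso_copy_kernel[OF N(1) f] in auto)
qed

end

lemma card_pairs: "card (pairs d) = d * (d - 1) div 2"
  using card_increasing_pairs(1)[of 0 d] by (simp add: pairs_def)

text \<open>The commutators of generator 0 with the generators \<open>1, ..., s\<close> are
  normalised, \<open>(0, k + 1)\<close> receiving \<open>unitv s k\<close>; this takes
  \<open>s < d\<close>. The value \<open>s = 0\<close> serves small orders.\<close>

lemma f_B_count:
  assumes p: "prime p" "p \<ge> 3" and s: "s = 0 \<or> s < d" and l: "d + s \<ge> 1"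
  shows "p ^ (s * (d * (d - 1) div 2 - s)) \<le> f_B p (p ^ (d + s)) * p ^ (d * d)"
proof -
  interpret V: elab "vg p d" p by (rule elab_vg[OF p(1)])
  interpret W: elab "vg p s" p by (rule elab_vg[OF p(1)])
  define T where "T = (\<lambda>j. (0::nat, j)) ` {1..s}"
  define CQ where "CQ = (\<lambda>q. if q \<in> T then {unitv s (snd q - 1)} else carrier (vg p s))"
  define EI where "EI = (\<lambda>i::nat. {\<one>\<^bsub>vg p s\<^esub>})"
  have TP: "T \<subseteq> pairs d" using s by (auto simp: T_def pairs_def)
  have cT: "card T = s" by (simp add: T_def card_image inj_on_def)
  have CQs: "CQ q \<subseteq> carrier (vg p s)" for q using unitv_closed[OF V.p_gt_1] by (auto simp: CQ_def)
  have "(\<Prod>q\<in>pairs d. card (CQ q)) * (\<Prod>i<d. card (EI i))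
    \<le> num_iso_classes (class_B p) (p ^ (d + s)) * p ^ (d * d)"
  proof (rule card_sc_le[OF p(1) CQs _ _ f_B_upper(1)[OF p(1) l]])
    show "EI i \<subseteq> carrier (vg p s)" for i by (simp add: EI_def)
    show "(\<exists>q\<in>pairs d. CQ q = {unitv s k}) \<or> (\<exists>i<d. EI i = {unitv s k})" if "k < s" for k
    proof -
      have "(0, Suc k) \<in> T" using that by (auto simp: T_def)
      then show ?thesis using TP by (intro disjI1 bexI[of _ "(0, Suc k)"]) (auto simp: CQ_def)
    qed
    fix c e and N :: "nat monoid"
    assume c: "c \<in> Pi\<^sub>E (pairs d) CQ" and e: "e \<in> Pi\<^sub>E {..<d} EI" and N: "group N" "N \<cong> twisted p d s (sc_cocycle p d c e)"
    have e1: "e i = \<one>\<^bsub>vg p s\<^esub>" if "i < d" for i using e that by (auto simp: EI_def dest: PiE_mem)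
    interpret sc_group p d s c e
    proof
      show "c (i, j) \<in> carrier (vg p s)" if "(i, j) \<in> pairs d" for i j
        using PiE_mem[OF c that] CQs by blast
    qed (use p e1 in auto)
    show "class_B p N" by (rule iso_copy_class_B[OF N p(2)]) (simp add: e1 one_vg)
  qed
  moreover have "(\<Prod>q\<in>pairs d. card (CQ q)) = p ^ (s * (d * (d - 1) div 2 - s))"
  proof -
    have "(\<Prod>q\<in>pairs d. card (CQ q)) = (\<Prod>q\<in>pairs d - T. card (CQ q)) * (\<Prod>q\<in>T. card (CQ q))"
      by (rule prod.subset_diff[OF TP finite_pairs])
    also have "(\<Prod>q\<in>T. card (CQ q)) = 1" by (rule prod.neutral) (simp add: CQ_def)
    also have "(\<Prod>q\<in>pairs d - T. card (CQ q)) = (\<Prod>q\<in>pairs d - T. p ^ s)"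
      using order_vg[of p s] by (intro prod.cong) (auto simp: CQ_def order_def)
    also have "\<dots> = p ^ (s * (d * (d - 1) div 2 - s))"
      using card_Diff_subset[OF finite_subset[OF TP finite_pairs] TP] by (simp add: card_pairs cT power_mult)
    finally show ?thesis by simp
  qed
  moreover have "(\<Prod>i<d. card (EI i)) = 1" by (simp add: EI_def)
  ultimately show ?thesis by (simp add: f_B_def)
qed

text \<open>Here the \<open>p\<close>-th powers of the first \<open>s\<close> generators are
  normalised, so all commutators and the other \<open>d - s\<close> powers remain free.\<close>

lemma f_H_count:
  assumes p: "prime p" and s: "s \<le> d" and l: "d + s \<ge> 1"
  shows "p ^ (s * (d * (d - 1) div 2) + s * (d - s)) \<le> f_H p (p ^ (d + s)) * p ^ (d * d)"
proof -
  interpret V: elab "vg p d" p by (rule elab_vg[OF p(1)])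
  interpret W: elab "vg p s" p by (rule elab_vg[OF p(1)])
  define CQ where "CQ = (\<lambda>q :: nat \<times> nat. carrier (vg p s))"
  define EI where "EI = (\<lambda>i. if i < s then {unitv s i} else carrier (vg p s))"
  have EIs: "EI i \<subseteq> carrier (vg p s)" for i using unitv_closed[OF V.p_gt_1] by (auto simp: EI_def)
  have cW: "card (carrier (vg p s)) = p ^ s" using order_vg[of p s] by (simp add: order_def)
  have "(\<Prod>q\<in>pairs d. card (CQ q)) * (\<Prod>i<d. card (EI i))
    \<le> num_iso_classes (class_H p) (p ^ (d + s)) * p ^ (d * d)"
  proof (rule card_sc_le[OF p _ EIs _ f_H_upper(1)[OF p l]])
    show "CQ q \<subseteq> carrier (vg p s)" for q by (simp add: CQ_def)
    show "(\<exists>q\<in>pairs d. CQ q = {unitv s k}) \<or> (\<exists>i<d. EI i = {unitv s k})" if "k < s" for k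
      using that s by (intro disjI2 exI[of _ k]) (auto simp: EI_def)
    fix c e and N :: "nat monoid"
    assume c: "c \<in> Pi\<^sub>E (pairs d) CQ" and e: "e \<in> Pi\<^sub>E {..<d} EI" and N: "group N" "N \<cong> twisted p d s (sc_cocycle p d c e)"
    interpret sc_group p d s c e
    proof
      show "c (i, j) \<in> carrier (vg p s)" if "(i, j) \<in> pairs d" for i j
        using PiE_mem[OF c that] by (simp add: CQ_def)
      show "e i \<in> carrier (vg p s)" if "i < d" for i using PiE_mem[OF e, of i] EIs that by auto
    qed (rule p)
    show "class_H p N" by (rule iso_copy_class_H[OF N])
  qed
  moreover have "(\<Prod>q\<in>pairs d. card (CQ q)) = p ^ (s * (d * (d - 1) div 2))"
    by (simp add: CQ_def cW card_pairs power_mult)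
  moreover have "(\<Prod>i<d. card (EI i)) = p ^ (s * (d - s))"
  proof -
    have sub: "{..<s} \<subseteq> {..<d}" using s by auto
    have "(\<Prod>i<d. card (EI i)) = (\<Prod>i\<in>{..<d} - {..<s}. card (EI i)) * (\<Prod>i<s. card (EI i))"
      by (rule prod.subset_diff[OF sub]) simp
    also have "(\<Prod>i<s. card (EI i)) = 1" by (rule prod.neutral) (simp add: EI_def)
    also have "(\<Prod>i\<in>{..<d} - {..<s}. card (EI i)) = (\<Prod>i\<in>{..<d} - {..<s}. p ^ s)"
      by (intro prod.cong) (auto simp: EI_def cW)
    also have "\<dots> = p ^ (s * (d - s))" using card_Diff_subset[OF _ sub] by (simp add: power_mult)
    finally show ?thesis by simp
  qed
  ultimately show ?thesis by (simp add: f_H_def power_add)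
qed

section \<open>Lower bounds at the optimal dimension\<close>

lemma powr_le_of_power_le:
  assumes p: "p > (1::nat)" and "p ^ a \<le> c * p ^ b" and "x \<le> real a - real b"
  shows "real p powr x \<le> real c"
proof -
  have "real p powr x \<le> real p powr (real a - real b)" using p assms(3) by (intro powr_mono) auto
  also have "\<dots> = real (p ^ a) / real (p ^ b)" using p by (simp add: powr_diff powr_realpow)
  also have "\<dots> \<le> real c"
  proof -
    have "real (p ^ a) \<le> real (c * p ^ b)" using assms(2) by (rule of_nat_mono)
    then show ?thesis using p by (simp add: divide_le_eq)
  qed
  finally show ?thesis .
qed

text \<open>Since \<open>2/27 * 6 = 4/9\<close>, the claimed lower bound is at most 1 up to length
  6, where it suffices that some group exists.\<close>

lemma small_exponent:
  fixes L a :: real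
  assumes "0 \<le> L" "L \<le> 6" "a \<ge> 4/9"
  shows "2/27 * L ^ 3 - a * L\<^sup>2 \<le> 0"
proof -
  have "2/27 * L ^ 3 - a * L\<^sup>2 = L\<^sup>2 * (2/27 * L - a)" by (simp add: power2_eq_square power3_eq_cube algebra_simps)
  also have "\<dots> \<le> 0" using assms by (intro mult_nonneg_nonpos) auto
  finally show ?thesis .
qed

text \<open>With \<open>k = l div 3\<close> the dimension used is \<open>2 * k\<close> or
  \<open>2 * k + 1\<close>. The bounds on \<open>k\<close> permit the substitutions
  \<open>k = n + 2\<close> and \<open>k = n + 3\<close>, which turn truncated subtractions into
  polynomials in \<open>n\<close>.\<close>

lemma length_cases:
  assumes "(l::nat) \<ge> 7"
  obtains k where "k \<ge> 2" "l = 3 * k + 1 \<or> l = 3 * k + 2" | k where "k \<ge> 3" "l = 3 * k"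
proof -
  have "l = 3 * (l div 3) + l mod 3" "l mod 3 < 3" by auto
  then consider "l mod 3 = 0" | "l mod 3 = 1" | "l mod 3 = 2" by linarith
  then show ?thesis
  proof cases
    case 1
    show ?thesis by (rule that(2)[of "l div 3"]) (use 1 assms in presburger)+
  next
    case 2
    show ?thesis by (rule that(1)[of "l div 3"]) (use 2 assms in presburger)+
  next
    case 3
    show ?thesis by (rule that(1)[of "l div 3"]) (use 3 assms in presburger)+
  qed
qed

lemma choose_div: "(2 * k) * (2 * k - 1) div 2 = k * (2 * k - 1)" "(2 * k + 1) * (2 * k + 1 - 1) div 2 = (2 * k + 1) * (k::nat)"
  by (simp_all add: mult.assoc)

lemma f_B_lower:
  assumes p: "prime p" "p \<ge> 3" and l: "l \<ge> 1"
  shows "real p powr (2/27 * real l ^ 3 - 2/3 * real l ^ 2) \<le> real (f_B p (p ^ l))"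
proof -
  have p1: "p > 1" using p by simp
  show ?thesis
  proof (cases "l \<ge> 7")
    case False
    \<comment> \<open>At \<open>s = 0\<close> the count only says that a group exists, the
      elementary abelian one.\<close>
    have "p ^ 0 \<le> f_B p (p ^ l) * p ^ (l * l)" using f_B_count[OF p, of 0 l] l by simp
    then have "f_B p (p ^ l) \<noteq> 0" by (metis mult_0 not_one_le_zero power_0)
    then have "1 \<le> real (f_B p (p ^ l))" by simp
    moreover have "real p powr (2/27 * real l ^ 3 - 2/3 * real l ^ 2) \<le> real p powr 0"
      using False p1 by (intro powr_mono small_exponent) auto
    ultimately show ?thesis using p1 by simp
  next
    case True
    then show ?thesis
    proof (cases rule: length_cases)
      case (1 k)
      show ?thesis using 1(2)
      proof
        \<comment> \<open>Here \<open>d = 2 k\<close> and \<open>s = k + 1\<close>; the exponent of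
          the count exceeds the claimed one by \<open>k/3 - 11/27\<close>.\<close>
        assume lk: "l = 3 * k + 1"
        have h: "k + 1 = 0 \<or> k + 1 < 2 * k" "2 * k + (k + 1) \<ge> 1" and l_eq: "2 * k + (k + 1) = l" using 1(1) lk by auto
        have c: "p ^ ((k + 1) * (k * (2 * k - 1) - (k + 1))) \<le> f_B p (p ^ l) * p ^ (2 * k * (2 * k))"
          by (rule f_B_count[OF p h, unfolded choose_div(1)[of k] l_eq])
        obtain n where n: "k = n + 2" using 1(1) by (metis le_Suc_ex add.commute)
        show ?thesis
          by (rule powr_le_of_power_le[OF p1 c])
            (simp add: lk n of_nat_diff power2_eq_square power3_eq_cube field_simps)
      next
        assume lk: "l = 3 * k + 2"
        have h: "k + 1 = 0 \<or> k + 1 < 2 * k + 1" "2 * k + 1 + (k + 1) \<ge> 1" and l_eq: "2 * k + 1 + (k + 1) = l" using 1(1) lk by auto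
        have c: "p ^ ((k + 1) * ((2 * k + 1) * k - (k + 1))) \<le> f_B p (p ^ l) * p ^ ((2 * k + 1) * (2 * k + 1))"
          by (rule f_B_count[OF p h, unfolded choose_div(2)[of k] l_eq])
        obtain n where n: "k = n + 2" using 1(1) by (metis le_Suc_ex add.commute)
        show ?thesis
          by (rule powr_le_of_power_le[OF p1 c])
            (simp add: lk n of_nat_diff power2_eq_square power3_eq_cube field_simps)
      qed
    next
      \<comment> \<open>With \<open>d = 2 k\<close> and \<open>s = k\<close> the count gives
        \<open>2 k^3 - 6 k^2\<close>, the claimed exponent without any slack.\<close>
      case (2 k)
      have h: "k = 0 \<or> k < 2 * k" "2 * k + (k) \<ge> 1" and l_eq: "2 * k + (k) = l" using 2(1) 2(2) by auto
      have c: "p ^ (k * (k * (2 * k - 1) - k)) \<le> f_B p (p ^ l) * p ^ (2 * k * (2 * k))"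
        by (rule f_B_count[OF p h, unfolded choose_div(1)[of k] l_eq])
      obtain n where n: "k = n + 3" using 2(1) by (metis add.commute le_Suc_ex)
      show ?thesis
        by (rule powr_le_of_power_le[OF p1 c])
          (simp add: 2(2) n of_nat_diff power2_eq_square power3_eq_cube field_simps)
    qed
  qed
qed

lemma f_H_lower:
  assumes p: "prime p" and l: "l \<ge> 1"
  shows "real p powr (2/27 * real l ^ 3 - 4/9 * real l ^ 2) \<le> real (f_H p (p ^ l))"
proof -
  have p1: "p > 1" using p by (rule prime_gt_1_nat)
  show ?thesis
  proof (cases "l \<ge> 7")
    case False
    have "p ^ 0 \<le> f_H p (p ^ l) * p ^ (l * l)" using f_H_count[OF p, of 0 l] l by simp
    then have "f_H p (p ^ l) \<noteq> 0" by (metis mult_0 not_one_le_zero power_0)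
    then have "1 \<le> real (f_H p (p ^ l))" by simp
    moreover have "real p powr (2/27 * real l ^ 3 - 4/9 * real l ^ 2) \<le> real p powr 0"
      using False p1 by (intro powr_mono small_exponent) auto
    ultimately show ?thesis using p1 by simp
  next
    case True
    then show ?thesis
    proof (cases rule: length_cases)
      case (1 k)
      show ?thesis using 1(2)
      proof
        assume lk: "l = 3 * k + 1"
        have h: "k + 1 \<le> 2 * k" "2 * k + (k + 1) \<ge> 1" and l_eq: "2 * k + (k + 1) = l" using 1(1) lk by auto
        have c: "p ^ ((k + 1) * (k * (2 * k - 1)) + (k + 1) * (2 * k - (k + 1))) \<le> f_H p (p ^ l) * p ^ (2 * k * (2 * k))"
          by (rule f_H_count[OF p h, unfolded choose_div(1)[of k] l_eq])
        obtain n where n: "k = n + 2" using 1(1) by (metis le_Suc_ex add.commute)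
        show ?thesis
          by (rule powr_le_of_power_le[OF p1 c])
            (simp add: lk n of_nat_diff power2_eq_square power3_eq_cube field_simps)
      next
        assume lk: "l = 3 * k + 2"
        have h: "k + 1 \<le> 2 * k + 1" "2 * k + 1 + (k + 1) \<ge> 1" and l_eq: "2 * k + 1 + (k + 1) = l" using 1(1) lk by auto
        have c: "p ^ ((k + 1) * ((2 * k + 1) * k) + (k + 1) * (2 * k + 1 - (k + 1))) \<le> f_H p (p ^ l) * p ^ ((2 * k + 1) * (2 * k + 1))"
          by (rule f_H_count[OF p h, unfolded choose_div(2)[of k] l_eq])
        obtain n where n: "k = n + 2" using 1(1) by (metis le_Suc_ex add.commute)
        show ?thesis
          by (rule powr_le_of_power_le[OF p1 c])
            (simp add: lk n of_nat_diff power2_eq_square power3_eq_cube field_simps)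
      qed
    next
      \<comment> \<open>Again without slack: both exponents are
        \<open>2 k^3 - 4 k^2\<close>.\<close>
      case (2 k)
      have h: "k \<le> 2 * k" "2 * k + (k) \<ge> 1" and l_eq: "2 * k + (k) = l" using 2(1) 2(2) by auto
      have c: "p ^ (k * (k * (2 * k - 1)) + k * (2 * k - k)) \<le> f_H p (p ^ l) * p ^ (2 * k * (2 * k))"
        by (rule f_H_count[OF p h, unfolded choose_div(1)[of k] l_eq])
      obtain n where n: "k = n + 3" using 2(1) by (metis add.commute le_Suc_ex)
      show ?thesis
        by (rule powr_le_of_power_le[OF p1 c])
          (simp add: 2(2) n of_nat_diff power2_eq_square power3_eq_cube field_simps)
    qed
  qed
qed

theorem theorem1p4:
  fixes p :: nat
  assumes "prime p"
  shows "\<exists>c::real. \<forall>l::nat. l \<ge> 1 \<longrightarrow>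
    (p \<ge> 3 \<longrightarrow>
       real p powr (2/27 * real l ^ 3 - 2/3 * real l ^ 2) \<le> real (f_B p (p ^ l)) \<and>
       real (f_B p (p ^ l)) \<le> real p powr (2/27 * real l ^ 3 - 2/3 * real l ^ 2 + c * real l)) \<and>
    real p powr (2/27 * real l ^ 3 - 4/9 * real l ^ 2) \<le> real (f_H p (p ^ l)) \<and>
    real (f_H p (p ^ l)) \<le> real p powr (2/27 * real l ^ 3 - 4/9 * real l ^ 2 + c * real l)"
  \<comment> \<open>The same constant 1001 serves every prime.\<close>
  using f_B_lower f_B_upper(2) f_H_lower f_H_upper(2) assms by (intro exI[of _ 1001]) blast

end
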